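(* Let $g:\mathbb{R}^d\to\mathbb{R}$ be twice differentiable with $\inf g=g_\star>-\infty$, with $\beta$-Lipschitz gradient, and with $2\rho$-Lipschitz Hessian, i.e. $\|\nabla^2g(y)-\nabla^2g(y')\|\le2\rho\|y-y'\|$ for all $y,y'\in\mathbb{R}^d$ (where $\beta,\rho>0$). Let $y_0\in\mathbb{R}^d$ be arbitrary, let $\delta\in(0,1]$, and let $0<\epsilon\le\min\{\beta^2/\rho,\ \rho^{1/3}(g(y_0)-g_\star)^{2/3}\}$. With probability at least $1-\delta$, the algorithm Find-SOSP$(y_0,g,\beta,\rho,\epsilon,\delta)$ finds a point $y_\epsilon$ satisfying $$\|\nabla g(y_\epsilon)\|\le\epsilon\quad\text{and}\quad\nabla^2g(y_\epsilon)\succeq-\sqrt{\rho\epsilon}\,I$$ in at most $$O(1)\cdot\frac{\beta^{1/2}\rho^{1/4}(g(y_0)-g_\star)}{\epsilon^{7/4}}\left[\log\frac{d}{\delta^2}+\log\frac{\beta^{1/2}\rho^{1/4}(g(y_0)-g_\star)}{\epsilon^{7/4}}\right]$$ Hessian-vector product evaluations and at most $$O(1)\cdot\frac{\sqrt\rho\,(g(y_0)-g_\star)}{\epsilon^{3/2}}$$ calls to the subroutine Solve-CR and gradient evaluations.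
   Context: $\|\cdot\|$ is the Euclidean norm (operator norm for matrices). $O(1)$ denotes a universal numerical constant. Krylov subspaces: $\mathcal{K}_t(A,b)=\mathrm{span}\{b,Ab,\dots,A^{t-1}b\}$ and $\mathcal{K}_t(A,\{b,u\})=\mathrm{span}\{b,Ab,\dots,A^{t-1}b,u,Au,\dots,A^{t-1}u\}$. Minimizing over $\mathcal{K}_t(A,b)$ (resp. $\mathcal{K}_t(A,\{b,u\})$) is counted as $t$ (resp. $2t$) matrix-vector products with $A$; when $A$ is a Hessian of $g$ these are Hessian-vector products. Find-SOSP$(y_0,g,\beta,\rho,\epsilon,\delta)$: set $r=\sqrt{\epsilon/(9\rho)}$. For $k=1,2,\dots$: let $\Delta_k=$ Solve-CR$(\nabla^2g(y_{k-1}),\nabla g(y_{k-1}),\rho,\beta,r,\frac{\delta}{2k^2})$ and $y_k=y_{k-1}+\Delta_k$. If $g(y_k)>g(y_{k-1})-\frac1{12}\rho r^3$, let $\Delta_{\mathrm{final}}=$ Solve-Quadratic$(\nabla^2g(y_{k-1}),\nabla g(y_{k-1}),\rho,\beta,r,\frac{2\epsilon}{3})$ and return $y_{k-1}+\Delta_{\mathrm{final}}$ (halt). Solve-CR$(A,b,\rho,\beta,r,\delta')$: draw $u$ uniformly from the unit sphere of $\mathbb{R}^d$, set $T_{\mathrm{inner}}=\left\lceil\sqrt{\frac{24\beta}{\rho r}\left(4+\frac12\log^2\frac{4d}{\delta'^2}\right)}\right\rceil$, and return a minimizer of $\frac12x^TAx+b^Tx+\frac\rho3\|x\|^3$ over $x\in\mathcal{K}_{T_{\mathrm{inner}}}(A,\{b,u\})$.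 Solve-Quadratic$(A,b,\rho,\beta,r,\epsilon_g)$: set $T_{\mathrm{final}}=\left\lceil\frac14\sqrt{\frac{\beta+2\rho r}{\rho r}}\log\frac{36(\beta+2\rho r)^2r^2}{\epsilon_g^2}\right\rceil$ and return a minimizer of $\frac12x^TAx+b^Tx+\rho r\|x\|^2$ over $x\in\mathcal{K}_{T_{\mathrm{final}}}(A,b)$.
   Formalization: For d = 1 the bracket in the Hessian-vector product bound is enlarged by 1, since both logarithms can be arbitrarily close to 0 (g(y)=y²/2, β=ρ=ε=1, y_0=√2, δ→1) while products are still made; for d ≥ 2 the bound is as stated, with O(1) taken as 10^6. *)

theory Defs
  imports "HOL-Probability.Probability"
begin

definition krylov :: "real^'n^'n \<Rightarrow> (real^'n) set \<Rightarrow> nat \<Rightarrow> (real^'n) set" where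
  "krylov A B t = span {((\<lambda>x. A *v x) ^^ i) b | i b. i < t \<and> b \<in> B}"

definition loewner_ge :: "real^'n^'n \<Rightarrow> real^'n^'n \<Rightarrow> bool" where
  "loewner_ge A B \<longleftrightarrow> (\<forall>x. 0 \<le> x \<bullet> ((A - B) *v x))"

(* Normalized surface measure of the unit sphere, as the cone measure: a uniform point of
   the unit ball, projected radially (sgn x = x / norm x; the origin is a null set). *)
definition uniform_sphere :: "(real^'n) measure" where
  "uniform_sphere = distr (uniform_measure lborel (cball 0 1)) borel sgn"

definition T_inner :: "nat \<Rightarrow> real \<Rightarrow> real \<Rightarrow> real \<Rightarrow> real \<Rightarrow> nat" where
  "T_inner d \<rho> \<beta> r \<delta>' =
     nat \<lceil>sqrt (24 * \<beta> / (\<rho> * r) * (4 + 1/2 * (ln (4 * real d / \<delta>'\<^sup>2))\<^sup>2))\<rceil>"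

definition T_final :: "real \<Rightarrow> real \<Rightarrow> real \<Rightarrow> real \<Rightarrow> nat" where
  "T_final \<rho> \<beta> r \<epsilon>\<^sub>g =
     nat \<lceil>1/4 * sqrt ((\<beta> + 2 * \<rho> * r) / (\<rho> * r))
          * ln (36 * (\<beta> + 2 * \<rho> * r)\<^sup>2 * r\<^sup>2 / \<epsilon>\<^sub>g\<^sup>2)\<rceil>"

(* "A minimizer" need not be unique, so both subroutines are given by the set of admissible
   return values; u is the random direction drawn by Solve-CR. *)
definition solve_cr ::
  "real^'n^'n \<Rightarrow> real^'n \<Rightarrow> real \<Rightarrow> real \<Rightarrow> real \<Rightarrow> real \<Rightarrow> real^'n \<Rightarrow> (real^'n) set" where
  "solve_cr A b \<rho> \<beta> r \<delta>' u =
     {x. is_arg_min (\<lambda>x. 1/2 * (x \<bullet> (A *v x)) + b \<bullet> x + \<rho> / 3 * norm x ^ 3)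
           (\<lambda>x. x \<in> krylov A {b, u} (T_inner CARD('n) \<rho> \<beta> r \<delta>')) x}"

definition solve_quadratic ::
  "real^'n^'n \<Rightarrow> real^'n \<Rightarrow> real \<Rightarrow> real \<Rightarrow> real \<Rightarrow> real \<Rightarrow> (real^'n) set" where
  "solve_quadratic A b \<rho> \<beta> r \<epsilon>\<^sub>g =
     {x. is_arg_min (\<lambda>x. 1/2 * (x \<bullet> (A *v x)) + b \<bullet> x + \<rho> * r * (norm x)\<^sup>2)
           (\<lambda>x. x \<in> krylov A {b} (T_final \<rho> \<beta> r \<epsilon>\<^sub>g)) x}"

definition step_radius :: "real \<Rightarrow> real \<Rightarrow> real" where
  "step_radius \<rho> \<epsilon> = sqrt (\<epsilon> / (9 * \<rho>))"

definition conf :: "real \<Rightarrow> nat \<Rightarrow> real" where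
  "conf \<delta> k = \<delta> / (2 * (real k)\<^sup>2)"

(* The halting test of iteration k, on a sequence of iterates y. *)
definition insufficient_decrease ::
  "(real^'n \<Rightarrow> real) \<Rightarrow> real \<Rightarrow> real \<Rightarrow> (nat \<Rightarrow> real^'n) \<Rightarrow> nat \<Rightarrow> bool" where
  "insufficient_decrease g \<rho> \<epsilon> y k \<longleftrightarrow>
     g (y k) > g (y (k - 1)) - 1/12 * \<rho> * step_radius \<rho> \<epsilon> ^ 3"

definition reaches_iteration ::
  "(real^'n \<Rightarrow> real) \<Rightarrow> real \<Rightarrow> real \<Rightarrow> (nat \<Rightarrow> real^'n) \<Rightarrow> nat \<Rightarrow> bool" where
  "reaches_iteration g \<rho> \<epsilon> y k \<longleftrightarrow>
     1 \<le> k \<and> (\<forall>j. 1 \<le> j \<and> j < k \<longrightarrow> \<not> insufficient_decrease g \<rho> \<epsilon> y j)"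

definition halts_at ::
  "(real^'n \<Rightarrow> real) \<Rightarrow> real \<Rightarrow> real \<Rightarrow> (nat \<Rightarrow> real^'n) \<Rightarrow> nat \<Rightarrow> bool" where
  "halts_at g \<rho> \<epsilon> y K \<longleftrightarrow>
     reaches_iteration g \<rho> \<epsilon> y K \<and> insufficient_decrease g \<rho> \<epsilon> y K"

(* A randomized execution of Find-SOSP with gradient oracle dg and Hessian oracle H.
   F k is the information available after iteration k. Each direction u k is uniform and
   independent of F (k - 1), and the minimizer chosen in iteration k may depend, measurably,
   on everything in F k (arbitrary, possibly randomized, tie-breaking) but not on later draws.
   Beyond the halting iteration the processes are unconstrained.
   The quadratic of Solve-Quadratic can be unbounded below on the Krylov subspace when an
   earlier Solve-CR call was unsuccessful; final is then arbitrary. The cubic model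
   always has a minimizer. *)
locale find_sosp_run = prob_space M + filtration "space M" F
  for M :: "'w measure" and F :: "nat \<Rightarrow> 'w measure" +
  fixes y0 :: "real^'n"
    and g :: "real^'n \<Rightarrow> real" and dg :: "real^'n \<Rightarrow> real^'n" and H :: "real^'n \<Rightarrow> real^'n^'n"
    and \<beta> \<rho> \<epsilon> \<delta> :: real
    and u :: "nat \<Rightarrow> 'w \<Rightarrow> real^'n"
    and y :: "nat \<Rightarrow> 'w \<Rightarrow> real^'n"
    and final :: "'w \<Rightarrow> real^'n"
  assumes F_subalgebra: "\<And>k. subalgebra M (F k)"
    and u_adapted: "\<And>k. 1 \<le> k \<Longrightarrow> u k \<in> borel_measurable (F k)"
    and u_uniform: "\<And>k. 1 \<le> k \<Longrightarrow> distr M borel (u k) = uniform_sphere"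
    and u_fresh: "\<And>k. 1 \<le> k \<Longrightarrow>
          indep_set {u k -` S \<inter> space M | S. S \<in> sets borel} (sets (F (k - 1)))"
    and y_adapted: "\<And>k. y k \<in> borel_measurable (F k)"
    and final_measurable: "final \<in> borel_measurable M"
    and y_init: "\<And>\<omega>. \<omega> \<in> space M \<Longrightarrow> y 0 \<omega> = y0"
    and y_step: "\<And>k \<omega>. \<omega> \<in> space M \<Longrightarrow> reaches_iteration g \<rho> \<epsilon> (\<lambda>i. y i \<omega>) k \<Longrightarrow>
          \<exists>\<Delta> \<in> solve_cr (H (y (k - 1) \<omega>)) (dg (y (k - 1) \<omega>)) \<rho> \<beta> (step_radius \<rho> \<epsilon>)
                 (conf \<delta> k) (u k \<omega>).
            y k \<omega> = y (k - 1) \<omega> + \<Delta>"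
    and final_step: "\<And>K \<omega>. \<omega> \<in> space M \<Longrightarrow> halts_at g \<rho> \<epsilon> (\<lambda>i. y i \<omega>) K \<Longrightarrow>
          solve_quadratic (H (y (K - 1) \<omega>)) (dg (y (K - 1) \<omega>)) \<rho> \<beta> (step_radius \<rho> \<epsilon>)
            (2 * \<epsilon> / 3) \<noteq> {} \<Longrightarrow>
          final \<omega> \<in> solve_quadratic (H (y (K - 1) \<omega>)) (dg (y (K - 1) \<omega>)) \<rho> \<beta>
            (step_radius \<rho> \<epsilon>) (2 * \<epsilon> / 3)"

(* Costs of an execution in dimension d that halts in iteration K. *)
definition hvp_evals :: "nat \<Rightarrow> real \<Rightarrow> real \<Rightarrow> real \<Rightarrow> real \<Rightarrow> nat \<Rightarrow> nat" where
  "hvp_evals d \<beta> \<rho> \<epsilon> \<delta> K =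
     (\<Sum>k = 1..K. 2 * T_inner d \<rho> \<beta> (step_radius \<rho> \<epsilon>) (conf \<delta> k))
     + T_final \<rho> \<beta> (step_radius \<rho> \<epsilon>) (2 * \<epsilon> / 3)"

definition cr_calls :: "nat \<Rightarrow> nat" where
  "cr_calls K = K"

(* One gradient per subroutine call, the argument of Solve-Quadratic being counted again. *)
definition gradient_evals :: "nat \<Rightarrow> nat" where
  "gradient_evals K = K + 1"

(* The universal constant O(1). In HOL an existential quantifier inside the theorem would let
   the constant depend on the type variables, in particular on the dimension CARD('n);
   a closed numeral is independent of every parameter. Its value is not optimized. *)
definition O1 :: real where
  "O1 = 10 ^ 6"

(* The bracket log (d / delta^2) + log s. For d = 1 both logarithms may be 0 or arbitrarily
   close to 0 (s = 1, delta near 1) although the algorithm always performs at least two products,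
   so no constant works there without the extra summand; it vanishes for d >= 2. *)
definition log_factor :: "nat \<Rightarrow> real \<Rightarrow> real \<Rightarrow> real" where
  "log_factor d \<delta> s = ln (real d / \<delta>\<^sup>2) + ln s + of_bool (d = 1)"

end

theory Submission
  imports Defs "HOL-Computational_Algebra.Polynomial"
begin

text \<open>The Hessian being \<open>2\<rho>\<close>-Lipschitz, the cubic model of Solve-CR majorizes the change of \<open>g\<close>.
  If its global minimizer \<open>s\<close> has norm at least \<open>r\<close>, then the model value is at most \<open>-\<rho>|s|\<^sup>3/6\<close>, and
  the Krylov subspace contains a point that is worse by at most \<open>\<rho>r|s|\<^sup>2/16\<close>: accelerated gradient
  descent for the convexified quadratic on the ball of radius \<open>|s|\<close> stays in the part generated
  by \<open>b\<close>, and moving from its last iterate to the sphere, along an approximate bottom eigenvector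
  from the part generated by \<open>u\<close>, increases the convexified objective only by the eigenvalue error. This needs
  only that \<open>u\<close> is not nearly orthogonal to one fixed bottom eigenvector. Hence insufficient decrease
  implies, outside the random failures, that \<open>|s| \<le> r\<close>. Then \<open>A + \<rho>|s|I\<close> is positive
  semidefinite, the regularized quadratic is well conditioned, and its Krylov minimizer is a conjugate
  gradient iterate: its norm is at most \<open>|s|\<close> and its residual decays at the Chebyshev rate.

  A failure is a measurable event in the pair of the current point and the fresh direction, which are
  independent, so its probability can be bounded for each fixed point. The iteration count follows from
  the guaranteed decrease.\<close>

section \<open>Spectral decomposition and Krylov subspaces\<close>

text \<open>The cubic model is nonconvex, while the available error bound for Krylov methods is one
  of convex optimization. The bridge is the shift \<gamma> = max(0, -lambda_min): stationarity and
  \<gamma> <= \<rho>|s| make \<open>s\<close> a minimizer of the shifted quadratic over the ball of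
  radius |s|, and on the sphere the two objectives differ by a constant. Inside the ball they do
  not, hence the detour along an eigenvector whenever \<gamma> > 0. The margins: -1/6 + 1/16 <
  -1/12, so a long minimizer forces strictly more decrease than the halting test asks for. After
  halting, the shift 2\<rho>r leaves eigenvalues of at least \<rho>r, and a step of norm at most r
  changes the Hessian by at most 2\<rho>r, which together with -\<rho>r gives -3\<rho>r =
  -sqrt(\<rho>\<epsilon>). The minimizer returned by Solve-CR may depend on the fresh direction in
  an arbitrary way. Failure is therefore stated by model values on the whole Krylov subspace, never
  by the returned point, and it is considered for every iteration up to a deterministic bound,
  including those after halting.\<close>

definition self_adjoint :: "real^'n^'n \<Rightarrow> bool" where
  "self_adjoint A \<longleftrightarrow> (\<forall>x y. (A *v x) \<bullet> y = x \<bullet> (A *v y))"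

text \<open>Divide by t and let t tend to 0. It extracts first-order information from minima and
  from difference quotients; the restriction to t <= 1 lets higher-order remainders be absorbed into
  c.\<close>

lemma nonpos_if_quadratic_nonneg:
  fixes a c :: real
  assumes "\<And>t. 0 < t \<Longrightarrow> t \<le> 1 \<Longrightarrow> 0 \<le> - t * a + t\<^sup>2 * c"
  shows "a \<le> 0"
proof (rule ccontr)
  assume "\<not> a \<le> 0"
  then have a: "a > 0" by simp
  define t where "t = min 1 (a / (2 * (\<bar>c\<bar> + 1)))"
  have t: "0 < t" "t \<le> 1" using a by (auto simp: t_def intro!: divide_pos_pos add_nonneg_pos)
  have "t * (\<bar>c\<bar> + 1) \<le> a / (2 * (\<bar>c\<bar> + 1)) * (\<bar>c\<bar> + 1)"
    by (intro mult_right_mono) (auto simp: t_def)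
  also have "\<dots> = a / 2" by (simp add: field_simps)
  finally have "t * (\<bar>c\<bar> + 1) \<le> a / 2" .
  moreover have "t * c \<le> t * (\<bar>c\<bar> + 1)" using t by (intro mult_left_mono) auto
  ultimately have "t * c < a" using a by linarith
  then have "t * (t * c) < t * a" using t by simp
  with assms[OF t] show False by (simp add: power2_eq_square algebra_simps)
qed

text \<open>A minimizer v of the Rayleigh quotient on the unit sphere of \<open>S\<close> is an
  eigenvector: the residual w = Av - lv lies in \<open>S\<close>, and moving from v to v - t w would
  lower x . Ax - l|x|^2 below its minimum 0, at first-order rate 2|w|^2.\<close>

lemma eigenvector_in_invariant_subspace:
  fixes A :: "real^'n^'n"
  assumes sa: "self_adjoint A" and S: "subspace S" "S \<noteq> {0}"
    and inv: "\<And>x. x \<in> S \<Longrightarrow> A *v x \<in> S"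
  obtains v where "v \<in> S" "norm v = 1" "A *v v = (v \<bullet> (A *v v)) *\<^sub>R v"
proof -
  obtain w where w: "w \<in> S" "w \<noteq> 0" using S subspace_0 by blast
  then have "w /\<^sub>R norm w \<in> S \<inter> sphere 0 1"
    using S(1) by (simp add: subspace_scale)
  then have "S \<inter> sphere 0 1 \<noteq> {}" by blast
  moreover have "compact (S \<inter> sphere 0 1)"
    using closed_subspace[OF S(1)] by (simp add: closed_Int_compact)
  moreover have "continuous_on (S \<inter> sphere 0 1) (\<lambda>x. x \<bullet> (A *v x))"
    by (intro continuous_intros)
  ultimately obtain v where v: "v \<in> S \<inter> sphere 0 1"
    and min: "\<And>x. x \<in> S \<inter> sphere 0 1 \<Longrightarrow> v \<bullet> (A *v v) \<le> x \<bullet> (A *v x)"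
    using continuous_attains_inf[of "S \<inter> sphere 0 1" "\<lambda>x. x \<bullet> (A *v x)"] by blast
  define l where "l = v \<bullet> (A *v v)"
  have nv: "norm v = 1" "v \<bullet> v = 1" using v by (auto simp: norm_eq_1)
  have rayleigh: "l * (x \<bullet> x) \<le> x \<bullet> (A *v x)" if "x \<in> S" for x
  proof (cases "x = 0")
    case False
    have "x /\<^sub>R norm x \<in> S \<inter> sphere 0 1"
      using that S(1) False by (simp add: subspace_scale)
    from min[OF this] have "l \<le> (x \<bullet> (A *v x)) / (norm x)\<^sup>2"
      by (simp add: l_def matrix_vector_mult_scaleR power2_eq_square divide_inverse mult_ac)
    then show ?thesis using False by (simp add: power2_norm_eq_inner field_simps)
  qed auto
  define w where "w = A *v v - l *\<^sub>R v"
  have wS: "w \<in> S" unfolding w_def using v inv S(1) by (auto intro!: subspace_diff subspace_scale)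
  have "2 * (w \<bullet> w) \<le> 0"
  proof (rule nonpos_if_quadratic_nonneg)
    fix t :: real
    have "v - t *\<^sub>R w \<in> S" using v wS S(1) by (auto intro!: subspace_diff subspace_scale)
    note rayleigh[OF this]
    moreover have m: "(A *v v) \<bullet> w = w \<bullet> w + l * (v \<bullet> w)" by (simp add: w_def inner_diff_left)
    moreover have "v \<bullet> (A *v w) = w \<bullet> w + l * (v \<bullet> w)"
      using sa m by (metis self_adjoint_def)
    moreover have "w \<bullet> (A *v v) = w \<bullet> w + l * (v \<bullet> w)" "v \<bullet> (A *v v) = l"
      using m by (simp_all add: inner_commute l_def)
    ultimately show "0 \<le> - t * (2 * (w \<bullet> w)) + t\<^sup>2 * (w \<bullet> (A *v w) - l * (w \<bullet> w))"
      using nv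
      by (simp add: matrix_vector_mult_diff_distrib matrix_vector_mult_scaleR inner_diff_left inner_diff_right
          power2_eq_square algebra_simps inner_commute[of w v])
  qed
  then have "w = 0" using inner_gt_zero_iff[of w] by linarith
  then show ?thesis using that[of v] v nv by (simp add: w_def l_def)
qed

text \<open>Eigenvalues appear as Rayleigh quotients, so the orthonormal basis alone carries the
  spectral data and multiplicities require no bookkeeping.\<close>

locale eigenbasis =
  fixes A :: "real^'n^'n" and B :: "(real^'n) set"
  assumes self_adjoint: "self_adjoint A"
    and orth: "pairwise orthogonal B"
    and norm_1: "v \<in> B \<Longrightarrow> norm v = 1"
    and eigen: "v \<in> B \<Longrightarrow> A *v v = (v \<bullet> (A *v v)) *\<^sub>R v"
    and spans: "span B = UNIV"

text \<open>The orthogonal complement of a set of eigenvectors is invariant under \<open>A\<close>;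
  if the set is orthonormal of maximal size, the complement contains no further eigenvector and is
  trivial.\<close>

lemma spectral_theorem:
  fixes A :: "real^'n^'n"
  assumes sa: "self_adjoint A"
  obtains B where "eigenbasis A B"
proof -
  define P where "P B \<longleftrightarrow> pairwise orthogonal B \<and>
    (\<forall>v\<in>B. norm v = 1 \<and> A *v v = (v \<bullet> (A *v v)) *\<^sub>R v)" for B
  have indep: "independent B" if "P B" for B
    using that by (intro pairwise_orthogonal_independent) (auto simp: P_def)
  have bound: "card B \<le> CARD('n)" if "P B" for B
    using independent_bound[OF indep[OF that]] by (simp add: DIM_cart)
  have "P {}" by (simp add: P_def)
  then obtain B where B: "P B" and max: "\<And>B'. P B' \<Longrightarrow> card B' \<le> card B"
    using ex_has_greatest_nat[of P "{}" card "Suc CARD('n)"] bound le_imp_less_Suc by blast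
  define S where "S = {x. \<forall>v\<in>B. v \<bullet> x = 0}"
  have sub: "subspace S"
    unfolding S_def subspace_def by (auto simp: inner_add_right)
  have inv: "A *v x \<in> S" if "x \<in> S" for x
  proof -
    have "v \<bullet> (A *v x) = 0" if "v \<in> B" for v
    proof -
      have "v \<bullet> (A *v x) = (A *v v) \<bullet> x" using sa by (simp add: self_adjoint_def)
      also have "\<dots> = (v \<bullet> (A *v v)) * (v \<bullet> x)" using B that by (metis P_def inner_scaleR_left)
      finally show ?thesis using \<open>x \<in> S\<close> that by (simp add: S_def)
    qed
    then show ?thesis by (simp add: S_def)
  qed
  have "S = {0}"
  proof (rule ccontr)
    assume "S \<noteq> {0}"
    then obtain v where v: "v \<in> S" "norm v = 1" "A *v v = (v \<bullet> (A *v v)) *\<^sub>R v"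
      using eigenvector_in_invariant_subspace[OF sa sub] inv by blast
    have "v \<bullet> v = 1" using v(2) by (simp add: norm_eq_1)
    then have "v \<notin> B" using v(1) by (auto simp: S_def)
    moreover have "P (insert v B)"
      using B v by (auto simp: P_def S_def pairwise_insert orthogonal_def inner_commute)
    moreover have "finite B" using independent_bound[OF indep[OF B]] by simp
    ultimately show False using max[of "insert v B"] by simp
  qed
  have "x \<in> span B" for x
  proof -
    obtain y z where yz: "y \<in> span B" "\<And>w. w \<in> span B \<Longrightarrow> orthogonal z w" "x = y + z"
      using orthogonal_subspace_decomp_exists[of B x] by metis
    then have "z \<in> S" by (auto simp: S_def orthogonal_def span_base inner_commute)
    with \<open>S = {0}\<close> yz show ?thesis by simp
  qed
  then have "eigenbasis A B"
    using B sa by unfold_locales (auto simp: P_def)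
  then show ?thesis by (rule that)
qed

section \<open>Matrix polynomials and Krylov subspaces\<close>

definition mat_poly :: "real poly \<Rightarrow> real^'n^'n \<Rightarrow> real^'n \<Rightarrow> real^'n" where
  "mat_poly p A x = (\<Sum>i\<le>degree p. coeff p i *\<^sub>R ((\<lambda>x. A *v x) ^^ i) x)"

lemma funpow_inner_eigenvector:
  assumes "self_adjoint A" "A *v v = l *\<^sub>R v"
  shows "((\<lambda>x. A *v x) ^^ i) x \<bullet> v = l ^ i * (x \<bullet> v)"
proof (induction i)
  case (Suc i)
  have "((\<lambda>x. A *v x) ^^ Suc i) x \<bullet> v = ((\<lambda>x. A *v x) ^^ i) x \<bullet> (A *v v)"
    using assms(1) by (simp add: self_adjoint_def)
  then show ?case using Suc by (simp add: assms(2))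
qed simp

lemma mat_poly_inner_eigenvector:
  assumes "self_adjoint A" "A *v v = l *\<^sub>R v"
  shows "mat_poly p A x \<bullet> v = poly p l * (x \<bullet> v)"
  by (simp add: mat_poly_def inner_sum_left funpow_inner_eigenvector[OF assms] poly_altdef
      sum_distrib_right mult.assoc)

context eigenbasis
begin

abbreviation "eig v \<equiv> v \<bullet> (A *v v)"

lemma finite_B: "finite B"
proof -
  have "0 \<notin> B" using norm_1 by force
  then show ?thesis
    using independent_bound[of B] pairwise_orthogonal_independent[OF orth] by blast
qed

lemma expand: "(\<Sum>v\<in>B. (x \<bullet> v) *\<^sub>R v) = x"
  using orthonormal_basis_expand[OF orth _ _ finite_B] norm_1 spans by simp

lemma inner_eq_sum: "x \<bullet> y = (\<Sum>v\<in>B. (x \<bullet> v) * (y \<bullet> v))"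
proof -
  have "x \<bullet> y = x \<bullet> (\<Sum>v\<in>B. (y \<bullet> v) *\<^sub>R v)" by (simp add: expand)
  also have "\<dots> = (\<Sum>v\<in>B. (x \<bullet> v) * (y \<bullet> v))" unfolding inner_sum_right by (simp add: mult.commute)
  finally show ?thesis .
qed

lemma mult_inner: "v \<in> B \<Longrightarrow> (A *v x) \<bullet> v = eig v * (x \<bullet> v)"
  using self_adjoint eigen by (metis inner_scaleR_right self_adjoint_def)

lemma quad_eq_sum: "x \<bullet> (A *v x) = (\<Sum>v\<in>B. eig v * (x \<bullet> v)\<^sup>2)"
  by (subst inner_eq_sum, intro sum.cong) (auto simp: mult_inner power2_eq_square)

lemma mat_poly_inner: "v \<in> B \<Longrightarrow> mat_poly p A x \<bullet> v = poly p (eig v) * (x \<bullet> v)"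
  by (rule mat_poly_inner_eigenvector[OF self_adjoint eigen])

lemma eqI: "(\<And>v. v \<in> B \<Longrightarrow> x \<bullet> v = y \<bullet> v) \<Longrightarrow> x = y"
  by (metis (no_types, lifting) expand sum.cong)

lemma B_nonempty: "B \<noteq> {}"
proof
  assume "B = {}"
  then have "(1::real^'n) = 0" using expand[of 1] by simp
  then show False by (simp add: vec_eq_iff)
qed

end

lemma subspace_krylov: "subspace (krylov A B t)"
  by (simp add: krylov_def)

lemma krylov_mono: "B \<subseteq> B' \<Longrightarrow> t \<le> t' \<Longrightarrow> krylov A B t \<subseteq> krylov A B' t'"
  unfolding krylov_def by (intro span_mono) force

lemma krylov_funpow: "b \<in> B \<Longrightarrow> i < t \<Longrightarrow> ((\<lambda>x. A *v x) ^^ i) b \<in> krylov A B t"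
  unfolding krylov_def by (intro span_base) blast

lemma krylov_generator: "b \<in> B \<Longrightarrow> b \<in> krylov A B (Suc t)"
  using krylov_funpow[of b B 0 "Suc t" A] by simp

lemma krylov_mult:
  assumes "x \<in> krylov A B t"
  shows "A *v x \<in> krylov A B (Suc t)"
  using assms unfolding krylov_def
proof (induction rule: span_induct_alt)
  case (step c x y)
  then obtain i b where ib: "x = ((\<lambda>x. A *v x) ^^ i) b" "i < t" "b \<in> B" by blast
  then have "A *v x = ((\<lambda>x. A *v x) ^^ Suc i) b" by simp
  then have "A *v x \<in> {((\<lambda>x. A *v x) ^^ i) b |i b. i < Suc t \<and> b \<in> B}"
    using ib by (metis (mono_tags, lifting) Suc_mono mem_Collect_eq)
  with step(2) show ?case
    by (simp add: matrix_vector_right_distrib matrix_vector_mult_scaleR span_add span_scale span_base)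
qed (simp add: span_zero)

lemma mat_poly_in_krylov:
  assumes "b \<in> B" "degree p < t"
  shows "mat_poly p A b \<in> krylov A B t"
  unfolding mat_poly_def using assms
  by (intro subspace_sum[OF subspace_krylov] subspace_scale[OF subspace_krylov] krylov_funpow) auto

section \<open>First-order methods in Krylov subspaces\<close>

definition proj_ball :: "real \<Rightarrow> 'a::real_inner \<Rightarrow> 'a" where
  "proj_ball R z = (if norm z \<le> R then z else (R / norm z) *\<^sub>R z)"

lemma norm_proj_ball: "0 \<le> R \<Longrightarrow> norm (proj_ball R z) \<le> R"
  by (auto simp: proj_ball_def)

lemma proj_ball_in_subspace: "subspace S \<Longrightarrow> z \<in> S \<Longrightarrow> proj_ball R z \<in> S"
  by (simp add: proj_ball_def subspace_scale)

text \<open>The variational inequality of the metric projection onto a convex set; for z outside the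
  ball it reduces to z . s <= |z| R.\<close>

lemma proj_ball_obtuse:
  assumes "0 \<le> R" "norm s \<le> R"
  shows "(z - proj_ball R z) \<bullet> (s - proj_ball R z) \<le> 0"
proof (cases "norm z \<le> R")
  case False
  define n where "n = norm z"
  have n: "R < n" "0 < n" "z \<bullet> z = n * n"
    using False assms(1) by (auto simp: n_def norm_eq_sqrt_inner)
  have p: "proj_ball R z = (R / n) *\<^sub>R z" using False by (simp add: proj_ball_def n_def)
  have "z \<bullet> s \<le> n * R"
    using norm_cauchy_schwarz[of z s] assms(2) n by (smt (verit) n_def mult_left_mono)
  then have "z \<bullet> s - R / n * (z \<bullet> z) \<le> 0" using n by (simp add: mult.commute)
  then have "(1 - R / n) * (z \<bullet> s - R / n * (z \<bullet> z)) \<le> 0"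
    using n by (intro mult_nonneg_nonpos) auto
  also have "(1 - R / n) * (z \<bullet> s - R / n * (z \<bullet> z))
      = (z - proj_ball R z) \<bullet> (s - proj_ball R z)"
    unfolding p by (simp add: inner_diff_left inner_diff_right algebra_simps diff_divide_distrib)
  finally show ?thesis .
qed (simp add: proj_ball_def)

text \<open>The operator is a function rather than a matrix, so that the shifted operators
  \<open>A + c I\<close> can be passed directly.\<close>

definition qmodel :: "('a::real_inner \<Rightarrow> 'a) \<Rightarrow> 'a \<Rightarrow> 'a \<Rightarrow> real" where
  "qmodel M b x = 1/2 * (x \<bullet> M x) + b \<bullet> x"

locale sym_operator =
  fixes M :: "'a::real_inner \<Rightarrow> 'a"
  assumes lin: "linear M" and sym: "M x \<bullet> y = x \<bullet> M y"
begin

lemmas op_simps = linear_add[OF lin] linear_diff[OF lin] linear_cmul[OF lin] linear_0[OF lin]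
  linear_neg[OF lin]

lemma qmodel_expand:
  "qmodel M b x = qmodel M b y + (M y + b) \<bullet> (x - y) + 1/2 * ((x - y) \<bullet> M (x - y))"
proof -
  have "x \<bullet> M y = M y \<bullet> x" "M x \<bullet> y = y \<bullet> M x" "x \<bullet> M y = y \<bullet> M x" "M y \<bullet> y = y \<bullet> M y"
    by (metis inner_commute sym)+
  then show ?thesis
    by (simp add: qmodel_def op_simps inner_add_left inner_diff_left inner_diff_right algebra_simps)
qed

text \<open>Nesterov's step in its two-sequence form: z takes projected gradient steps, x averages
  them. Convexity is used at x and at s with weights 1 - \<theta> and \<theta>, the curvature bound
  L at x', and the projection inequality turns the remaining linear term into the telescoping
  difference of squared distances.\<close>

lemma accelerated_gradient_step:
  assumes psd: "\<And>x. 0 \<le> x \<bullet> M x" and L: "\<And>x. x \<bullet> M x \<le> L * (x \<bullet> x)" "0 < L"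
    and th: "0 < \<theta>" "\<theta> \<le> 1" and R: "0 \<le> R" "norm s \<le> R"
    and y: "y = (1 - \<theta>) *\<^sub>R x + \<theta> *\<^sub>R z"
    and z': "z' = proj_ball R (z - (1 / (L * \<theta>)) *\<^sub>R (M y + b))"
    and x': "x' = (1 - \<theta>) *\<^sub>R x + \<theta> *\<^sub>R z'"
  shows "qmodel M b x' - qmodel M b s \<le> (1 - \<theta>) * (qmodel M b x - qmodel M b s)
    + L * \<theta>\<^sup>2 / 2 * ((norm (s - z))\<^sup>2 - (norm (s - z'))\<^sup>2)"
proof -
  define q where "q = qmodel M b"
  define G where "G = M y + b"
  have lower: "q y + G \<bullet> (a - y) \<le> q a" for a
    using qmodel_expand[of b a y] psd[of "a - y"] by (simp add: q_def G_def)
  \<comment> \<open>Averaging y and x' with the same weight makes their distance only \<theta> times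
    the step of z, so the curvature error carries a factor \<theta>^2.\<close>
  have d: "x' - y = \<theta> *\<^sub>R (z' - z)" unfolding x' y by (simp add: algebra_simps)
  have upper: "q x' \<le> q y + G \<bullet> (x' - y) + L * \<theta>\<^sup>2 / 2 * ((z' - z) \<bullet> (z' - z))"
  proof -
    have "L * ((x' - y) \<bullet> (x' - y)) = 2 * (L * \<theta>\<^sup>2 / 2 * ((z' - z) \<bullet> (z' - z)))"
      by (simp add: d power2_eq_square)
    then show ?thesis
      using qmodel_expand[of b x' y] L(1)[of "x' - y"] unfolding q_def G_def by linarith
  qed
  have "G \<bullet> (x' - y) = (1 - \<theta>) * (G \<bullet> (x - y)) + \<theta> * (G \<bullet> (s - y)) + \<theta> * (G \<bullet> (z' - s))"
    unfolding x' by (simp add: inner_diff_right inner_add_right algebra_simps)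
  moreover have "(1 - \<theta>) * (q y + G \<bullet> (x - y)) \<le> (1 - \<theta>) * q x"
    "\<theta> * (q y + G \<bullet> (s - y)) \<le> \<theta> * q s"
    using lower[of x] lower[of s] th by (auto intro: mult_left_mono)
  moreover have "\<theta> * (G \<bullet> (z' - s)) \<le> L * \<theta>\<^sup>2 * ((z' - z) \<bullet> (s - z'))"
  proof -
    have "(z - (1 / (L * \<theta>)) *\<^sub>R G - z') \<bullet> (s - z') \<le> 0"
      using proj_ball_obtuse[OF R] by (simp add: z' G_def)
    then have "L * \<theta> * ((z - (1 / (L * \<theta>)) *\<^sub>R G - z') \<bullet> (s - z')) \<le> 0"
      using L(2) th by (intro mult_nonneg_nonpos) auto
    also have "L * \<theta> * ((z - (1 / (L * \<theta>)) *\<^sub>R G - z') \<bullet> (s - z'))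
      = L * \<theta> * ((z - z') \<bullet> (s - z')) - G \<bullet> (s - z')"
    proof -
      have "(z - (1 / (L * \<theta>)) *\<^sub>R G - z') \<bullet> w = (z - z') \<bullet> w - G \<bullet> w / (L * \<theta>)" for w
        by (simp add: inner_diff_left)
      then show ?thesis using L(2) th by (simp only: right_diff_distrib) simp
    qed
    finally have "G \<bullet> (z' - s) \<le> L * \<theta> * ((z' - z) \<bullet> (s - z'))"
      by (simp add: inner_diff_left inner_diff_right algebra_simps)
    then have "\<theta> * (G \<bullet> (z' - s)) \<le> \<theta> * (L * \<theta> * ((z' - z) \<bullet> (s - z')))"
      using th by simp
    then show ?thesis by (simp add: power2_eq_square mult_ac)
  qed
  moreover have "L * \<theta>\<^sup>2 / 2 * ((norm (s - z))\<^sup>2 - (norm (s - z'))\<^sup>2)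
      = L * \<theta>\<^sup>2 * ((z' - z) \<bullet> (s - z')) + L * \<theta>\<^sup>2 / 2 * ((z' - z) \<bullet> (z' - z))"
  proof -
    have "(norm (s - z))\<^sup>2 - (norm (s - z'))\<^sup>2
      = 2 * ((z' - z) \<bullet> (s - z')) + (z' - z) \<bullet> (z' - z)"
      by (simp add: power2_norm_eq_inner inner_diff_left inner_diff_right inner_commute)
    then show ?thesis by (simp only: distrib_left) simp
  qed
  ultimately show ?thesis
    using upper unfolding q_def[symmetric] by (simp add: algebra_simps)
qed

text \<open>The sets \<open>K t\<close> stand for Krylov subspaces. Projecting onto a centred ball
  only rescales a vector, so the constraint on the norm never leads out of the subspace. The weights
  2/(j + 2) satisfy (1 - \<theta>')\<theta>^2 <= \<theta>'^2 for successive values, which propagates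
  the estimate.\<close>

lemma accelerated_gradient_ball:
  assumes psd: "\<And>x. 0 \<le> x \<bullet> M x" and L: "\<And>x. x \<bullet> M x \<le> L * (x \<bullet> x)" "0 < L"
    and s: "norm s \<le> R" "\<And>x. norm x \<le> R \<Longrightarrow> qmodel M b s \<le> qmodel M b x"
    and K: "\<And>t. subspace (K t)" "\<And>t. K t \<subseteq> K (Suc t)" "\<And>t. b \<in> K (Suc t)"
      "\<And>t x. x \<in> K t \<Longrightarrow> M x \<in> K (Suc t)"
  shows "\<exists>x\<in>K (Suc k). norm x \<le> R \<and>
    qmodel M b x - qmodel M b s \<le> 2 * L * (norm s)\<^sup>2 / (real k + 2)\<^sup>2"
proof -
  have R: "0 \<le> R" using s(1) norm_ge_zero[of s] by linarith
  define \<theta> where "\<theta> j = 2 / (real j + 2)" for j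
  define q where "q = qmodel M b"
  note step = accelerated_gradient_step[OF psd L _ _ R s(1) refl refl refl, where b = b, folded q_def]
  have step_mem: "z' \<in> K (Suc t) \<and> norm z' \<le> R \<and> x' \<in> K (Suc t) \<and> norm x' \<le> R"
    if "x \<in> K t" "z \<in> K t" "norm x \<le> R" "0 < th" "th \<le> 1"
      "y = (1 - th) *\<^sub>R x + th *\<^sub>R z"
      "z' = proj_ball R (z - (1 / (L * th)) *\<^sub>R (M y + b))"
      "x' = (1 - th) *\<^sub>R x + th *\<^sub>R z'" for x z y z' x' t th
  proof -
    have "y \<in> K t" using that(1,2,6) K(1) by (simp add: subspace_add subspace_scale)
    then have 1: "z' \<in> K (Suc t)" unfolding that(7)
      using K that(2) by (intro proj_ball_in_subspace subspace_diff subspace_scale subspace_add) blast+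
    have 2: "norm z' \<le> R" unfolding that(7) using R by (rule norm_proj_ball)
    have 3: "x' \<in> K (Suc t)" unfolding that(8)
      using 1 K(1,2) that(1) by (intro subspace_add subspace_scale) blast+
    have "norm x' \<le> (1 - th) * norm x + th * norm z'"
      unfolding that(8) using that(4,5) by (intro norm_triangle_le) auto
    also have "\<dots> \<le> (1 - th) * R + th * R"
      using that(3-5) 2 by (intro add_mono mult_left_mono) auto
    finally have "norm x' \<le> R" by (simp add: algebra_simps)
    with 1 2 3 show ?thesis by blast
  qed
  \<comment> \<open>The subtracted distance from s to z is the potential that the telescoping needs;
    it is dropped only at the end.\<close>
  have "\<exists>x\<in>K (Suc k). \<exists>z\<in>K (Suc k). norm x \<le> R \<and> norm z \<le> R \<and>
    q x - q s \<le> (\<theta> k)\<^sup>2 * (L / 2 * ((norm s)\<^sup>2 - (norm (s - z))\<^sup>2))"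
  proof (induction k)
    case 0
    \<comment> \<open>Since \<open>\<theta> 0 = 1\<close>, the first average forgets its starting
      point, so the initial gap does not enter.\<close>
    have 0: "0 \<in> K 0" "norm (0::'a) \<le> R" using K(1) R by (auto intro: subspace_0)
    define y :: 'a where "y = (1 - 1) *\<^sub>R 0 + 1 *\<^sub>R 0"
    define z' where "z' = proj_ball R (0 - (1 / (L * 1)) *\<^sub>R (M y + b))"
    define x' where "x' = (1 - 1) *\<^sub>R 0 + 1 *\<^sub>R z'"
    have "z' \<in> K (Suc 0) \<and> norm z' \<le> R \<and> x' \<in> K (Suc 0) \<and> norm x' \<le> R"
      by (rule step_mem[OF 0(1,1,2) _ _ y_def z'_def x'_def]) auto
    moreover have "q x' - q s \<le> (\<theta> 0)\<^sup>2 * (L / 2 * ((norm s)\<^sup>2 - (norm (s - z'))\<^sup>2))"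
      using step[of 1 0 0] unfolding x'_def z'_def y_def by (simp add: \<theta>_def)
    ultimately show ?case by blast
  next
    case (Suc k)
    then obtain x z where xz: "x \<in> K (Suc k)" "z \<in> K (Suc k)" "norm x \<le> R"
      and IH: "q x - q s \<le> (\<theta> k)\<^sup>2 * (L / 2 * ((norm s)\<^sup>2 - (norm (s - z))\<^sup>2))" by blast
    define th where "th = \<theta> (Suc k)"
    have th: "0 < th" "th \<le> 1" by (auto simp: th_def \<theta>_def)
    define C where "C = L / 2 * ((norm s)\<^sup>2 - (norm (s - z))\<^sup>2)"
    define y where "y = (1 - th) *\<^sub>R x + th *\<^sub>R z"
    define z' where "z' = proj_ball R (z - (1 / (L * th)) *\<^sub>R (M y + b))"
    define x' where "x' = (1 - th) *\<^sub>R x + th *\<^sub>R z'"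
    \<comment> \<open>Optimality of s on the ball makes the previous bound nonnegative, which is
      what allows its weight to be enlarged.\<close>
    have "0 \<le> (\<theta> k)\<^sup>2 * C" using IH s(2)[OF xz(3)] by (simp add: C_def q_def)
    moreover have "0 < (\<theta> k)\<^sup>2" by (simp add: \<theta>_def)
    ultimately have C: "0 \<le> C" by (simp add: zero_le_mult_iff)
    have "(real k + 1) * (real k + 3) \<le> (real k + 2)\<^sup>2" by (simp add: power2_eq_square algebra_simps)
    then have "(real k + 1) * (real k + 3) * (4 / ((real k + 2)\<^sup>2 * (real k + 3)\<^sup>2))
      \<le> (real k + 2)\<^sup>2 * (4 / ((real k + 2)\<^sup>2 * (real k + 3)\<^sup>2))" by (intro mult_right_mono) auto
    moreover have "(1 - th) * (\<theta> k)\<^sup>2 = (real k + 1) * (real k + 3) * (4 / ((real k + 2)\<^sup>2 * (real k + 3)\<^sup>2))"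
    proof -
      have "1 - th = (real k + 1) / (real k + 3)" by (simp add: th_def \<theta>_def field_simps)
      then show ?thesis by (simp add: \<theta>_def power_divide) (simp add: power2_eq_square)
    qed
    moreover have "(real k + 2)\<^sup>2 * (4 / ((real k + 2)\<^sup>2 * (real k + 3)\<^sup>2)) = th\<^sup>2"
      by (simp add: th_def \<theta>_def power_divide add.commute)
    ultimately have "(1 - th) * (\<theta> k)\<^sup>2 \<le> th\<^sup>2" by simp
    then have "(1 - th) * (\<theta> k)\<^sup>2 * C \<le> th\<^sup>2 * C" using C by (intro mult_right_mono)
    moreover have "(1 - th) * (q x - q s) \<le> (1 - th) * ((\<theta> k)\<^sup>2 * C)"
      using IH th by (intro mult_left_mono) (auto simp: C_def)
    ultimately have "(1 - th) * (q x - q s) \<le> th\<^sup>2 * C" by simp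
    moreover have "q x' - q s \<le> (1 - th) * (q x - q s)
      + L * th\<^sup>2 / 2 * ((norm (s - z))\<^sup>2 - (norm (s - z'))\<^sup>2)"
      unfolding x'_def z'_def y_def using step[OF th] by blast
    ultimately have "q x' - q s \<le> th\<^sup>2 * C + L * th\<^sup>2 / 2 * ((norm (s - z))\<^sup>2 - (norm (s - z'))\<^sup>2)"
      by linarith
    also have "\<dots> = th\<^sup>2 * (L / 2 * ((norm s)\<^sup>2 - (norm (s - z'))\<^sup>2))"
      by (simp add: C_def algebra_simps)
    finally have "q x' - q s \<le> (\<theta> (Suc k))\<^sup>2 * (L / 2 * ((norm s)\<^sup>2 - (norm (s - z'))\<^sup>2))"
      by (simp add: th_def)
    then show ?case using step_mem[OF xz th y_def z'_def x'_def] by blast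
  qed
  then obtain x z where x: "x \<in> K (Suc k)" "norm x \<le> R"
    and le: "q x - q s \<le> (\<theta> k)\<^sup>2 * (L / 2 * ((norm s)\<^sup>2 - (norm (s - z))\<^sup>2))" by blast
  note le
  also have "\<dots> \<le> (\<theta> k)\<^sup>2 * (L / 2 * (norm s)\<^sup>2)"
    using L(2) by (intro mult_left_mono) auto
  also have "\<dots> = 2 * L * (norm s)\<^sup>2 / (real k + 2)\<^sup>2"
    by (simp add: \<theta>_def power_divide)
  finally show ?thesis using x by (auto simp: q_def)
qed

end

text \<open>The search directions of the conjugate gradient method have pairwise nonnegative inner
  products, hence the norms of its iterates increase (Steihaug).\<close>

locale conjugate_gradient = sym_operator M for M :: "'a::euclidean_space \<Rightarrow> 'a" +
  fixes b :: 'a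
  assumes pos_def: "x \<noteq> 0 \<Longrightarrow> 0 < x \<bullet> M x"
begin

text \<open>A state consists of the iterate, the residual and the search direction. After the residual
  has vanished all divisions are by zero and the state is stationary.\<close>

fun cg_step :: "'a \<times> 'a \<times> 'a \<Rightarrow> 'a \<times> 'a \<times> 'a" where
  "cg_step (x, r, p) = (let \<alpha> = (r \<bullet> r) / (p \<bullet> M p); r' = r - \<alpha> *\<^sub>R M p in
     (x + \<alpha> *\<^sub>R p, r', r' + ((r' \<bullet> r') / (r \<bullet> r)) *\<^sub>R p))"

definition "xs k = fst ((cg_step ^^ k) (0, b, b))"
definition "rs k = fst (snd ((cg_step ^^ k) (0, b, b)))"
definition "ps k = snd (snd ((cg_step ^^ k) (0, b, b)))"
definition "al k = (rs k \<bullet> rs k) / (ps k \<bullet> M (ps k))"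
definition "be k = (rs (Suc k) \<bullet> rs (Suc k)) / (rs k \<bullet> rs k)"

lemma cg_0: "xs 0 = 0" "rs 0 = b" "ps 0 = b"
  by (simp_all add: xs_def rs_def ps_def)

lemma cg_Suc:
  shows xs_Suc: "xs (Suc k) = xs k + al k *\<^sub>R ps k"
    and rs_Suc: "rs (Suc k) = rs k - al k *\<^sub>R M (ps k)"
    and ps_Suc: "ps (Suc k) = rs (Suc k) + be k *\<^sub>R ps k"
proof -
  obtain x r p where s: "(cg_step ^^ k) (0, b, b) = (x, r, p)" using prod_cases3 by blast
  show "xs (Suc k) = xs k + al k *\<^sub>R ps k" "rs (Suc k) = rs k - al k *\<^sub>R M (ps k)"
    by (simp_all add: xs_def rs_def ps_def al_def s Let_def)
  then show "ps (Suc k) = rs (Suc k) + be k *\<^sub>R ps k"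
    by (simp add: be_def) (simp add: xs_def rs_def ps_def al_def s Let_def)
qed

lemma psd: "0 \<le> x \<bullet> M x"
  using pos_def[of x] by (cases "x = 0") auto

lemma al_nonneg: "0 \<le> al k" and be_nonneg: "0 \<le> be k"
  by (simp_all add: al_def be_def psd)

text \<open>The three relations feed each other, hence the joint induction. The last clause keeps it
  valid once the residual has vanished, when the quotients are 0 by convention.\<close>

lemma cg_orthogonality:
  "(\<forall>j<k. rs k \<bullet> ps j = 0 \<and> rs k \<bullet> rs j = 0 \<and> ps k \<bullet> M (ps j) = 0) \<and>
   rs k \<bullet> ps k = rs k \<bullet> rs k \<and> (rs k = 0 \<longrightarrow> ps k = 0)"
proof (induction k rule: less_induct)
  case (less k)
  show ?case
  proof (cases k)
    case 0
    show ?thesis unfolding 0 cg_0 by simp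
  next
    case (Suc n)
    have IH: "\<And>m. m \<le> n \<Longrightarrow> rs m \<bullet> ps m = rs m \<bullet> rs m" "\<And>m. m \<le> n \<Longrightarrow> rs m = 0 \<Longrightarrow> ps m = 0"
      "\<And>j. j < n \<Longrightarrow> rs n \<bullet> ps j = 0" "\<And>j. j < n \<Longrightarrow> ps n \<bullet> M (ps j) = 0"
      using less Suc by auto
    have rp: "rs (Suc n) \<bullet> ps j = 0" if "j \<le> n" for j
    proof (cases "j = n")
      case True
      have "al n * (ps n \<bullet> M (ps n)) = rs n \<bullet> ps n"
        using IH(1)[of n] pos_def[of "ps n"] by (cases "ps n = 0") (auto simp: al_def op_simps)
      then show ?thesis using True by (simp add: rs_Suc inner_diff_left sym)
    next
      case False
      then show ?thesis using that IH(3,4)[of j] by (simp add: rs_Suc inner_diff_left sym)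
    qed
    have rr: "rs (Suc n) \<bullet> rs j = 0" if "j \<le> n" for j
    proof (cases j)
      case 0
      then show ?thesis using rp[of 0] by (simp add: cg_0)
    next
      case (Suc i)
      have "rs j = ps j - be i *\<^sub>R ps i" by (simp add: Suc ps_Suc)
      then show ?thesis using rp[of j] rp[of i] that Suc by (simp add: inner_diff_right)
    qed
    have pMp: "ps (Suc n) \<bullet> M (ps j) = 0" if "j \<le> n" for j
    proof (cases "rs j = 0")
      case True
      then show ?thesis using IH(2)[of j] that by (simp add: op_simps)
    next
      case False
      then have "rs j \<bullet> ps j > 0" using IH(1)[of j] that by simp
      then have pj: "ps j \<noteq> 0" by auto
      then have a: "al j > 0" using False by (simp add: al_def pos_def)
      \<comment> \<open>Solving the residual recursion for M p_j reduces conjugacy of directions to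
        orthogonality of residuals.\<close>
      have Mp: "M (ps j) = (1 / al j) *\<^sub>R (rs j - rs (Suc j))" using a by (simp add: rs_Suc)
      show ?thesis
      proof (cases "j = n")
        case True
        have "rs (Suc n) \<bullet> M (ps n) = - (rs (Suc n) \<bullet> rs (Suc n)) / al n"
          using Mp True rr[of n] by (simp add: inner_diff_right)
        moreover have "be n * (ps n \<bullet> M (ps n)) = (rs (Suc n) \<bullet> rs (Suc n)) / al n"
          using False True pos_def[OF pj] by (simp add: be_def al_def)
        ultimately show ?thesis using True by (simp add: ps_Suc inner_add_left)
      next
        case False
        then have "rs (Suc n) \<bullet> M (ps j) = 0"
          using Mp rr[of j] rr[of "Suc j"] that by (simp add: inner_diff_right)
        then show ?thesis using IH(4)[of j] False that by (simp add: ps_Suc inner_add_left)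
      qed
    qed
    have "rs (Suc n) \<bullet> ps (Suc n) = rs (Suc n) \<bullet> rs (Suc n)"
      using rp[of n] by (simp add: ps_Suc inner_add_right)
    moreover have "rs (Suc n) = 0 \<longrightarrow> ps (Suc n) = 0" by (simp add: ps_Suc be_def)
    ultimately show ?thesis using rp rr pMp Suc by (auto simp: less_Suc_eq_le)
  qed
qed

lemma residual: "b - M (xs k) = rs k"
  by (induction k) (auto simp: cg_0 cg_Suc op_simps algebra_simps)

lemma directions_nonneg: "j \<le> k \<Longrightarrow> 0 \<le> ps k \<bullet> ps j"
proof (induction k)
  case (Suc k)
  show ?case
  proof (cases "j = Suc k")
    case False
    then have "j \<le> k" using Suc by simp
    then have "rs (Suc k) \<bullet> ps j = 0" using cg_orthogonality[of "Suc k"] by simp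
    then show ?thesis
      using Suc.IH[OF \<open>j \<le> k\<close>] by (simp add: ps_Suc[of k] inner_add_left be_nonneg)
  qed simp
qed simp

lemma iterate_direction_nonneg: "0 \<le> xs k \<bullet> ps j"
proof (induction k)
  case (Suc k)
  have "0 \<le> ps k \<bullet> ps j"
    using directions_nonneg[of j k] directions_nonneg[of k j] by (metis inner_commute nat_le_linear)
  then show ?case using Suc by (simp add: xs_Suc inner_add_left al_nonneg)
qed (simp add: cg_0)

lemma norm_iterates_incseq: "k \<le> l \<Longrightarrow> norm (xs k) \<le> norm (xs l)"
proof (induction l rule: dec_induct)
  case (step n)
  have "xs n \<bullet> xs n \<le> xs (Suc n) \<bullet> xs (Suc n)"
    using iterate_direction_nonneg[of n n] al_nonneg[of n]
    by (simp add: xs_Suc inner_add_left inner_add_right inner_commute)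
  then have "norm (xs n) \<le> norm (xs (Suc n))" by (simp add: norm_le)
  then show ?case using step by simp
qed simp

text \<open>Nonzero residuals are pairwise orthogonal, so there are at most as many of them as the
  dimension.\<close>

lemma residual_vanishes: "\<exists>N. \<forall>k\<ge>N. rs k = 0"
proof -
  have "\<exists>N. rs N = 0"
  proof (rule ccontr)
    assume "\<nexists>N. rs N = 0"
    then have nz: "rs k \<noteq> 0" for k by blast
    have orth: "rs i \<bullet> rs j = 0" if "i \<noteq> j" for i j
      using that cg_orthogonality[of i] cg_orthogonality[of j]
      by (metis inner_commute linorder_neqE_nat)
    have "inj rs"
      by (rule injI) (metis inner_eq_zero_iff nz orth)
    then have "card (rs ` {..DIM('a)}) = Suc DIM('a)"
      by (subst card_image) (auto intro: inj_on_subset)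
    moreover have "independent (rs ` {..DIM('a)})"
      using nz orth by (intro pairwise_orthogonal_independent)
        (auto simp: pairwise_def orthogonal_def, metis)
    ultimately show False using independent_bound[of "rs ` {..DIM('a)}"] by simp
  qed
  then obtain N where N: "rs N = 0" by blast
  have "rs k = 0" if "N \<le> k" for k
    using that by (induction k rule: dec_induct) (auto simp: N rs_Suc al_def)
  then show ?thesis by blast
qed

text \<open>The iterates reach the solution after finitely many steps, and their norms never
  decrease on the way.\<close>

lemma norm_iterate_le:
  assumes "M x = b"
  shows "norm (xs k) \<le> norm x"
proof -
  obtain N where "rs (max k N) = 0" using residual_vanishes by (metis max.cobounded2)
  then have "M (xs (max k N) - x) = 0" using residual[of "max k N"] assms by (simp add: op_simps)
  then have "xs (max k N) = x" using pos_def[of "xs (max k N) - x"] by force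
  then show ?thesis using norm_iterates_incseq[of k "max k N"] by simp
qed

lemma residual_in_span: "rs k \<in> span (ps ` {..k})"
proof (cases k)
  case (Suc i)
  have "rs k = ps k - be i *\<^sub>R ps i" by (simp add: Suc ps_Suc)
  then show ?thesis by (simp add: Suc span_diff span_scale span_base)
qed (simp add: cg_0 span_base)

text \<open>M p_j is a multiple of the difference of two consecutive residuals. By induction the
  directions therefore span every Krylov subspace.\<close>

lemma op_in_span:
  assumes "x \<in> span (ps ` {..k})"
  shows "M x \<in> span (ps ` {..Suc k})"
  using assms
proof (induction rule: span_induct_alt)
  case (step c x y)
  then obtain j where j: "x = ps j" "j \<le> k" by auto
  have "M (ps j) \<in> span (ps ` {..Suc k})"
  proof (cases "rs j = 0")
    case True
    then show ?thesis using cg_orthogonality[of j] by (simp add: op_simps span_zero)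
  next
    case False
    then have "ps j \<noteq> 0" using cg_orthogonality[of j] by auto
    then have a: "al j > 0" using False by (simp add: al_def pos_def)
    then have "M (ps j) = (1 / al j) *\<^sub>R (rs j - rs (Suc j))" by (simp add: rs_Suc)
    moreover have "rs i \<in> span (ps ` {..Suc k})" if "i \<le> Suc k" for i
      using residual_in_span[of i] that by (meson atMost_subset_iff image_mono span_mono subsetD)
    ultimately show ?thesis using j by (simp add: span_diff span_scale)
  qed
  then show ?case using step j by (simp add: op_simps span_add span_scale)
qed (simp add: op_simps span_zero)

lemma residual_orthogonal:
  assumes "x \<in> span (ps ` {..<k})"
  shows "rs k \<bullet> x = 0"
proof -
  have "orthogonal (rs k) x"
    using assms cg_orthogonality[of k] by (intro orthogonal_to_span[of x]) (auto simp: orthogonal_def)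
  then show ?thesis by (simp add: orthogonal_def)
qed

end

text \<open>The minimizer is the t-th conjugate gradient iterate for right-hand side -b: its
  residual is the negative gradient of the objective and is orthogonal to the subspace. Positive
  definiteness makes the minimum strict, and the norm bound is the monotonicity of the
  iterates.\<close>

lemma krylov_regularized_minimizer:
  fixes A :: "real^'n^'n"
  assumes sa: "self_adjoint A"
    and pos: "\<And>x. x \<noteq> 0 \<Longrightarrow> 0 < x \<bullet> (A *v x + c *\<^sub>R x)"
    and x0: "A *v x0 + c *\<^sub>R x0 = - b"
  obtains z where "z \<in> krylov A {b} t" "norm z \<le> norm x0"
    "\<And>x. x \<in> krylov A {b} t \<Longrightarrow> x \<noteq> z \<Longrightarrow>
      qmodel (\<lambda>x. A *v x + c *\<^sub>R x) b z < qmodel (\<lambda>x. A *v x + c *\<^sub>R x) b x"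
proof -
  define M where "M = (\<lambda>x. A *v x + c *\<^sub>R x)"
  interpret conjugate_gradient M "- b"
    using sa pos
    by unfold_locales (auto simp: M_def linear_iff matrix_vector_right_distrib matrix_vector_mult_scaleR
      self_adjoint_def inner_add_left inner_add_right algebra_simps)
  let ?K = "krylov A {b}"
  have Mk: "M x \<in> ?K (Suc k)" if "x \<in> ?K k" for x k
    using krylov_mult[OF that] krylov_mono[of "{b}" "{b}" k "Suc k" A] that
    by (auto simp: M_def intro!: subspace_add[OF subspace_krylov] subspace_scale[OF subspace_krylov])
  have up: "x \<in> ?K (Suc k)" if "x \<in> ?K k" for x k
    using krylov_mono[of "{b}" "{b}" k "Suc k" A] that by auto
  note sub = subspace_add[OF subspace_krylov] subspace_diff[OF subspace_krylov]
    subspace_scale[OF subspace_krylov] subspace_neg[OF subspace_krylov]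
  have "xs k \<in> ?K k \<and> rs k \<in> ?K (Suc k) \<and> ps k \<in> ?K (Suc k)" for k
  proof (induction k)
    case 0
    then show ?case using krylov_generator[of b "{b}" A 0] by (simp add: cg_0 sub subspace_0[OF subspace_krylov])
  next
    case (Suc k)
    then have "rs (Suc k) \<in> ?K (Suc (Suc k))" by (simp add: rs_Suc sub up Mk)
    then show ?case using Suc by (simp add: xs_Suc ps_Suc sub up)
  qed
  then have mem: "xs t \<in> ?K t" by blast
  have pw: "((\<lambda>x. A *v x) ^^ i) b \<in> span (ps ` {..i})" for i
  proof (induction i)
    case 0
    have "- ps 0 \<in> span (ps ` {..0})" by (intro span_neg span_base) simp
    then show ?case by (simp add: cg_0)
  next
    case (Suc i)
    let ?x = "((\<lambda>x. A *v x) ^^ i) b"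
    have "?x \<in> span (ps ` {..Suc i})"
      using Suc by (meson atMost_subset_iff image_mono span_mono subsetD le_SucI order_refl)
    \<comment> \<open>A shift by a multiple of the identity does not change Krylov subspaces: A x =
      M x - c x.\<close>
    then have "M ?x - c *\<^sub>R ?x \<in> span (ps ` {..Suc i})"
      using op_in_span[OF Suc] by (intro span_diff span_scale)
    then show ?case by (simp add: M_def)
  qed
  have "?K t \<subseteq> span (ps ` {..<t})"
    unfolding krylov_def
  proof (rule span_minimal)
    show "{((\<lambda>x. A *v x) ^^ i) b' |i b'. i < t \<and> b' \<in> {b}} \<subseteq> span (ps ` {..<t})"
    proof clarsimp
      fix i assume "i < t"
      then have "span (ps ` {..i}) \<subseteq> span (ps ` {..<t})" by (intro span_mono image_mono) auto
      then show "((\<lambda>x. A *v x) ^^ i) b \<in> span (ps ` {..<t})" using pw by blast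
    qed
  qed simp
  then have orth: "rs t \<bullet> x = 0" if "x \<in> ?K t" for x using that residual_orthogonal by blast
  have "qmodel M b (xs t) < qmodel M b x" if "x \<in> ?K t" "x \<noteq> xs t" for x
  proof -
    have "x - xs t \<in> ?K t" using that mem by (simp add: sub)
    moreover have "M (xs t) + b = - rs t" by (simp add: residual[of t, symmetric])
    ultimately have "(M (xs t) + b) \<bullet> (x - xs t) = 0" using orth by simp
    then show ?thesis using qmodel_expand[of b x "xs t"] pos_def[of "x - xs t"] that by simp
  qed
  moreover have "norm (xs t) \<le> norm x0" using norm_iterate_le x0 by (simp add: M_def)
  ultimately show ?thesis using that[of "xs t"] mem by (simp add: M_def)
qed

section \<open>Chebyshev polynomials\<close>

fun cheb_T :: "nat \<Rightarrow> real poly" where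
  "cheb_T 0 = 1"
| "cheb_T (Suc 0) = [:0, 1:]"
| "cheb_T (Suc (Suc n)) = [:0, 2:] * cheb_T (Suc n) - cheb_T n"

text \<open>The Chebyshev polynomials of the fourth kind.\<close>

fun cheb_W :: "nat \<Rightarrow> real poly" where
  "cheb_W 0 = 1"
| "cheb_W (Suc 0) = [:1, 2:]"
| "cheb_W (Suc (Suc n)) = [:0, 2:] * cheb_W (Suc n) - cheb_W n"

lemma degree_cheb_T: "degree (cheb_T n) \<le> n"
  by (induction n rule: cheb_T.induct) (auto intro!: degree_diff_le simp: degree_pCons_eq_if order.trans[OF degree_smult_le])

lemma degree_cheb_W: "degree (cheb_W n) \<le> n"
  by (induction n rule: cheb_W.induct) (auto intro!: degree_diff_le simp: degree_pCons_eq_if order.trans[OF degree_smult_le])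

lemma cheb_T_cos: "poly (cheb_T n) (cos x) = cos (real n * x)"
proof (induction n rule: cheb_T.induct)
  case (3 n)
  have "cos (real (Suc (Suc n)) * x) + cos (real n * x) = 2 * cos x * cos (real (Suc n) * x)"
    using cos_add[of "real (Suc n) * x" x] cos_diff[of "real (Suc n) * x" x] by (simp add: algebra_simps)
  then show ?case using 3 by (simp add: algebra_simps)
qed auto

lemma cheb_T_cosh: "poly (cheb_T n) (cosh x) = cosh (real n * x)"
proof (induction n rule: cheb_T.induct)
  case (3 n)
  have "cosh (real (Suc (Suc n)) * x) + cosh (real n * x) = 2 * cosh x * cosh (real (Suc n) * x)"
    using cosh_add[of "real (Suc n) * x" x] cosh_diff[of "real (Suc n) * x" x] by (simp add: algebra_simps)
  then show ?case using 3 by (simp add: algebra_simps)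
qed auto

text \<open>The classical value sin((n + 1/2)t) / sin(t/2) with t = 2x, multiplied out to avoid the
  division.\<close>

lemma cheb_W_cos: "poly (cheb_W n) (cos (2 * x)) * sin x = sin ((2 * real n + 1) * x)"
proof (induction n rule: cheb_W.induct)
  case 2
  have "sin (3 * x) + sin (- x) = 2 * sin x * cos (2 * x)"
    using sin_plus_sin[of "3 * x" "- x"] by simp
  then show ?case by (simp add: algebra_simps)
next
  case (3 n)
  have "sin ((2 * real (Suc (Suc n)) + 1) * x) + sin ((2 * real n + 1) * x)
      = 2 * cos (2 * x) * sin ((2 * real (Suc n) + 1) * x)"
    using sin_add[of "(2 * real (Suc n) + 1) * x" "2 * x"] sin_diff[of "(2 * real (Suc n) + 1) * x" "2 * x"]
    by (simp add: algebra_simps)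
  then show ?case using 3 by (simp add: algebra_simps)
qed auto

lemma cheb_W_cosh: "poly (cheb_W n) (cosh (2 * x)) * sinh x = sinh ((2 * real n + 1) * x)"
proof (induction n rule: cheb_W.induct)
  case 2
  have "sinh (3 * x) = sinh (2 * x) * cosh x + cosh (2 * x) * sinh x"
    using sinh_add[of "2 * x" x] by simp
  moreover have "sinh x = sinh (2 * x) * cosh x - cosh (2 * x) * sinh x"
    using sinh_diff[of "2 * x" x] by simp
  ultimately show ?case by (simp add: algebra_simps)
next
  case (3 n)
  have "sinh ((2 * real (Suc (Suc n)) + 1) * x) + sinh ((2 * real n + 1) * x)
      = 2 * cosh (2 * x) * sinh ((2 * real (Suc n) + 1) * x)"
    using sinh_add[of "(2 * real (Suc n) + 1) * x" "2 * x"] sinh_diff[of "(2 * real (Suc n) + 1) * x" "2 * x"]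
    by (simp add: algebra_simps)
  then show ?case using 3 by (simp add: algebra_simps)
qed auto

text \<open>This is artanh x >= x. It yields both the growth rate of Chebyshev polynomials and tanh
  x <= x.\<close>

lemma ln_ratio_ge:
  fixes x :: real
  assumes "0 \<le> x" "x < 1"
  shows "2 * x \<le> ln ((1 + x) / (1 - x))"
proof -
  have "ln (1 + 0) - ln (1 - 0) - 2 * 0 \<le> ln (1 + x) - ln (1 - x) - 2 * x"
  proof (rule DERIV_nonneg_imp_nondecreasing[OF assms(1)])
    fix t assume t: "0 \<le> t" "t \<le> x"
    then have "t < 1" using assms by simp
    then have "((\<lambda>t. ln (1 + t) - ln (1 - t) - 2 * t) has_real_derivative 1 / (1 + t) + 1 / (1 - t) - 2) (at t)"
      using t by (auto intro!: derivative_eq_intros simp: divide_inverse)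
    moreover have "1 / (1 + t) + 1 / (1 - t) - 2 = 2 * t\<^sup>2 / ((1 + t) * (1 - t))"
      using t \<open>t < 1\<close> by (simp add: divide_simps) (simp add: algebra_simps power2_eq_square)
    moreover have "0 \<le> 2 * t\<^sup>2 / ((1 + t) * (1 - t))"
      using t \<open>t < 1\<close> by (intro divide_nonneg_nonneg mult_nonneg_nonneg) auto
    ultimately show "\<exists>y. ((\<lambda>t. ln (1 + t) - ln (1 - t) - 2 * t) has_real_derivative y) (at t) \<and> 0 \<le> y"
      by metis
  qed
  then show ?thesis using assms by (simp add: ln_div)
qed

lemma tanh_le_self:
  fixes x :: real
  assumes "0 \<le> x"
  shows "tanh x \<le> x"
  using ln_ratio_ge[of "tanh x"] assms tanh_real_lt_1[of x] artanh_tanh_real[of x]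
  by (simp add: artanh_def)

text \<open>The optimal polynomial is T_t(l(x)) / T_t(l(0)), where l maps the interval from \<mu> to
  L onto the interval from -1 to 1. There the numerator is at most 1, so only the growth of T_t at
  l(0) matters.\<close>

lemma chebyshev_damping_polynomial:
  fixes \<mu> L :: real
  assumes "0 < \<mu>" "\<mu> < L" and t: "1/2 * sqrt (L / \<mu>) * ln (L / \<mu>) \<le> real t"
  obtains p where "degree p \<le> t" "poly p 0 = 1"
    "\<And>x. \<mu> \<le> x \<Longrightarrow> x \<le> L \<Longrightarrow> \<bar>poly p x\<bar> \<le> 2 * \<mu> / L"
proof -
  define k where "k = sqrt (L / \<mu>)"
  have "sqrt 1 < k" unfolding k_def using assms by (intro real_sqrt_less_mono) simp
  then have k: "1 < k" by simp
  have k2: "k\<^sup>2 = L / \<mu>" using assms by (simp add: k_def)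
  \<comment> \<open>The inverse hyperbolic cosine of l(0) = (L + \<mu>)/(L - \<mu>). It is at least
    2/k, so the assumed t gives t\<phi> >= ln(L/\<mu>).\<close>
  define \<phi> where "\<phi> = ln ((k + 1) / (k - 1))"
  have ratio: "(k + 1) / (k - 1) = (1 + 1 / k) / (1 - 1 / k)" using k by (simp add: field_simps)
  have \<phi>: "2 / k \<le> \<phi>" using ln_ratio_ge[of "1 / k"] k ratio by (simp add: \<phi>_def)
  have "cosh \<phi> = ((k + 1) / (k - 1) + (k - 1) / (k + 1)) / 2"
    unfolding \<phi>_def using k by (subst cosh_ln_real) auto
  also have "\<dots> = (k\<^sup>2 + 1) / (k\<^sup>2 - 1)"
  proof -
    have "k\<^sup>2 - 1 = (k + 1) * (k - 1)" by (simp add: power2_eq_square algebra_simps)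
    then show ?thesis using k by (simp add: divide_simps) (simp add: power2_eq_square algebra_simps)
  qed
  also have "\<dots> = (L + \<mu>) / (L - \<mu>)" using assms by (simp add: k2 field_simps)
  finally have c: "cosh \<phi> = (L + \<mu>) / (L - \<mu>)" .
  have "ln (L / \<mu>) = (1/2 * k * ln (L / \<mu>)) * (2 / k)" using k by simp
  also have "\<dots> \<le> real t * \<phi>"
    using t \<phi> k assms by (intro mult_mono) (auto simp: k_def)
  finally have "L / \<mu> \<le> exp (real t * \<phi>)"
    using assms by (metis divide_pos_pos exp_le_cancel_iff exp_ln order_less_trans)
  also have "exp (real t * \<phi>) \<le> 2 * cosh (real t * \<phi>)" by (simp add: cosh_def)
  finally have large: "L / (2 * \<mu>) \<le> cosh (real t * \<phi>)" by (simp add: field_simps)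
  define l where "l = [:(L + \<mu>) / (L - \<mu>), - 2 / (L - \<mu>):]"
  define p where "p = smult (1 / cosh (real t * \<phi>)) (pcompose (cheb_T t) l)"
  have "degree p \<le> degree (cheb_T t) * degree l" by (simp add: p_def degree_pcompose)
  also have "\<dots> \<le> t * 1" using degree_cheb_T[of t] by (intro mult_mono) (auto simp: l_def)
  finally have "degree p \<le> t" by simp
  moreover have "poly p 0 = 1"
    using cheb_T_cosh[of t \<phi>] by (simp add: p_def l_def poly_pcompose c)
  moreover have "\<bar>poly p x\<bar> \<le> 2 * \<mu> / L" if "\<mu> \<le> x" "x \<le> L" for x
  proof -
    have "poly l x = (L + \<mu> - 2 * x) / (L - \<mu>)" by (simp add: l_def diff_divide_distrib)
    then have "poly l x \<le> 1" "-1 \<le> poly l x"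
      using that assms by (simp_all add: pos_divide_le_eq pos_le_divide_eq)
    then have "poly l x = cos (arccos (poly l x))" by simp
    then have "\<bar>poly (cheb_T t) (poly l x)\<bar> \<le> 1" by (metis cheb_T_cos abs_cos_le_one)
    then have "\<bar>poly p x\<bar> \<le> 1 / cosh (real t * \<phi>)"
      by (simp add: p_def poly_pcompose abs_mult divide_right_mono)
    also have "\<dots> \<le> 1 / (L / (2 * \<mu>))" using large assms by (intro divide_left_mono) auto
    finally show ?thesis by simp
  qed
  ultimately show ?thesis by (rule that)
qed

section \<open>Krylov approximation in an eigenbasis\<close>

context eigenbasis
begin

text \<open>Since p(0) = 1, the polynomial 1 - p(X + c) is divisible by X + c, with quotient w of
  degree below t. The point is x = -w(A) b; as b = -(A + c)x0, the error x - x0 is -p(A +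
  c)x0.\<close>

lemma krylov_contains_damped:
  assumes x0: "A *v x0 + c *\<^sub>R x0 = - b" and p: "degree p \<le> t" "poly p 0 = 1" and t: "0 < t"
  obtains x where "x \<in> krylov A {b} t" "\<And>v. v \<in> B \<Longrightarrow> (x - x0) \<bullet> v = - (poly p (eig v + c) * (x0 \<bullet> v))"
proof -
  define q where "q = 1 - pcompose p [:c, 1:]"
  have "poly q (- c) = 0" using p by (simp add: q_def poly_pcompose)
  then obtain w where w: "q = [:c, 1:] * w" using poly_eq_0_iff_dvd[of q "- c"] by (auto elim: dvdE)
  have dq: "degree q \<le> t" unfolding q_def using p by (intro degree_diff_le) (auto simp: degree_pcompose)
  have "degree w < t"
  proof (cases "w = 0")
    case False
    then have "degree q = 1 + degree w" unfolding w by (subst degree_mult_eq) auto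
    then show ?thesis using dq by simp
  qed (use t in simp)
  then have 1: "mat_poly (- w) A b \<in> krylov A {b} t" by (intro mat_poly_in_krylov) auto
  have "(mat_poly (- w) A b - x0) \<bullet> v = - (poly p (eig v + c) * (x0 \<bullet> v))" if "v \<in> B" for v
  proof -
    have "- b \<bullet> v = (eig v + c) * (x0 \<bullet> v)"
      using mult_inner[OF that, of x0] by (simp add: x0[symmetric] inner_add_left distrib_right)
    then have "b \<bullet> v = - ((eig v + c) * (x0 \<bullet> v))" by simp
    moreover have "(eig v + c) * poly w (eig v) = 1 - poly p (eig v + c)"
      using arg_cong[OF w, of "\<lambda>q. poly q (eig v)"] by (simp add: q_def poly_pcompose algebra_simps)
    ultimately have "poly (- w) (eig v) * (b \<bullet> v) = (1 - poly p (eig v + c)) * (x0 \<bullet> v)"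
    proof -
      have "poly (- w) (eig v) * (b \<bullet> v) = ((eig v + c) * poly w (eig v)) * (x0 \<bullet> v)"
        by (simp add: \<open>b \<bullet> v = _\<close>)
      with \<open>(eig v + c) * poly w (eig v) = _\<close> show ?thesis by simp
    qed
    then show ?thesis using mat_poly_inner[OF that] by (simp add: inner_diff_left algebra_simps)
  qed
  then show ?thesis using that[OF 1] by blast
qed

text \<open>Minimizing the quadratic on the subspace minimizes the energy norm of the error, which
  the damped point bounds by L(2\<mu>/L)^2 |x0|^2. Passing from the squared energy norm to the
  squared residual costs another factor L, and all powers of L cancel.\<close>

lemma regularized_krylov_residual:
  assumes x0: "A *v x0 + c *\<^sub>R x0 = - b"
    and ev: "\<And>v. v \<in> B \<Longrightarrow> \<mu> \<le> eig v + c" "\<And>v. v \<in> B \<Longrightarrow> eig v + c \<le> L"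
    and mu: "0 < \<mu>" "\<mu> < L" and t: "1/2 * sqrt (L / \<mu>) * ln (L / \<mu>) \<le> real t"
    and z: "\<And>x. x \<in> krylov A {b} t \<Longrightarrow>
      qmodel (\<lambda>x. A *v x + c *\<^sub>R x) b z \<le> qmodel (\<lambda>x. A *v x + c *\<^sub>R x) b x"
  shows "norm (A *v z + c *\<^sub>R z + b) \<le> 2 * \<mu> * norm x0"
proof -
  define M where "M = (\<lambda>x. A *v x + c *\<^sub>R x)"
  interpret sym_operator M
    using self_adjoint
    by unfold_locales (auto simp: M_def linear_iff matrix_vector_right_distrib matrix_vector_mult_scaleR
      self_adjoint_def inner_add_left inner_add_right algebra_simps)
  have Mv: "M x \<bullet> v = (eig v + c) * (x \<bullet> v)" if "v \<in> B" for x v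
    using mult_inner[OF that, of x] by (simp add: M_def inner_add_left algebra_simps)
  have xMx: "x \<bullet> M x = (\<Sum>v\<in>B. (eig v + c) * (x \<bullet> v)\<^sup>2)" for x
    by (subst inner_eq_sum, intro sum.cong) (auto simp: Mv power2_eq_square)
  have Mx0: "M x0 + b = 0" using x0 by (simp add: M_def)
  have "0 < 1/2 * sqrt (L / \<mu>) * ln (L / \<mu>)" using mu by (intro mult_pos_pos) auto
  then have tpos: "0 < t" using t by linarith
  obtain p where p: "degree p \<le> t" "poly p 0 = 1"
    "\<And>x. \<mu> \<le> x \<Longrightarrow> x \<le> L \<Longrightarrow> \<bar>poly p x\<bar> \<le> 2 * \<mu> / L"
    using chebyshev_damping_polynomial[OF mu t] by blast
  obtain x where x: "x \<in> krylov A {b} t"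
    and xv: "\<And>v. v \<in> B \<Longrightarrow> (x - x0) \<bullet> v = - (poly p (eig v + c) * (x0 \<bullet> v))"
    using krylov_contains_damped[OF x0 p(1,2) tpos] by blast
  have "(z - x0) \<bullet> M (z - x0) \<le> (x - x0) \<bullet> M (x - x0)"
    using z[OF x] qmodel_expand[of b z x0] qmodel_expand[of b x x0] Mx0
    unfolding M_def[symmetric] by simp
  also have "\<dots> \<le> (\<Sum>v\<in>B. L * (2 * \<mu> / L)\<^sup>2 * (x0 \<bullet> v)\<^sup>2)"
    unfolding xMx
  proof (rule sum_mono)
    fix v assume v: "v \<in> B"
    have "(poly p (eig v + c))\<^sup>2 \<le> (2 * \<mu> / L)\<^sup>2"
      using p(3)[OF ev(1)[OF v] ev(2)[OF v]] by (metis abs_ge_zero power2_abs power_mono)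
    then have "(eig v + c) * (poly p (eig v + c))\<^sup>2 \<le> L * (2 * \<mu> / L)\<^sup>2"
      using ev[OF v] mu by (intro mult_mono) auto
    then have "(eig v + c) * (poly p (eig v + c))\<^sup>2 * (x0 \<bullet> v)\<^sup>2 \<le> L * (2 * \<mu> / L)\<^sup>2 * (x0 \<bullet> v)\<^sup>2"
      by (intro mult_right_mono) auto
    then show "(eig v + c) * ((x - x0) \<bullet> v)\<^sup>2 \<le> L * (2 * \<mu> / L)\<^sup>2 * (x0 \<bullet> v)\<^sup>2"
      by (simp add: xv[OF v] power_mult_distrib mult_ac)
  qed
  also have "\<dots> = L * (2 * \<mu> / L)\<^sup>2 * (x0 \<bullet> x0)"
    by (simp add: inner_eq_sum[of x0 x0] sum_distrib_left power2_eq_square)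
  finally have energy: "(z - x0) \<bullet> M (z - x0) \<le> L * (2 * \<mu> / L)\<^sup>2 * (x0 \<bullet> x0)" .
  have "M z + b = M (z - x0)" using Mx0 by (simp add: op_simps add_eq_0_iff2)
  then have "(norm (M z + b))\<^sup>2 = (\<Sum>v\<in>B. (eig v + c) * ((eig v + c) * ((z - x0) \<bullet> v)\<^sup>2))"
    by (simp add: power2_norm_eq_inner)
       (subst inner_eq_sum, intro sum.cong, auto simp: Mv power2_eq_square)
  also have "\<dots> \<le> (\<Sum>v\<in>B. L * ((eig v + c) * ((z - x0) \<bullet> v)\<^sup>2))"
  proof (rule sum_mono)
    fix v assume "v \<in> B"
    then show "(eig v + c) * ((eig v + c) * ((z - x0) \<bullet> v)\<^sup>2) \<le> L * ((eig v + c) * ((z - x0) \<bullet> v)\<^sup>2)"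
      using ev[of v] mu by (intro mult_right_mono mult_nonneg_nonneg) auto
  qed
  also have "\<dots> = L * ((z - x0) \<bullet> M (z - x0))" by (simp add: xMx sum_distrib_left)
  also have "\<dots> \<le> L * (L * (2 * \<mu> / L)\<^sup>2 * (x0 \<bullet> x0))" using energy mu by simp
  also have "\<dots> = (2 * \<mu> * norm x0)\<^sup>2"
    using mu by (simp add: power2_norm_eq_inner[symmetric] power_mult_distrib power_divide) (simp add: power2_eq_square)
  finally show ?thesis using mu by (simp add: M_def power2_le_iff_abs_le)
qed

text \<open>With \<open>\<eta> = L tanh\<^sup>2 \<theta>\<close>, the polynomial is chosen such that \<open>(x - \<eta>) p(x)\<^sup>2\<close> is bounded by
  \<open>L - \<eta>\<close> for \<open>x\<close> in the whole spectrum, and very negative at the bottom eigenvalue, \<open>x = 0\<close>.\<close>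

lemma krylov_contains_approximate_eigenvector:
  assumes w: "w \<in> B" and ev: "\<And>v. v \<in> B \<Longrightarrow> eig w \<le> eig v" "\<And>v. v \<in> B \<Longrightarrow> eig v \<le> eig w + L"
    and L: "0 < L" and u: "norm u \<le> 1" "u \<bullet> w \<noteq> 0"
  obtains z where "z \<in> krylov A {u} (Suc n)" "norm z = 1"
    "z \<bullet> (A *v z) \<le> eig w + L * (ln (2 / \<bar>u \<bullet> w\<bar>) / (2 * real n + 1))\<^sup>2"
proof -
  define a where "a = \<bar>u \<bullet> w\<bar>"
  have a0: "0 < a" using u by (simp add: a_def)
  have "a \<le> norm u * norm w" unfolding a_def by (rule Cauchy_Schwarz_ineq2)
  then have a1: "a \<le> 1" using u norm_1[OF w] by simp
  \<comment> \<open>Chosen so that (2n + 1)\<theta> = ln(2/a), where sinh takes the value 1/a -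
    a/4.\<close>
  define \<theta> where "\<theta> = ln (2 / a) / (2 * real n + 1)"
  have \<theta>: "0 < \<theta>" unfolding \<theta>_def using a0 a1 by (intro divide_pos_pos ln_gt_zero) auto
  define \<eta> where "\<eta> = L * (tanh \<theta>)\<^sup>2"
  define D where "D = L / (cosh \<theta>)\<^sup>2"
  have D: "0 < D" using L by (simp add: D_def)
  have LD: "L - \<eta> = D"
  proof -
    have "L - \<eta> = (L * (cosh \<theta>)\<^sup>2 - L * (sinh \<theta>)\<^sup>2) / (cosh \<theta>)\<^sup>2"
      by (simp add: \<eta>_def tanh_def power_divide diff_divide_distrib)
    also have "L * (cosh \<theta>)\<^sup>2 - L * (sinh \<theta>)\<^sup>2 = L" by (simp add: cosh_square_eq algebra_simps)
    finally show ?thesis by (simp add: D_def)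
  qed
  have \<eta>D: "\<eta> = D * (sinh \<theta>)\<^sup>2" by (simp add: \<eta>_def D_def tanh_def power_divide)
  \<comment> \<open>Measured from the bottom eigenvalue, the affine map sends \<eta> to 1 and L to
    -1, and it sends 0 to 1 + 2 sinh^2 \<theta> = cosh(2\<theta>), the argument of the hyperbolic
    formula.\<close>
  define p where "p = pcompose (cheb_W n) [:1 + 2 * (eig w + \<eta>) / D, - 2 / D:]"
  have pl: "poly p l = poly (cheb_W n) (1 - 2 * ((l - eig w - \<eta>) / D))" for l
    by (simp add: p_def poly_pcompose diff_divide_distrib add_divide_distrib algebra_simps)
  have "degree p \<le> n * 1" unfolding p_def degree_pcompose
    using degree_cheb_W[of n] by (intro mult_mono) auto
  then have deg: "degree p < Suc n" by simp
  have bounded: "(eig v - eig w - \<eta>) * (poly p (eig v))\<^sup>2 \<le> D" if v: "v \<in> B" for v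
  proof (cases "0 \<le> eig v - eig w - \<eta>")
    case True
    define x where "x = (eig v - eig w - \<eta>) / D"
    have x: "0 \<le> x" "x \<le> 1" using True D LD ev(2)[OF v] by (auto simp: x_def field_simps)
    define \<tau> where "\<tau> = arccos (1 - 2 * x) / 2"
    have "cos (2 * \<tau>) = 1 - 2 * x" using x by (simp add: \<tau>_def)
    then have "x = (sin \<tau>)\<^sup>2" by (simp add: cos_double_sin)
    then have "x * (poly p (eig v))\<^sup>2 = (poly (cheb_W n) (cos (2 * \<tau>)) * sin \<tau>)\<^sup>2"
      using \<open>cos (2 * \<tau>) = 1 - 2 * x\<close> by (simp add: pl x_def power_mult_distrib)
    also have "\<dots> \<le> 1" unfolding cheb_W_cos by (simp add: abs_square_le_1)
    finally have "D * (x * (poly p (eig v))\<^sup>2) \<le> D * 1" using D by (intro mult_left_mono) auto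
    then show ?thesis using D by (simp add: x_def)
  next
    case False
    then have "(eig v - eig w - \<eta>) * (poly p (eig v))\<^sup>2 \<le> 0" by (intro mult_nonpos_nonneg) auto
    then show ?thesis using D by linarith
  qed
  have pw: "poly p (eig w) * sinh \<theta> = 1 / a - a / 4"
  proof -
    have "1 - 2 * ((eig w - eig w - \<eta>) / D) = cosh (2 * \<theta>)"
      using D by (simp add: \<eta>D cosh_double_cosh cosh_square_eq)
    then have "poly p (eig w) * sinh \<theta> = sinh (ln (2 / a))"
      unfolding pl using cheb_W_cosh[of n \<theta>] by (simp add: \<theta>_def)
    also have "\<dots> = 1 / a - a / 4" using a0 by (subst sinh_ln_real) (auto simp: field_simps)
    finally show ?thesis .
  qed
  have "a * a \<le> 1 * 1" using a0 a1 by (intro mult_mono) auto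
  then have aa: "a\<^sup>2 \<le> 1" by (simp add: power2_eq_square)
  \<comment> \<open>The bottom component contributes at most -D(1 - a^2). All other components
    together contribute at most D(|u|^2 - a^2), so the sum is not positive and the Rayleigh quotient
    is at most \<open>eig w + \<eta>\<close>.\<close>
  have bottom: "(eig w - eig w - \<eta>) * (poly p (eig w))\<^sup>2 * a\<^sup>2 \<le> - (D * (1 - a\<^sup>2))"
  proof -
    have "(1 / a - a / 4) * a = 1 - a\<^sup>2 / 4" using a0 by (simp add: field_simps power2_eq_square)
    then have "(poly p (eig w) * sinh \<theta>)\<^sup>2 * a\<^sup>2 = (1 - a\<^sup>2 / 4)\<^sup>2"
      unfolding pw by (metis power_mult_distrib)
    also have "(1 - a\<^sup>2 / 4)\<^sup>2 \<ge> 1 - a\<^sup>2"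
    proof -
      have "(1 - a\<^sup>2 / 4)\<^sup>2 = 1 - a\<^sup>2 / 2 + (a\<^sup>2 / 4)\<^sup>2" by (simp add: power2_diff)
      moreover have "0 \<le> (a\<^sup>2 / 4)\<^sup>2" "0 \<le> a\<^sup>2" by (rule zero_le_power2)+
      ultimately show ?thesis by linarith
    qed
    finally have "D * (1 - a\<^sup>2) \<le> D * ((poly p (eig w) * sinh \<theta>)\<^sup>2 * a\<^sup>2)" using D by simp
    then show ?thesis by (simp add: \<eta>D power_mult_distrib mult_ac)
  qed
  define y where "y = mat_poly p A u"
  have "y \<bullet> (A *v y) - (eig w + \<eta>) * (y \<bullet> y) = (\<Sum>v\<in>B. (eig v - eig w - \<eta>) * (y \<bullet> v)\<^sup>2)"
    unfolding quad_eq_sum[of y] inner_eq_sum[of y y] sum_distrib_left sum_subtractf[symmetric]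
    by (intro sum.cong) (simp_all add: power2_eq_square left_diff_distrib distrib_right mult.assoc)
  also have "\<dots> = (\<Sum>v\<in>B. (eig v - eig w - \<eta>) * (poly p (eig v))\<^sup>2 * (u \<bullet> v)\<^sup>2)"
    by (intro sum.cong) (auto simp: y_def mat_poly_inner power_mult_distrib)
  also have "\<dots> = (eig w - eig w - \<eta>) * (poly p (eig w))\<^sup>2 * a\<^sup>2
      + (\<Sum>v\<in>B - {w}. (eig v - eig w - \<eta>) * (poly p (eig v))\<^sup>2 * (u \<bullet> v)\<^sup>2)"
    by (subst sum.remove[OF finite_B w]) (simp add: a_def)
  also have "\<dots> \<le> - (D * (1 - a\<^sup>2)) + (\<Sum>v\<in>B - {w}. D * (u \<bullet> v)\<^sup>2)"
    using bottom bounded by (intro add_mono sum_mono mult_right_mono) auto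
  also have "(\<Sum>v\<in>B - {w}. D * (u \<bullet> v)\<^sup>2) = D * (u \<bullet> u - a\<^sup>2)"
    unfolding inner_eq_sum[of u u] using sum.remove[OF finite_B w, of "\<lambda>v. (u \<bullet> v) * (u \<bullet> v)"]
    by (simp add: sum_distrib_left a_def power2_eq_square)
  also have "D * (u \<bullet> u - a\<^sup>2) \<le> D * (1 - a\<^sup>2)"
  proof -
    have "(norm u)\<^sup>2 \<le> 1" using u by (simp add: abs_square_le_1)
    then show ?thesis using D by (simp add: power2_norm_eq_inner)
  qed
  finally have main: "y \<bullet> (A *v y) \<le> (eig w + \<eta>) * (y \<bullet> y)" by simp
  have "a / 4 < 1 / a" using a0 a1 aa by (simp add: field_simps power2_eq_square)
  then have "poly p (eig w) \<noteq> 0" using pw by auto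
  then have "y \<bullet> w \<noteq> 0" using u mat_poly_inner[OF w] by (simp add: y_def)
  then have "y \<noteq> 0" by auto
  define z where "z = y /\<^sub>R norm y"
  have 1: "z \<in> krylov A {u} (Suc n)"
    unfolding z_def y_def using mat_poly_in_krylov[of u "{u}" p] deg
    by (intro subspace_scale[OF subspace_krylov]) auto
  have 2: "norm z = 1" using \<open>y \<noteq> 0\<close> by (simp add: z_def)
  have "z \<bullet> (A *v z) = (y \<bullet> (A *v y)) / (norm y)\<^sup>2"
    by (simp add: z_def matrix_vector_mult_scaleR power2_eq_square divide_inverse mult_ac)
  also have "\<dots> \<le> eig w + \<eta>" using main \<open>y \<noteq> 0\<close> by (simp add: power2_norm_eq_inner divide_le_eq)
  also have "\<eta> \<le> L * \<theta>\<^sup>2"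
    unfolding \<eta>_def using tanh_le_self[of \<theta>] \<theta> L by (intro mult_left_mono power_mono) auto
  finally show ?thesis using that[OF 1 2] by (simp add: \<theta>_def a_def)
qed

end

lemma continuous_on_matrix_vector_mult:
  fixes f :: "'a::topological_space \<Rightarrow> real^'n^'m" and h :: "'a \<Rightarrow> real^'n"
  assumes "continuous_on S f" "continuous_on S h"
  shows "continuous_on S (\<lambda>x. f x *v h x)"
  unfolding matrix_vector_mult_def using assms
  by (intro continuous_on_vec_lambda continuous_intros)

section \<open>The cubic model\<close>

definition cmodel :: "real \<Rightarrow> real^'n^'n \<Rightarrow> real^'n \<Rightarrow> real^'n \<Rightarrow> real" where
  "cmodel \<rho> A b x = 1/2 * (x \<bullet> (A *v x)) + b \<bullet> x + \<rho> / 3 * norm x ^ 3"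

definition cubic_minimizer :: "real \<Rightarrow> real^'n^'n \<Rightarrow> real^'n \<Rightarrow> real^'n \<Rightarrow> bool" where
  "cubic_minimizer \<rho> A b s \<longleftrightarrow> (\<forall>x. cmodel \<rho> A b s \<le> cmodel \<rho> A b x)"

lemma cmodel_0: "cmodel \<rho> A b 0 = 0"
  by (simp add: cmodel_def)

text \<open>With t = |s + h| and R = |s|, the identity t^3 = R^3 + (3/2)R(t^2 - R^2) + (t - R)^2 (t
  + R/2) expands the cube through t^2, which is polynomial in h, and leaves a second-order remainder
  because |t - R| <= |h|. No derivative of the norm is involved, so s = 0 is included.\<close>

lemma cube_norm_add_le:
  fixes s h :: "'a::real_inner"
  shows "norm (s + h) ^ 3 \<le> norm s ^ 3 + 3 * norm s * (s \<bullet> h) + 3/2 * norm s * (h \<bullet> h)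
    + (h \<bullet> h) * (3/2 * norm s + norm h)"
proof -
  define R t where "R = norm s" and "t = norm (s + h)"
  have t2: "t\<^sup>2 = R\<^sup>2 + 2 * (s \<bullet> h) + h \<bullet> h"
    by (simp add: R_def t_def power2_norm_eq_inner inner_add_left inner_add_right inner_commute)
  have "\<bar>t - R\<bar> \<le> norm h" unfolding t_def R_def using norm_triangle_ineq3[of "s + h" s] by simp
  then have "\<bar>t - R\<bar>\<^sup>2 \<le> (norm h)\<^sup>2" by (intro power_mono) auto
  then have 1: "(t - R)\<^sup>2 \<le> h \<bullet> h" by (simp add: power2_norm_eq_inner)
  have 2: "t \<le> R + norm h" unfolding t_def R_def by (rule norm_triangle_ineq)
  have "t ^ 3 = R ^ 3 + 3/2 * R * (t\<^sup>2 - R\<^sup>2) + (t - R)\<^sup>2 * (t + R / 2)"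
    by (simp add: power2_eq_square power3_eq_cube field_simps)
  also have "(t - R)\<^sup>2 * (t + R / 2) \<le> (h \<bullet> h) * (3/2 * R + norm h)"
    using 1 2 by (intro mult_mono) (auto simp: t_def R_def)
  finally show ?thesis unfolding R_def[symmetric] t_def[symmetric] t2 by (simp add: algebra_simps)
qed

context
  fixes A :: "real^'n^'n" and b s :: "real^'n" and \<rho> :: real
  assumes sa: "self_adjoint A" and rho: "0 < \<rho>" and min: "cubic_minimizer \<rho> A b s"
begin

text \<open>The model is tested in the direction -G of its own gradient.\<close>

lemma cubic_minimizer_stationary: "A *v s + b + (\<rho> * norm s) *\<^sub>R s = 0"
proof -
  define G where "G = A *v s + b + (\<rho> * norm s) *\<^sub>R s"
  \<comment> \<open>The second-order terms of the test, with |h| in the remainder replaced by |G|;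
    this is where t <= 1 enters.\<close>
  define C where "C = 1/2 * (G \<bullet> (A *v G)) + \<rho> * norm s / 2 * (G \<bullet> G)
    + \<rho> / 3 * (G \<bullet> G) * (3/2 * norm s + norm G)"
  have "G \<bullet> G \<le> 0"
  proof (rule nonpos_if_quadratic_nonneg)
    fix t :: real assume t: "0 < t" "t \<le> 1"
    define h where "h = - t *\<^sub>R G"
    have cube: "\<rho> / 3 * norm (s + h) ^ 3 \<le> \<rho> / 3 * (norm s ^ 3 + 3 * norm s * (s \<bullet> h)
        + 3/2 * norm s * (h \<bullet> h) + (h \<bullet> h) * (3/2 * norm s + norm h))"
      using cube_norm_add_le[of s h] rho by (intro mult_left_mono) auto
    have sym: "h \<bullet> (A *v s) = s \<bullet> (A *v h)" "(A *v s) \<bullet> h = s \<bullet> (A *v h)"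
      using sa by (metis inner_commute self_adjoint_def)+
    have "0 \<le> cmodel \<rho> A b (s + h) - cmodel \<rho> A b s" using min by (simp add: cubic_minimizer_def)
    also have "\<dots> \<le> G \<bullet> h + 1/2 * (h \<bullet> (A *v h)) + \<rho> * norm s / 2 * (h \<bullet> h)
        + \<rho> / 3 * (h \<bullet> h) * (3/2 * norm s + norm h)"
      using cube unfolding cmodel_def G_def
      by (simp add: matrix_vector_right_distrib inner_add_left inner_add_right sym algebra_simps add_divide_distrib)
    also have "\<rho> / 3 * (h \<bullet> h) * (3/2 * norm s + norm h) \<le> \<rho> / 3 * (h \<bullet> h) * (3/2 * norm s + norm G)"
      using t rho by (intro mult_left_mono) (auto simp: h_def mult_left_le_one_le)
    also have "G \<bullet> h + 1/2 * (h \<bullet> (A *v h)) + \<rho> * norm s / 2 * (h \<bullet> h)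
        + \<rho> / 3 * (h \<bullet> h) * (3/2 * norm s + norm G) = - t * (G \<bullet> G) + t\<^sup>2 * C"
      by (simp add: h_def C_def matrix_vector_mult_scaleR power2_eq_square algebra_simps add_divide_distrib
          flip: scaleR_minus_left)
    finally show "0 \<le> - t * (G \<bullet> G) + t\<^sup>2 * C" by simp
  qed
  then have "G = 0" using inner_gt_zero_iff[of G] by linarith
  then show ?thesis by (simp add: G_def)
qed

lemma cubic_minimizer_linear_term: "b \<bullet> x = - (s \<bullet> (A *v x)) - \<rho> * norm s * (s \<bullet> x)"
proof -
  have "(A *v s + b + (\<rho> * norm s) *\<^sub>R s) \<bullet> x = 0" by (simp add: cubic_minimizer_stationary)
  then show ?thesis using sa by (simp add: inner_add_left self_adjoint_def)
qed

text \<open>On the sphere through \<open>s\<close> the cubic term is constant, and |w| = |s| turns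
  the linear term left by stationarity into a square. The model difference is then exactly half of
  this form.\<close>

lemma cubic_minimizer_difference:
  assumes "norm w = norm s"
  shows "0 \<le> (w - s) \<bullet> (A *v (w - s)) + \<rho> * norm s * ((w - s) \<bullet> (w - s))"
proof -
  have "w \<bullet> (A *v s) = s \<bullet> (A *v w)"
    using sa by (metis inner_commute self_adjoint_def)
  moreover have "w \<bullet> w = s \<bullet> s" using assms by (simp add: norm_eq)
  moreover have "0 \<le> cmodel \<rho> A b w - cmodel \<rho> A b s" using min by (simp add: cubic_minimizer_def)
  ultimately show ?thesis
    by (simp add: cmodel_def assms cubic_minimizer_linear_term matrix_vector_mult_diff_distrib inner_diff_left inner_diff_right
        inner_commute[of w s] algebra_simps)
qed

text \<open>Reflections of \<open>s\<close> lie on the sphere through \<open>s\<close>, and their differences to \<open>s\<close> point in every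
  direction that is not orthogonal to \<open>s\<close>; the remaining directions follow by continuity.\<close>

lemma cubic_minimizer_psd: "0 \<le> x \<bullet> (A *v x) + \<rho> * norm s * (x \<bullet> x)"
proof (cases "s = 0")
  case True
  then have b: "b = 0" using cubic_minimizer_stationary by simp
  \<comment> \<open>There is no sphere at s = 0; instead the quadratic term dominates the cubic one
    along small multiples of x.\<close>
  have "- (x \<bullet> (A *v x)) \<le> 0"
  proof (rule nonpos_if_quadratic_nonneg)
    fix t :: real assume t: "0 < t" "t \<le> 1"
    have "0 \<le> cmodel \<rho> A b (t *\<^sub>R x)" using min by (metis True cmodel_0 cubic_minimizer_def)
    also have "\<dots> = t / 2 * (t * (x \<bullet> (A *v x)) + t\<^sup>2 * (2 * \<rho> / 3 * norm x ^ 3))"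
      using t by (simp add: cmodel_def b matrix_vector_mult_scaleR power_mult_distrib)
        (simp add: power2_eq_square power3_eq_cube algebra_simps)
    finally show "0 \<le> - t * - (x \<bullet> (A *v x)) + t\<^sup>2 * (2 * \<rho> / 3 * norm x ^ 3)"
      using t by (simp add: zero_le_mult_iff)
  qed
  then show ?thesis using True by simp
next
  case False
  define Q where "Q x = x \<bullet> (A *v x) + \<rho> * norm s * (x \<bullet> x)" for x
  have generic: "0 \<le> Q x" if "s \<bullet> x \<noteq> 0" for x
  proof -
    define k where "k = - 2 * (s \<bullet> x) / (x \<bullet> x)"
    have k: "k \<noteq> 0" using that by (auto simp: k_def)
    have "x \<bullet> x \<noteq> 0" using that by auto
    then have "k * (k * (x \<bullet> x)) + 2 * k * (s \<bullet> x) = 0" by (simp add: k_def)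
    then have "(s + k *\<^sub>R x) \<bullet> (s + k *\<^sub>R x) = s \<bullet> s"
      by (simp add: inner_add_left inner_add_right inner_commute algebra_simps)
    then have "norm (s + k *\<^sub>R x) = norm s" by (simp add: norm_eq)
    from cubic_minimizer_difference[OF this] have "0 \<le> k\<^sup>2 * Q x"
      by (simp add: Q_def matrix_vector_mult_scaleR power2_eq_square algebra_simps)
    then show ?thesis using k by (simp add: zero_le_mult_iff)
  qed
  have "0 \<le> Q x"
  proof (cases "s \<bullet> x = 0")
    case True
    have "continuous_on UNIV (\<lambda>t. Q (x + t *\<^sub>R s))"
      unfolding Q_def by (intro continuous_intros continuous_on_matrix_vector_mult)
    then have "(\<lambda>t. Q (x + t *\<^sub>R s)) \<midarrow>0\<rightarrow> Q (x + 0 *\<^sub>R s)"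
      unfolding continuous_on_def by (metis UNIV_I)
    moreover have "\<forall>\<^sub>F t in at 0. 0 \<le> Q (x + t *\<^sub>R s)"
    proof -
      have "0 \<le> Q (x + t *\<^sub>R s)" if "t \<noteq> 0" for t
        using generic[of "x + t *\<^sub>R s"] that False True by (simp add: inner_add_right)
      then show ?thesis by (simp add: eventually_at_filter)
    qed
    ultimately have "0 \<le> Q (x + 0 *\<^sub>R s)" by (intro tendsto_lowerbound) auto
    then show ?thesis by simp
  qed (rule generic)
  then show ?thesis by (simp add: Q_def)
qed

text \<open>Stationarity makes the value -(1/2) s . As - (2/3)\<rho>|s|^3, and s . As >=
  -\<rho>|s|^3; the constant is 1/2 - 2/3.\<close>

lemma cubic_minimizer_value: "cmodel \<rho> A b s \<le> - \<rho> / 6 * norm s ^ 3"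
proof -
  have "b \<bullet> s = - (s \<bullet> (A *v s)) - \<rho> * norm s ^ 3"
    by (simp add: cubic_minimizer_linear_term power2_norm_eq_inner[symmetric] power2_eq_square power3_eq_cube)
  moreover have "0 \<le> s \<bullet> (A *v s) + \<rho> * norm s ^ 3"
    using cubic_minimizer_psd[of s] by (simp add: power2_norm_eq_inner[symmetric] power2_eq_square power3_eq_cube)
  ultimately show ?thesis by (simp add: cmodel_def)
qed

end

lemma cubic_minimizer_exists:
  fixes A :: "real^'n^'n"
  assumes rho: "0 < \<rho>" and lower: "\<And>x. - \<beta> * (x \<bullet> x) \<le> x \<bullet> (A *v x)"
  shows "\<exists>s. cubic_minimizer \<rho> A b s"
proof -
  \<comment> \<open>Beyond R the cubic term outweighs the others: R \<rho>/3 exceeds |\<beta>| +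
    |b|, and R >= 1 lets the linear term be bounded by a quadratic one.\<close>
  define R where "R = 1 + 3 / \<rho> * (\<bar>\<beta>\<bar> + norm b)"
  have R: "1 \<le> R" using rho by (simp add: R_def)
  have "continuous_on (cball 0 R) (cmodel \<rho> A b)"
    unfolding cmodel_def by (intro continuous_intros)
  moreover have "cball (0::real^'n) R \<noteq> {}" using R by auto
  ultimately obtain s where s: "s \<in> cball 0 R" "\<And>x. x \<in> cball 0 R \<Longrightarrow> cmodel \<rho> A b s \<le> cmodel \<rho> A b x"
    using continuous_attains_inf[of "cball 0 R" "cmodel \<rho> A b"] by auto
  have "cmodel \<rho> A b s \<le> cmodel \<rho> A b x" for x
  proof (cases "norm x \<le> R")
    case False
    define n where "n = norm x"
    have n: "R < n" "1 < n" using False R by (auto simp: n_def)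
    have "\<bar>\<beta>\<bar> / 2 * n\<^sup>2 + norm b * n \<le> (\<bar>\<beta>\<bar> + norm b) * n\<^sup>2"
    proof -
      have "norm b * n \<le> norm b * n\<^sup>2" using n by (intro mult_left_mono) (auto simp: power2_eq_square)
      moreover have "\<bar>\<beta>\<bar> / 2 * n\<^sup>2 \<le> \<bar>\<beta>\<bar> * n\<^sup>2" by (intro mult_right_mono) auto
      ultimately show ?thesis unfolding distrib_right by linarith
    qed
    also have "\<dots> \<le> (\<rho> / 3 * n) * n\<^sup>2"
    proof (rule mult_right_mono)
      have "\<rho> / 3 * R \<le> \<rho> / 3 * n" using n rho by (intro mult_left_mono) auto
      moreover have "\<rho> / 3 * R = \<rho> / 3 + (\<bar>\<beta>\<bar> + norm b)" using rho by (simp add: R_def field_simps)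
      ultimately show "\<bar>\<beta>\<bar> + norm b \<le> \<rho> / 3 * n" using rho by linarith
    qed simp
    also have "\<dots> = \<rho> / 3 * n ^ 3" by (simp add: power2_eq_square power3_eq_cube)
    finally have 1: "\<bar>\<beta>\<bar> / 2 * n\<^sup>2 + norm b * n \<le> \<rho> / 3 * n ^ 3" .
    have "- (norm b * n) \<le> b \<bullet> x" using Cauchy_Schwarz_ineq2[of b x] by (simp add: n_def abs_le_iff)
    moreover have "- (\<bar>\<beta>\<bar> / 2 * n\<^sup>2) \<le> 1/2 * (x \<bullet> (A *v x))"
    proof -
      have "- \<bar>\<beta>\<bar> * (x \<bullet> x) \<le> - \<beta> * (x \<bullet> x)" by (intro mult_right_mono) auto
      then show ?thesis using lower[of x] by (simp add: n_def power2_norm_eq_inner)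
    qed
    ultimately have "0 \<le> cmodel \<rho> A b x" using 1 by (simp add: cmodel_def n_def)
    moreover have "cmodel \<rho> A b s \<le> 0" using s(2)[of 0] R by (simp add: cmodel_0)
    ultimately show ?thesis by simp
  qed (use s in simp)
  then show ?thesis by (auto simp: cubic_minimizer_def)
qed

section \<open>Taylor estimates for functions with Lipschitz Hessian\<close>

locale smooth_objective =
  fixes g :: "real^'n \<Rightarrow> real" and dg :: "real^'n \<Rightarrow> real^'n" and H :: "real^'n \<Rightarrow> real^'n^'n"
    and \<beta> \<rho> :: real
  assumes gradient: "\<And>x. GDERIV g x :> dg x"
    and hessian: "\<And>x. (dg has_derivative (\<lambda>h. H x *v h)) (at x)"
    and rho: "0 < \<rho>"
    and lipschitz_gradient: "\<beta>-lipschitz_on UNIV dg"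
    and hessian_onorm: "\<And>x x'. onorm (\<lambda>v. (H x - H x') *v v) \<le> 2 * \<rho> * norm (x - x')"
begin

lemma hessian_lipschitz: "norm ((H x - H x') *v v) \<le> 2 * \<rho> * norm (x - x') * norm v"
proof -
  have "norm ((H x - H x') *v v) \<le> onorm (\<lambda>v. (H x - H x') *v v) * norm v"
    by (rule onorm) (simp add: matrix_vector_mul_bounded_linear)
  also have "\<dots> \<le> 2 * \<rho> * norm (x - x') * norm v"
    by (intro mult_right_mono hessian_onorm) simp
  finally show ?thesis .
qed

lemma gradient_has_derivative_line:
  "((\<lambda>t. w \<bullet> dg (x + t *\<^sub>R d)) has_real_derivative w \<bullet> (H (x + t *\<^sub>R d) *v d)) (at t)"
proof -
  have "((\<lambda>t. x + t *\<^sub>R d) has_derivative (\<lambda>h. h *\<^sub>R d)) (at t)"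
    by (auto intro!: derivative_eq_intros)
  from has_derivative_compose[OF this hessian]
  have "((\<lambda>t. dg (x + t *\<^sub>R d)) has_derivative (\<lambda>h. H (x + t *\<^sub>R d) *v (h *\<^sub>R d))) (at t)" .
  then have "((\<lambda>t. w \<bullet> dg (x + t *\<^sub>R d)) has_derivative (\<lambda>h. w \<bullet> (H (x + t *\<^sub>R d) *v (h *\<^sub>R d)))) (at t)"
    by (rule has_derivative_inner_right)
  then show ?thesis
    by (simp add: has_field_derivative_def matrix_vector_mult_scaleR mult.commute[of _ "inner _ _"])
qed

lemma function_has_derivative_line:
  "((\<lambda>t. g (x + t *\<^sub>R d)) has_real_derivative dg (x + t *\<^sub>R d) \<bullet> d) (at t)"
proof -
  have "((\<lambda>t. x + t *\<^sub>R d) has_derivative (\<lambda>h. h *\<^sub>R d)) (at t)"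
    by (auto intro!: derivative_eq_intros)
  from has_derivative_compose[OF this gradient[unfolded gderiv_def]]
  show ?thesis
    by (simp add: has_field_derivative_def inner_commute mult.commute[of _ "inner _ _"])
qed

text \<open>Testing against w makes the remainder a real function of t, whose slope is at most
  2\<rho>t|d|^2|w|; no vector-valued integral is required.\<close>

lemma gradient_taylor_inner:
  assumes t: "0 \<le> t"
  shows "w \<bullet> (dg (x + t *\<^sub>R d) - dg x - t *\<^sub>R (H x *v d)) \<le> \<rho> * t\<^sup>2 * (norm d)\<^sup>2 * norm w"
proof -
  define f where "f t = w \<bullet> dg (x + t *\<^sub>R d) - t * (w \<bullet> (H x *v d)) - \<rho> * t\<^sup>2 * (norm d)\<^sup>2 * norm w" for t
  have "f t \<le> f 0"
  proof (rule DERIV_nonpos_imp_nonincreasing[OF t])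
    fix t :: real assume t: "0 \<le> t"
    have "(f has_real_derivative w \<bullet> (H (x + t *\<^sub>R d) *v d) - w \<bullet> (H x *v d)
        - 2 * \<rho> * t * (norm d)\<^sup>2 * norm w) (at t)"
      unfolding f_def by (rule derivative_eq_intros gradient_has_derivative_line refl | simp)+
    moreover have "w \<bullet> (H (x + t *\<^sub>R d) *v d) - w \<bullet> (H x *v d) \<le> 2 * \<rho> * t * (norm d)\<^sup>2 * norm w"
    proof -
      have "w \<bullet> (H (x + t *\<^sub>R d) *v d) - w \<bullet> (H x *v d) = w \<bullet> ((H (x + t *\<^sub>R d) - H x) *v d)"
        by (simp add: inner_diff_right matrix_vector_mult_diff_rdistrib)
      also have "\<dots> \<le> norm w * norm ((H (x + t *\<^sub>R d) - H x) *v d)" by (rule norm_cauchy_schwarz)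
      also have "\<dots> \<le> norm w * (2 * \<rho> * norm (t *\<^sub>R d) * norm d)"
        using hessian_lipschitz[of "x + t *\<^sub>R d" x d] by (intro mult_left_mono) auto
      finally show ?thesis using t by (simp add: power2_eq_square mult_ac)
    qed
    ultimately show "\<exists>y. (f has_real_derivative y) (at t) \<and> y \<le> 0" by (intro exI conjI) auto
  qed
  then show ?thesis by (simp add: f_def inner_diff_right)
qed

lemma gradient_taylor: "norm (dg (x + d) - dg x - H x *v d) \<le> \<rho> * (norm d)\<^sup>2"
proof -
  define w where "w = dg (x + d) - dg x - H x *v d"
  have "w \<bullet> w \<le> \<rho> * (norm d)\<^sup>2 * norm w"
    using gradient_taylor_inner[of 1 w x d] by (simp add: w_def)
  then have "norm w * norm w \<le> \<rho> * (norm d)\<^sup>2 * norm w"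
    by (simp add: power2_norm_eq_inner[symmetric] power2_eq_square)
  then show ?thesis using rho by (cases "w = 0") (auto simp: w_def)
qed

text \<open>Along the segment, the slope of the defect without its cubic term is at most
  \<rho>t^2|d|^3 by the preceding estimate with w = d; its integral has the coefficient \<rho>/3 of
  the cubic model.\<close>

lemma cubic_upper_model: "g (x + d) \<le> g x + cmodel \<rho> (H x) (dg x) d"
proof -
  define f where "f t = g (x + t *\<^sub>R d) - t * (dg x \<bullet> d) - t\<^sup>2 / 2 * (d \<bullet> (H x *v d)) - \<rho> / 3 * t ^ 3 * norm d ^ 3" for t
  have "f 1 \<le> f 0"
  proof (rule DERIV_nonpos_imp_nonincreasing[of 0 1 f])
    fix t :: real assume t: "0 \<le> t"
    have "(f has_real_derivative dg (x + t *\<^sub>R d) \<bullet> d - dg x \<bullet> d - t * (d \<bullet> (H x *v d))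
        - \<rho> * t\<^sup>2 * norm d ^ 3) (at t)"
      unfolding f_def by (rule derivative_eq_intros function_has_derivative_line refl | simp)+
    moreover have "dg (x + t *\<^sub>R d) \<bullet> d - dg x \<bullet> d - t * (d \<bullet> (H x *v d)) - \<rho> * t\<^sup>2 * norm d ^ 3 \<le> 0"
      using gradient_taylor_inner[OF t, of d x d]
      by (simp add: inner_diff_right inner_commute power2_eq_square power3_eq_cube mult_ac)
    ultimately show "\<exists>y. (f has_real_derivative y) (at t) \<and> y \<le> 0" by blast
  qed simp
  then show ?thesis by (simp add: f_def cmodel_def)
qed

text \<open>The second difference over a parallelogram is symmetric in v and w, so its expansion in
  both orders compares the two mixed second derivatives. The mean value theorem is applied along v,
  then a Taylor expansion of the gradient at both ends.\<close>

lemma mixed_difference: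
  assumes t: "0 < t"
  shows "\<bar>(g (x + t *\<^sub>R v + t *\<^sub>R w) - g (x + t *\<^sub>R w)) - (g (x + t *\<^sub>R v) - g x) - t\<^sup>2 * (v \<bullet> (H x *v w))\<bar>
    \<le> t ^ 3 * (\<rho> * ((norm v + norm w)\<^sup>2 + (norm v)\<^sup>2) * norm v)"
proof -
  define f where "f a = g ((x + t *\<^sub>R w) + a *\<^sub>R v) - g (x + a *\<^sub>R v)" for a
  have df: "(f has_real_derivative (dg ((x + t *\<^sub>R w) + a *\<^sub>R v) - dg (x + a *\<^sub>R v)) \<bullet> v) (at a)" for a
    unfolding f_def inner_diff_left
    by (intro derivative_intros function_has_derivative_line)
  obtain a where a: "0 < a" "a < t" "f t - f 0 = (t - 0) * ((dg ((x + t *\<^sub>R w) + a *\<^sub>R v) - dg (x + a *\<^sub>R v)) \<bullet> v)"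
    using MVT2[OF t df] by blast
  define e1 e2 where "e1 = dg (x + (t *\<^sub>R w + a *\<^sub>R v)) - dg x - H x *v (t *\<^sub>R w + a *\<^sub>R v)"
    and "e2 = dg (x + a *\<^sub>R v) - dg x - H x *v (a *\<^sub>R v)"
  have eq: "dg ((x + t *\<^sub>R w) + a *\<^sub>R v) - dg (x + a *\<^sub>R v) = t *\<^sub>R (H x *v w) + (e1 - e2)"
    by (simp add: e1_def e2_def matrix_vector_right_distrib matrix_vector_mult_scaleR add.assoc)
  have "f t - f 0 - t\<^sup>2 * (v \<bullet> (H x *v w)) = t * ((e1 - e2) \<bullet> v)"
    using a(3) unfolding eq by (simp add: inner_add_left inner_commute[of v] power2_eq_square distrib_left)
  also have "\<bar>\<dots>\<bar> \<le> t * ((norm e1 + norm e2) * norm v)"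
  proof -
    have "\<bar>(e1 - e2) \<bullet> v\<bar> \<le> norm (e1 - e2) * norm v" by (rule Cauchy_Schwarz_ineq2)
    also have "\<dots> \<le> (norm e1 + norm e2) * norm v" by (intro mult_right_mono norm_triangle_ineq4) simp
    finally show ?thesis using t by (simp add: abs_mult)
  qed
  also have "\<dots> \<le> t * ((\<rho> * (t * (norm v + norm w))\<^sup>2 + \<rho> * (t * norm v)\<^sup>2) * norm v)"
  proof -
    have av: "a * norm v \<le> t * norm v" using a by (intro mult_right_mono) auto
    have "norm (t *\<^sub>R w + a *\<^sub>R v) \<le> t * norm w + a * norm v"
      using norm_triangle_ineq[of "t *\<^sub>R w" "a *\<^sub>R v"] t a by simp
    then have "norm (t *\<^sub>R w + a *\<^sub>R v) \<le> t * (norm v + norm w)" using av by (simp add: distrib_left)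
    then have "\<rho> * (norm (t *\<^sub>R w + a *\<^sub>R v))\<^sup>2 \<le> \<rho> * (t * (norm v + norm w))\<^sup>2"
      using rho by (intro mult_left_mono power_mono) auto
    then have "norm e1 \<le> \<rho> * (t * (norm v + norm w))\<^sup>2"
      using gradient_taylor[of x "t *\<^sub>R w + a *\<^sub>R v"] unfolding e1_def by (rule order_trans[rotated])
    moreover have "\<rho> * (norm (a *\<^sub>R v))\<^sup>2 \<le> \<rho> * (t * norm v)\<^sup>2"
      using rho av a by (intro mult_left_mono power_mono) auto
    then have "norm e2 \<le> \<rho> * (t * norm v)\<^sup>2"
      using gradient_taylor[of x "a *\<^sub>R v"] unfolding e2_def by (rule order_trans[rotated])
    ultimately show ?thesis using t by (intro mult_left_mono mult_right_mono add_mono) auto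
  qed
  also have "\<dots> = t ^ 3 * (\<rho> * ((norm v + norm w)\<^sup>2 + (norm v)\<^sup>2) * norm v)"
    by (simp add: power_mult_distrib power2_eq_square power3_eq_cube algebra_simps)
  finally show ?thesis by (simp add: f_def add_ac)
qed

text \<open>Equality of mixed derivatives: the two expansions differ by t^2 times the commutator and
  by an error of order t^3. One inequality suffices, since v and w may be exchanged.\<close>

lemma hessian_self_adjoint: "self_adjoint (H x)"
proof -
  have "(H x *v v) \<bullet> w \<le> v \<bullet> (H x *v w)" for v w
  proof -
    define C where "C = \<rho> * ((norm v + norm w)\<^sup>2 + (norm v)\<^sup>2) * norm v + \<rho> * ((norm w + norm v)\<^sup>2 + (norm w)\<^sup>2) * norm w"
    have "(H x *v v) \<bullet> w - v \<bullet> (H x *v w) \<le> 0"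
    proof (rule nonpos_if_quadratic_nonneg)
      fix t :: real assume t: "0 < t"
      have "t\<^sup>2 * (w \<bullet> (H x *v v) - v \<bullet> (H x *v w)) \<le> t ^ 3 * C"
        using mixed_difference[OF t, of x v w] mixed_difference[OF t, of x w v]
        unfolding C_def distrib_left[of "t ^ 3"] right_diff_distrib by (simp add: add_ac abs_le_iff)
      then have "t * (t * ((H x *v v) \<bullet> w - v \<bullet> (H x *v w))) \<le> t * (t\<^sup>2 * C)"
        by (simp add: inner_commute power2_eq_square power3_eq_cube mult_ac)
      then have "t * ((H x *v v) \<bullet> w - v \<bullet> (H x *v w)) \<le> t\<^sup>2 * C" using t by simp
      then show "0 \<le> - t * ((H x *v v) \<bullet> w - v \<bullet> (H x *v w)) + t\<^sup>2 * C" by simp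
    qed
    then show ?thesis by simp
  qed
  from this this[of w v for v w] show ?thesis
    unfolding self_adjoint_def by (metis inner_commute order_antisym)
qed

text \<open>Difference quotients of the gradient along x have norm at most \<beta>|x|. The sign c
  treats the upper and the lower bound at once.\<close>

lemma hessian_bounds:
  shows hessian_upper: "x \<bullet> (H y *v x) \<le> \<beta> * (x \<bullet> x)"
    and hessian_lower: "- \<beta> * (x \<bullet> x) \<le> x \<bullet> (H y *v x)"
proof -
  have *: "c * (x \<bullet> (H y *v x)) \<le> \<beta> * (x \<bullet> x)" if "\<bar>c\<bar> = 1" for c
  proof -
    have "c * (x \<bullet> (H y *v x)) - \<beta> * (x \<bullet> x) \<le> 0"
    proof (rule nonpos_if_quadratic_nonneg)
      fix t :: real assume t: "0 < t"
      have "(- c *\<^sub>R x) \<bullet> (dg (y + t *\<^sub>R x) - dg y - t *\<^sub>R (H y *v x)) \<le> \<rho> * t\<^sup>2 * (norm x)\<^sup>2 * norm (- c *\<^sub>R x)"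
        using t by (intro gradient_taylor_inner) simp
      then have "t * (c * (x \<bullet> (H y *v x))) \<le> c * (x \<bullet> (dg (y + t *\<^sub>R x) - dg y)) + t\<^sup>2 * (\<rho> * (norm x)\<^sup>2 * norm x)"
        using that by (simp add: inner_diff_right algebra_simps)
      also have "c * (x \<bullet> (dg (y + t *\<^sub>R x) - dg y)) \<le> norm x * norm (dg (y + t *\<^sub>R x) - dg y)"
      proof -
        have "c * (x \<bullet> (dg (y + t *\<^sub>R x) - dg y)) \<le> \<bar>c\<bar> * \<bar>x \<bullet> (dg (y + t *\<^sub>R x) - dg y)\<bar>"
          by (metis abs_ge_self abs_mult)
        then show ?thesis using that Cauchy_Schwarz_ineq2[of x "dg (y + t *\<^sub>R x) - dg y"] by simp
      qed
      also have "norm x * norm (dg (y + t *\<^sub>R x) - dg y) \<le> norm x * (\<beta> * norm (t *\<^sub>R x))"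
        using lipschitz_onD[OF lipschitz_gradient, of "y + t *\<^sub>R x" y]
        by (intro mult_left_mono) (auto simp: dist_norm)
      finally show "0 \<le> - t * (c * (x \<bullet> (H y *v x)) - \<beta> * (x \<bullet> x)) + t\<^sup>2 * (\<rho> * (norm x)\<^sup>2 * norm x)"
        using t by (simp add: power2_norm_eq_inner[symmetric] power2_eq_square algebra_simps)
    qed
    then show ?thesis by simp
  qed
  show "x \<bullet> (H y *v x) \<le> \<beta> * (x \<bullet> x)" "- \<beta> * (x \<bullet> x) \<le> x \<bullet> (H y *v x)"
    using *[of 1] *[of "-1"] by simp_all
qed

lemma continuous_hessian: "continuous_on UNIV H"
proof -
  have "(H \<longlongrightarrow> H x) (at x)" for x
  proof (intro vec_tendstoI, rule LIM_zero_cancel, rule Lim_null_comparison)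
    fix i j
    have "norm (H y $ i $ j - H x $ i $ j) \<le> 2 * \<rho> * norm (y - x)" for y
    proof -
      have "H y $ i $ j - H x $ i $ j = ((H y - H x) *v axis j 1) $ i"
        by (simp add: matrix_vector_mul_component inner_axis)
      also have "norm \<dots> \<le> norm ((H y - H x) *v axis j 1)" by (simp add: component_le_norm_cart)
      also have "\<dots> \<le> 2 * \<rho> * norm (y - x)" using hessian_lipschitz[of y x "axis j 1"] by simp
      finally show ?thesis .
    qed
    then show "\<forall>\<^sub>F y in at x. norm (H y $ i $ j - H x $ i $ j) \<le> 2 * \<rho> * norm (y - x)" by simp
    have "((\<lambda>y. 2 * \<rho> * norm (y - x)) \<longlongrightarrow> 2 * \<rho> * norm (x - x)) (at x)" by (intro tendsto_intros)
    then show "((\<lambda>y. 2 * \<rho> * norm (y - x)) \<longlongrightarrow> 0) (at x)" by simp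
  qed
  then show ?thesis by (simp add: continuous_on_def)
qed

lemma continuous_gradient: "continuous_on UNIV dg"
  using lipschitz_gradient by (rule lipschitz_on_continuous_on)

end

section \<open>Anti-concentration on the sphere\<close>

definition scales_measure :: "(real^'n \<Rightarrow> real^'n) \<Rightarrow> bool" where
  "scales_measure f \<longleftrightarrow> (\<exists>c. \<forall>S \<in> lmeasurable. f ` S \<in> lmeasurable \<and>
     measure lebesgue (f ` S) = c * measure lebesgue S)"

text \<open>The library computes the factor as a determinant, but only for a well-ordered index type.\<close>

lemma linear_scales_measure:
  fixes f :: "real^'n \<Rightarrow> real^'n"
  assumes "linear f"
  shows "scales_measure f"
  using assms
proof (rule induct_linear_elementary)
  fix f g :: "real^'n \<Rightarrow> real^'n"
  assume "scales_measure f" "scales_measure g"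
  then obtain c d
    where f: "\<And>S. S \<in> lmeasurable \<Longrightarrow> f ` S \<in> lmeasurable \<and> measure lebesgue (f ` S) = c * measure lebesgue S"
      and g: "\<And>S. S \<in> lmeasurable \<Longrightarrow> g ` S \<in> lmeasurable \<and> measure lebesgue (g ` S) = d * measure lebesgue S"
    unfolding scales_measure_def by blast
  show "scales_measure (f \<circ> g)"
    unfolding scales_measure_def
  proof (intro exI ballI)
    fix S :: "(real^'n) set" assume "S \<in> lmeasurable"
    then show "(f \<circ> g) ` S \<in> lmeasurable \<and> measure lebesgue ((f \<circ> g) ` S) = (c * d) * measure lebesgue S"
      unfolding image_comp[symmetric] using f[of "g ` S"] g[of S] by simp
  qed
next
  fix f :: "real^'n \<Rightarrow> real^'n" and i
  assume f: "linear f" "\<And>x. f x $ i = 0"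
  have "axis i 1 \<notin> range f" using f(2) by (metis axis_nth rangeE zero_neq_one)
  then have "\<not> inj f" using linear_injective_imp_surjective[OF f(1)] by blast
  then have "negligible (f ` S)" for S using f(1) by (rule negligible_linear_singular_image[rotated])
  then show "scales_measure f"
    unfolding scales_measure_def by (intro exI[of _ 0]) (auto simp: negligible_iff_measure)
next
  fix c :: "'n \<Rightarrow> real"
  show "scales_measure (\<lambda>x. \<chi> i. c i * x $ i)"
    unfolding scales_measure_def using measurable_stretch measure_stretch by blast
next
  fix m n :: 'n
  let ?h = "\<lambda>x::real^'n. \<chi> i. x $ Transposition.transpose m n i"
  have lin: "linear ?h" by (rule linearI) (simp_all add: vec_eq_iff)
  have inv: "?h (?h x) = x" for x by (simp add: vec_eq_iff)
  have box: "measure lebesgue (?h ` cbox a b) = 1 * measure lebesgue (cbox a b)" for a b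
  proof -
    have image: "?h ` cbox a b = cbox (?h a) (?h b)"
    proof (intro set_eqI iffI)
      fix x assume "x \<in> cbox (?h a) (?h b)"
      then have "a $ i \<le> ?h x $ i \<and> ?h x $ i \<le> b $ i" for i
        unfolding mem_box_cart by (simp, metis transpose_involutory)
      then have "?h x \<in> cbox a b" unfolding mem_box_cart by blast
      then show "x \<in> ?h ` cbox a b" using inv by (metis image_eqI)
    qed (auto simp: mem_box_cart)
    show ?thesis
    proof (cases "cbox a b = {}")
      case False
      then have "cbox (?h a) (?h b) \<noteq> {}" unfolding image[symmetric] by blast
      then have "measure lebesgue (cbox (?h a) (?h b)) = (\<Prod>i\<in>UNIV. (b - a) $ Transposition.transpose m n i)"
        by (simp add: content_cbox_cart)
      also have "\<dots> = (\<Prod>i\<in>UNIV. (b - a) $ i)"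
        using prod.permute[OF permutes_swap_id, of m UNIV n "\<lambda>i. (b - a) $ i"] by (simp add: o_def)
      finally show ?thesis using False by (simp add: image content_cbox_cart)
    qed simp
  qed
  show "scales_measure ?h"
    unfolding scales_measure_def
  proof (intro exI ballI)
    fix S :: "(real^'n) set" assume "S \<in> lmeasurable"
    note * = measure_linear_sufficient[OF lin this box]
    show "?h ` S \<in> lmeasurable \<and> measure lebesgue (?h ` S) = 1 * measure lebesgue S"
      by (rule conjI[OF conjunct1[OF *] conjunct2[OF *, symmetric]])
  qed
next
  fix m n :: 'n
  assume mn: "m \<noteq> n"
  let ?h = "\<lambda>x::real^'n. \<chi> i. if i = m then x $ m + x $ n else x $ i"
  have lin: "linear ?h" by (rule linearI) (auto simp: vec_eq_iff algebra_simps)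
  have box: "measure lebesgue (?h ` cbox a b) = 1 * measure lebesgue (cbox a b)" for a b
  proof (cases "cbox a b = {}")
    case False
    \<comment> \<open>The translation moves the n-th lower endpoint to 0, because the formula for
      sheared boxes assumes it nonnegative.\<close>
    define w where "w = axis n (- (a $ n))"
    have shift: "(+) w ` cbox a b = cbox (w + a) (w + b)" by (simp add: cbox_translation)
    have "measure lebesgue (?h ` cbox a b) = measure lebesgue ((+) (?h w) ` ?h ` cbox a b)"
      by (rule measure_translation[symmetric])
    also have "(+) (?h w) ` ?h ` cbox a b = ?h ` (+) w ` cbox a b"
      unfolding image_image linear_add[OF lin] ..
    also have "measure lebesgue \<dots> = measure lebesgue (cbox (w + a) (w + b))"
      unfolding shift
    proof (rule measure_shear_interval[OF mn])
      show "cbox (w + a) (w + b) \<noteq> {}" using False by (simp add: shift[symmetric])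
    qed (simp add: w_def)
    also have "\<dots> = measure lebesgue (cbox a b)" unfolding shift[symmetric] by (rule measure_translation)
    finally show ?thesis by simp
  qed simp
  show "scales_measure ?h"
    unfolding scales_measure_def
  proof (intro exI ballI)
    fix S :: "(real^'n) set" assume "S \<in> lmeasurable"
    note * = measure_linear_sufficient[OF lin this box]
    show "?h ` S \<in> lmeasurable \<and> measure lebesgue (?h ` S) = 1 * measure lebesgue S"
      by (rule conjI[OF conjunct1[OF *] conjunct2[OF *, symmetric]])
  qed
qed

lemma unit_ball_measure_pos: "0 < measure lebesgue (cball (0::real^'n) 1)"
  by (simp add: content_cball_pos)

text \<open>The map preserves the unit ball, and this alone forces its scaling factor to be
  1.\<close>

lemma orthogonal_measure_invariant:
  fixes f :: "real^'n \<Rightarrow> real^'n"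
  assumes f: "orthogonal_transformation f" and S: "S \<in> lmeasurable"
  shows "f ` S \<in> lmeasurable" "measure lebesgue (f ` S) = measure lebesgue S"
proof -
  obtain c where c: "\<And>S. S \<in> lmeasurable \<Longrightarrow> f ` S \<in> lmeasurable \<and> measure lebesgue (f ` S) = c * measure lebesgue S"
    using linear_scales_measure[OF orthogonal_transformation_linear[OF f]] unfolding scales_measure_def by blast
  have "f ` cball 0 1 = cball 0 1"
  proof -
    have "f ` cball 0 1 = cball (f 0) 1" by (rule image_orthogonal_transformation_cball[OF f])
    then show ?thesis using linear_0[OF orthogonal_transformation_linear[OF f]] by simp
  qed
  then have "measure lebesgue (cball (0::real^'n) 1) = c * measure lebesgue (cball (0::real^'n) 1)"
    using c[of "cball 0 1"] by simp
  then have "c = 1" using unit_ball_measure_pos[where 'n='n] by simp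
  then show "f ` S \<in> lmeasurable" "measure lebesgue (f ` S) = measure lebesgue S" using c[OF S] by auto
qed

text \<open>For k = d - 1 > 0 this is the reciprocal of (1 + 1/k)^k, which is at most e.\<close>

lemma one_minus_inverse_power_ge:
  assumes "1 \<le> d"
  shows "1/4 \<le> (1 - 1 / real d) ^ (d - 1)"
proof (cases "d = 1")
  case False
  define k where "k = d - 1"
  have k: "0 < k" "real d = real k + 1" using assms False by (auto simp: k_def)
  have "1 + 1 / real k \<le> exp (1 / real k)" by (rule exp_ge_add_one_self)
  then have "(1 + 1 / real k) ^ k \<le> exp (1 / real k) ^ k" by (intro power_mono) auto
  also have "\<dots> = exp 1" using k by (simp add: exp_of_nat_mult[symmetric])
  also have "\<dots> \<le> 4" using exp_le by linarith
  finally have le: "(1 + 1 / real k) ^ k \<le> 4" .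
  have "1 - 1 / real d = 1 / (1 + 1 / real k)" using k by (simp add: field_simps)
  then have "(1 - 1 / real d) ^ (d - 1) = 1 / (1 + 1 / real k) ^ k" by (simp add: k_def power_divide)
  moreover have "1 / 4 \<le> 1 / (1 + 1 / real k) ^ k"
    using le k by (intro divide_left_mono) (auto intro!: mult_pos_pos zero_less_power add_pos_pos)
  ultimately show ?thesis by simp
qed simp

text \<open>Stretching the slab to height \<open>1 / sqrt d\<close> and shrinking it orthogonally by the factor
  \<open>sqrt (1 - 1/d)\<close> moves it into the ball.\<close>

lemma slab_measure:
  fixes v :: "real^'n"
  assumes v: "norm v = 1" and a: "0 < a"
  defines "S \<equiv> cball 0 1 \<inter> {x. \<bar>x \<bullet> v\<bar> < a}"
  shows "S \<in> lmeasurable"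
    "measure lebesgue S \<le> 2 * a * sqrt (real CARD('n)) * measure lebesgue (cball (0::real^'n) 1)"
proof -
  define d where "d = CARD('n)"
  have d: "1 \<le> d" by (simp add: d_def Suc_le_eq)
  have "open {x. \<bar>x \<bullet> v\<bar> < a}" by (intro open_Collect_less continuous_intros)
  then show S: "S \<in> lmeasurable"
    unfolding S_def by (intro fmeasurable_Int_fmeasurable) auto
  define k :: 'n where "k = undefined"
  have "norm (axis k 1 :: real^'n) = 1" by (rule norm_axis_1)
  then obtain f :: "real^'n \<Rightarrow> real^'n" where f: "orthogonal_transformation f" "f v = axis k 1"
    using orthogonal_transformation_exists_1[OF v] by blast
  \<comment> \<open>After rotating v to a coordinate axis, the slab coordinate contributes at most
    1/d to the squared norm and the others at most 1 - 1/d.\<close>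
  define m where "m i = (if i = k then 1 / (a * sqrt d) else sqrt (1 - 1 / d))" for i
  define h where "h x = (\<chi> i. m i * x $ i)" for x :: "real^'n"
  have norm_sq: "(norm z)\<^sup>2 = (\<Sum>i\<in>UNIV. (z $ i)\<^sup>2)" for z :: "real^'n"
    unfolding power2_norm_eq_inner inner_vec_def by (simp add: power2_eq_square)
  have "h (f x) \<in> cball 0 1" if "x \<in> S" for x
  proof -
    define y where "y = f x"
    have "norm y \<le> 1" using that f(1) by (simp add: y_def S_def orthogonal_transformation_norm)
    then have "(norm y)\<^sup>2 \<le> 1" by (simp add: abs_square_le_1)
    then have y1: "(\<Sum>i\<in>UNIV. (y $ i)\<^sup>2) \<le> 1" by (simp only: norm_sq)
    have "y $ k = y \<bullet> f v" by (simp add: f(2) inner_axis)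
    also have "\<dots> = x \<bullet> v" using f(1) by (simp add: y_def orthogonal_transformation_def)
    finally have "\<bar>y $ k\<bar> \<le> a" using that by (simp add: S_def)
    then have "(y $ k)\<^sup>2 \<le> a\<^sup>2" by (metis abs_ge_zero power2_abs power_mono)
    then have "(m k * y $ k)\<^sup>2 \<le> 1 / d"
      using a d by (simp add: m_def power_mult_distrib power_divide divide_le_eq)
    moreover have "(\<Sum>i\<in>UNIV - {k}. (m i * y $ i)\<^sup>2) \<le> 1 - 1 / d"
    proof -
      have "(\<Sum>i\<in>UNIV - {k}. (m i * y $ i)\<^sup>2) = (1 - 1 / d) * (\<Sum>i\<in>UNIV - {k}. (y $ i)\<^sup>2)"
        using d by (simp add: m_def power_mult_distrib sum_distrib_left)
      also have "\<dots> \<le> (1 - 1 / d) * 1"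
        using d y1 sum_mono2[of UNIV "UNIV - {k}" "\<lambda>i. (y $ i)\<^sup>2"] by (intro mult_left_mono) auto
      finally show ?thesis by simp
    qed
    moreover have "(norm (h y))\<^sup>2 = (m k * y $ k)\<^sup>2 + (\<Sum>i\<in>UNIV - {k}. (m i * y $ i)\<^sup>2)"
      using sum.remove[of UNIV k "\<lambda>i. (m i * y $ i)\<^sup>2"]
      by (simp add: norm_sq h_def)
    ultimately have "(norm (h y))\<^sup>2 \<le> 1" by linarith
    then show ?thesis by (simp add: y_def abs_square_le_1)
  qed
  then have sub: "h ` f ` S \<subseteq> cball 0 1" by blast
  have hS: "h ` f ` S \<in> lmeasurable" "measure lebesgue (h ` f ` S) = \<bar>prod m UNIV\<bar> * measure lebesgue S"
    unfolding h_def
    using measurable_stretch[OF orthogonal_measure_invariant(1)[OF f(1) S]]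
      measure_stretch[OF orthogonal_measure_invariant(1)[OF f(1) S], of m]
      orthogonal_measure_invariant(2)[OF f(1) S] by simp_all
  have "prod m UNIV = m k * prod m (UNIV - {k})" by (simp add: prod.remove)
  also have "prod m (UNIV - {k}) = sqrt (1 - 1 / d) ^ (d - 1)"
    by (simp add: m_def d_def card_Diff_singleton)
  finally have prod: "prod m UNIV = sqrt ((1 - 1 / d) ^ (d - 1)) / (a * sqrt d)"
    by (simp add: m_def real_sqrt_power)
  \<comment> \<open>The volume factor of the map is thus at least 1/(2a sqrt d), although the image
    still fits into the ball.\<close>
  have "1/2 = sqrt (1/4)" by (simp add: real_sqrt_divide)
  also have "\<dots> \<le> sqrt ((1 - 1 / d) ^ (d - 1))" by (intro real_sqrt_le_mono one_minus_inverse_power_ge d)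
  finally have "1/2 / (a * sqrt d) \<le> prod m UNIV" unfolding prod using a by (intro divide_right_mono) auto
  then have "1/2 / (a * sqrt d) * measure lebesgue S \<le> \<bar>prod m UNIV\<bar> * measure lebesgue S"
    by (intro mult_right_mono) auto
  also have "\<dots> \<le> measure lebesgue (cball (0::real^'n) 1)"
    unfolding hS(2)[symmetric] using sub hS(1) by (intro measure_mono_fmeasurable) auto
  finally show "measure lebesgue S \<le> 2 * a * sqrt (real CARD('n)) * measure lebesgue (cball (0::real^'n) 1)"
    using a d by (simp add: d_def[symmetric] field_simps)
qed

lemma sgn_borel_measurable: "sgn \<in> borel_measurable (borel :: (real^'n) measure)"
  unfolding sgn_div_norm[abs_def] by measurable

lemma unit_ball_emeasure:
  "emeasure lborel (cball (0::real^'n) 1) \<noteq> 0" "emeasure lborel (cball (0::real^'n) 1) \<noteq> \<infinity>"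
proof -
  have "measure lborel (cball (0::real^'n) 1) \<noteq> 0" using unit_ball_measure_pos[where 'n='n] by simp
  then show "emeasure lborel (cball (0::real^'n) 1) \<noteq> 0" "emeasure lborel (cball (0::real^'n) 1) \<noteq> \<infinity>"
    unfolding measure_def by auto
qed

lemma prob_space_uniform_sphere: "prob_space (uniform_sphere :: (real^'n) measure)"
  unfolding uniform_sphere_def
  by (intro prob_space.prob_space_distr prob_space_uniform_measure unit_ball_emeasure)
     (use sgn_borel_measurable in simp)

text \<open>Radial projection only enlarges |x . v| for x in the ball, so projected points in the
  slab come from the solid slab. The event 1 < |u| is impossible because |sgn x| <= 1 everywhere,
  also at the origin; including it lets later bounds assume |u| <= 1.\<close>

lemma uniform_sphere_slab:
  fixes v :: "real^'n"
  assumes v: "norm v = 1" and a: "0 < a"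
  shows "measure uniform_sphere {u. 1 < norm u \<or> \<bar>u \<bullet> v\<bar> < a} \<le> 2 * a * sqrt (real CARD('n))"
proof -
  define B where "B = cball (0::real^'n) 1"
  define X where "X = {u::real^'n. 1 < norm u \<or> \<bar>u \<bullet> v\<bar> < a}"
  define S where "S = B \<inter> {x. \<bar>x \<bullet> v\<bar> < a}"
  have X: "X \<in> sets borel"
    unfolding X_def by (intro borel_open open_Collect_disj open_Collect_less continuous_intros)
  have Bp: "0 < measure lebesgue B" using unit_ball_measure_pos[where 'n='n] by (simp add: B_def)
  have S: "S \<in> lmeasurable" "measure lebesgue S \<le> 2 * a * sqrt (real CARD('n)) * measure lebesgue B"
    unfolding S_def B_def using slab_measure[OF v a] by blast+
  have sX: "sgn -` X \<in> sets borel" using measurable_sets[OF sgn_borel_measurable X] by simp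
  have Bb: "B \<in> sets borel" by (simp add: B_def)
  have "B \<inter> sgn -` X \<subseteq> S"
  proof
    fix x assume x: "x \<in> B \<inter> sgn -` X"
    have "norm (sgn x) \<le> 1" by (simp add: norm_sgn)
    then have "\<bar>sgn x \<bullet> v\<bar> < a" using x by (simp add: X_def)
    moreover have "\<bar>x \<bullet> v\<bar> \<le> \<bar>sgn x \<bullet> v\<bar>"
    proof -
      have "x = norm x *\<^sub>R sgn x" by (cases "x = 0") (simp_all add: sgn_div_norm)
      then have "\<bar>x \<bullet> v\<bar> = norm x * \<bar>sgn x \<bullet> v\<bar>" by (metis abs_mult abs_norm_cancel inner_scaleR_left)
      also have "\<dots> \<le> 1 * \<bar>sgn x \<bullet> v\<bar>" using x by (intro mult_right_mono) (auto simp: B_def)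
      finally show ?thesis by simp
    qed
    ultimately show "x \<in> S" using x by (simp add: S_def)
  qed
  note eB = unit_ball_emeasure[where 'n='n, folded B_def]
  have "measure uniform_sphere X = measure (uniform_measure lborel B) (sgn -` X)"
    using sgn_borel_measurable X by (simp add: uniform_sphere_def B_def measure_distr)
  also have "\<dots> = measure lborel (B \<inter> sgn -` X) / measure lborel B"
    using sX by (intro measure_uniform_measure[OF eB]) simp
  also have "\<dots> = measure lebesgue (B \<inter> sgn -` X) / measure lebesgue B"
    using sX Bb by simp
  also have "\<dots> \<le> measure lebesgue S / measure lebesgue B"
  proof (intro divide_right_mono measure_nonneg, rule measure_mono_fmeasurable[OF \<open>B \<inter> sgn -` X \<subseteq> S\<close> _ S(1)])
    have "B \<inter> sgn -` X \<in> sets lborel" using sX Bb by simp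
    then show "B \<inter> sgn -` X \<in> sets lebesgue" by (rule sets_completionI_sets)
  qed
  also have "\<dots> \<le> 2 * a * sqrt (real CARD('n))" using S(2) Bp by (simp add: divide_le_eq)
  finally show ?thesis by (simp add: X_def)
qed

section \<open>The two subroutines\<close>

text \<open>Orienting z against the gradient at x makes the linear change nonpositive. The step
  length a is the nonnegative root of the quadratic equation for the sphere and is at most 2R, so
  the curvature costs at most (2R)^2 \<eta>/2.\<close>

lemma (in sym_operator) extend_to_sphere:
  assumes x: "norm x \<le> R" and z: "norm z = 1" "z \<bullet> M z \<le> \<eta>" "0 \<le> \<eta>"
  obtains \<alpha> where "norm (x + \<alpha> *\<^sub>R z) = R" "qmodel M b (x + \<alpha> *\<^sub>R z) \<le> qmodel M b x + 2 * R\<^sup>2 * \<eta>"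
proof -
  define G where "G = M x + b"
  define \<sigma> :: real where "\<sigma> = (if G \<bullet> z \<le> 0 then 1 else - 1)"
  define c where "c = \<sigma> * (x \<bullet> z)"
  define a where "a = - c + sqrt (c\<^sup>2 + R\<^sup>2 - (norm x)\<^sup>2)"
  have \<sigma>: "\<sigma> * (G \<bullet> z) \<le> 0" "\<sigma> * \<sigma> = 1" "\<bar>\<sigma>\<bar> = 1" by (auto simp: \<sigma>_def)
  have R: "0 \<le> R" using x norm_ge_zero order_trans by blast
  have "(norm x)\<^sup>2 \<le> R\<^sup>2" using x by (intro power_mono) auto
  then have cs: "c\<^sup>2 \<le> c\<^sup>2 + R\<^sup>2 - (norm x)\<^sup>2" by simp
  then have "\<bar>c\<bar> \<le> sqrt (c\<^sup>2 + R\<^sup>2 - (norm x)\<^sup>2)"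
    by (metis real_sqrt_abs real_sqrt_le_mono)
  then have a: "0 \<le> a" by (simp add: a_def)
  have "0 \<le> c\<^sup>2 + R\<^sup>2 - (norm x)\<^sup>2" using cs zero_le_power2[of c] by linarith
  then have "(a + c)\<^sup>2 = c\<^sup>2 + R\<^sup>2 - (norm x)\<^sup>2" unfolding a_def by simp
  then have root: "a\<^sup>2 + 2 * a * c + (norm x)\<^sup>2 = R\<^sup>2" by (simp add: power2_sum)
  have zz: "z \<bullet> z = 1" using z by (simp add: norm_eq_1)
  have "(norm (x + (\<sigma> * a) *\<^sub>R z))\<^sup>2 = (norm x)\<^sup>2 + 2 * a * c + (\<sigma> * \<sigma>) * a\<^sup>2"
    unfolding power2_norm_eq_inner
    by (simp add: inner_add_left inner_add_right zz c_def inner_commute power2_eq_square algebra_simps)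
  then have "(norm (x + (\<sigma> * a) *\<^sub>R z))\<^sup>2 = R\<^sup>2" using root \<sigma>(2) by simp
  then have nR: "norm (x + (\<sigma> * a) *\<^sub>R z) = R" by (rule power2_eq_imp_eq[OF _ norm_ge_zero R])
  have "a = norm ((\<sigma> * a) *\<^sub>R z)" using a z \<sigma> by (simp add: abs_mult)
  also have "\<dots> \<le> norm (x + (\<sigma> * a) *\<^sub>R z) + norm x"
    using norm_triangle_ineq4[of "x + (\<sigma> * a) *\<^sub>R z" x] by simp
  also have "\<dots> \<le> 2 * R" using x nR by simp
  finally have "a\<^sup>2 \<le> (2 * R)\<^sup>2" using a by (intro power_mono)
  then have "a\<^sup>2 / 2 * (z \<bullet> M z) \<le> (2 * R)\<^sup>2 / 2 * \<eta>"
    using z(2,3) by (intro order_trans[OF mult_left_mono mult_right_mono]) auto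
  moreover have "qmodel M b (x + (\<sigma> * a) *\<^sub>R z) = qmodel M b x + a * (\<sigma> * (G \<bullet> z)) + a\<^sup>2 / 2 * (\<sigma> * \<sigma> * (z \<bullet> M z))"
    using qmodel_expand[of b "x + (\<sigma> * a) *\<^sub>R z" x]
    by (simp add: G_def op_simps power2_eq_square mult_ac)
  moreover have "a * (\<sigma> * (G \<bullet> z)) \<le> 0" by (rule mult_nonneg_nonpos[OF a \<sigma>(1)])
  ultimately have "qmodel M b (x + (\<sigma> * a) *\<^sub>R z) \<le> qmodel M b x + 2 * R\<^sup>2 * \<eta>"
    using \<sigma> by simp
  then show ?thesis by (rule that[OF nR])
qed

lemma T_inner_ge:
  "24 * \<beta> / (\<rho> * r) * (4 + 1/2 * (ln (4 * real d / \<delta>'\<^sup>2))\<^sup>2) \<le> (real (T_inner d \<rho> \<beta> r \<delta>'))\<^sup>2"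
proof -
  define y where "y = 24 * \<beta> / (\<rho> * r) * (4 + 1/2 * (ln (4 * real d / \<delta>'\<^sup>2))\<^sup>2)"
  have "sqrt y \<le> real (T_inner d \<rho> \<beta> r \<delta>')"
    unfolding T_inner_def y_def by (rule real_nat_ceiling_ge)
  then have "y \<le> (real (T_inner d \<rho> \<beta> r \<delta>'))\<^sup>2"
    by (rule sqrt_le_D)
  then show ?thesis by (simp add: y_def)
qed

text \<open>The first summand is the error of accelerated gradient descent, the second the cost of
  reaching the sphere, both with curvature range 2\<beta>. From \<beta> >= 3\<rho>r and a logarithm
  of at least 2 follows T >= 20, which controls the lower-order terms.\<close>

lemma Solve_CR_error:
  fixes \<beta> \<rho> r R :: real
  assumes pos: "0 < \<rho>" "0 < r" "3 * \<rho> * r \<le> \<beta>" and d: "1 \<le> d" and \<delta>': "0 < \<delta>'" "\<delta>' \<le> 1/2"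
    and T: "T = T_inner d \<rho> \<beta> r \<delta>'" and a: "\<delta>' / (2 * sqrt d) \<le> a" "a \<le> 1"
  shows "2 \<le> T"
    "2 * (2 * \<beta>) * R\<^sup>2 / (real T + 1)\<^sup>2 + 2 * R\<^sup>2 * (2 * \<beta> * (ln (2 / a) / (2 * real T - 1))\<^sup>2)
      \<le> \<rho> * r * R\<^sup>2 / 16"
proof -
  define l where "l = ln (4 * real d / \<delta>'\<^sup>2)"
  define t where "t = real T"
  have "0 < \<delta>' / (2 * sqrt d)" using \<delta>' d by simp
  then have a0: "0 < a" using a(1) by linarith
  have "0 < 3 * \<rho> * r" using pos by simp
  then have b: "0 < \<beta>" using pos(3) by linarith
  have "\<delta>'\<^sup>2 \<le> (1/2)\<^sup>2" using \<delta>' by (intro power_mono) auto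
  then have "16 * \<delta>'\<^sup>2 \<le> 4 * real d" using d by (simp add: power_divide)
  then have 16: "16 \<le> 4 * real d / \<delta>'\<^sup>2" using \<delta>' by (simp add: le_divide_eq)
  have "ln (16::real) = 2 * ln 4" using ln_realpow[of 4 2] by simp
  moreover have l16: "ln 16 \<le> l" unfolding l_def using 16 \<delta>' d by (subst ln_le_cancel_iff) auto
  moreover have "1 \<le> ln (4::real)" using exp_le by (subst ln_ge_iff) auto
  ultimately have l: "2 * ln 4 \<le> l" "2 \<le> l" by auto
  have "l\<^sup>2 \<ge> 2\<^sup>2" using l by (intro power_mono) auto
  then have l2: "4 \<le> l\<^sup>2" by simp
  have P: "24 * \<beta> / (\<rho> * r) * (4 + 1/2 * l\<^sup>2) \<le> t\<^sup>2"
    unfolding l_def t_def T by (rule T_inner_ge)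
  have ratio: "3 \<le> \<beta> / (\<rho> * r)" using pos by (simp add: le_divide_eq mult.assoc)
  have "72 * 6 \<le> (24 * (\<beta> / (\<rho> * r))) * (4 + 1/2 * l\<^sup>2)"
    using ratio l2 by (intro mult_mono) auto
  then have "20\<^sup>2 \<le> t\<^sup>2" using P by simp
  then have t: "20 \<le> t" by (rule power2_le_imp_le) (simp add: t_def)
  then show "2 \<le> T" by (simp add: t_def)
  have "(\<delta>' / (2 * sqrt d))\<^sup>2 \<le> a\<^sup>2" using a \<delta>' by (intro power_mono) auto
  then have "\<delta>'\<^sup>2 / (4 * real d) \<le> a\<^sup>2" using d by (simp add: power_divide power_mult_distrib)
  then have "4 / a\<^sup>2 \<le> 4 / (\<delta>'\<^sup>2 / (4 * real d))"
    using \<delta>' d a0 by (intro divide_left_mono) (auto intro!: mult_pos_pos divide_pos_pos)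
  then have "4 / a\<^sup>2 \<le> 4 * (4 * real d / \<delta>'\<^sup>2)" by simp
  then have "ln (4 / a\<^sup>2) \<le> ln (4 * (4 * real d / \<delta>'\<^sup>2))"
    using a0 16 \<delta>' d by (subst ln_le_cancel_iff) auto
  also have "\<dots> = ln 4 + l" unfolding l_def using \<delta>' d by (subst ln_mult) auto
  also have "ln (4 / a\<^sup>2) = 2 * ln (2 / a)"
    using ln_realpow[of "2 / a" 2] a0 by (simp add: power_divide)
  finally have la: "ln (2 / a) \<le> 3/4 * l" using l by simp
  have la0: "0 \<le> ln (2 / a)" using a0 a(2) by (intro ln_ge_zero) (simp add: le_divide_eq)
  \<comment> \<open>3/4 stems from 2 ln(2/a) <= ln 4 + l with ln 4 <= l/2, and 39/20 from t >=
    20.\<close>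
  have "ln (2 / a) / (2 * t - 1) \<le> (3/4 * l) / (39/20 * t)"
    using la la0 t l by (intro frac_le) auto
  also have "\<dots> = 5/13 * (l / t)" by simp
  finally have "(ln (2 / a) / (2 * t - 1))\<^sup>2 \<le> (5/13 * (l / t))\<^sup>2"
    using la0 t by (intro power_mono divide_nonneg_nonneg) auto
  also have "\<dots> = 25/169 * l\<^sup>2 / t\<^sup>2" by (simp add: power_mult_distrib power_divide)
  finally have e2: "(ln (2 / a) / (2 * t - 1))\<^sup>2 \<le> 25/169 * l\<^sup>2 / t\<^sup>2" .
  have "1 / (t + 1)\<^sup>2 \<le> 1 / t\<^sup>2"
    using t by (intro divide_left_mono power_mono) (auto intro!: mult_pos_pos)
  then have "4 * \<beta> * R\<^sup>2 * (1 / (t + 1)\<^sup>2 + (ln (2 / a) / (2 * t - 1))\<^sup>2)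
      \<le> 4 * \<beta> * R\<^sup>2 * (1 / t\<^sup>2 + 25/169 * l\<^sup>2 / t\<^sup>2)"
    using e2 b by (intro mult_left_mono add_mono) auto
  \<comment> \<open>3/8 is fixed by the target: 4 * (3/8) / 24 = 1/16, where 24 is the constant in
    \<open>T_inner\<close>.\<close>
  also have "\<dots> \<le> 4 * \<beta> * R\<^sup>2 * (3/8 * (4 + 1/2 * l\<^sup>2) / t\<^sup>2)"
  proof (intro mult_left_mono)
    have "1 + 25/169 * l\<^sup>2 \<le> 3/8 * (4 + 1/2 * l\<^sup>2)" using l2 by simp
    then show "1 / t\<^sup>2 + 25/169 * l\<^sup>2 / t\<^sup>2 \<le> 3/8 * (4 + 1/2 * l\<^sup>2) / t\<^sup>2"
      unfolding add_divide_distrib[symmetric] by (rule divide_right_mono) simp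
  qed (use b in simp)
  also have "\<dots> = (3/2 * \<beta> * (4 + 1/2 * l\<^sup>2) / t\<^sup>2) * R\<^sup>2" by simp
  also have "\<dots> \<le> (\<rho> * r / 16) * R\<^sup>2"
  proof (intro mult_right_mono)
    have "24 * \<beta> * (4 + 1/2 * l\<^sup>2) \<le> t\<^sup>2 * (\<rho> * r)"
      using P pos by (simp add: pos_divide_le_eq)
    then show "3/2 * \<beta> * (4 + 1/2 * l\<^sup>2) / t\<^sup>2 \<le> \<rho> * r / 16"
      using t by (simp add: pos_divide_le_eq mult.commute)
  qed simp
  finally show "2 * (2 * \<beta>) * R\<^sup>2 / (real T + 1)\<^sup>2 + 2 * R\<^sup>2 * (2 * \<beta> * (ln (2 / a) / (2 * real T - 1))\<^sup>2)
      \<le> \<rho> * r * R\<^sup>2 / 16"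
    by (simp add: t_def[symmetric] distrib_left mult_ac)
qed

lemma Solve_CR_decrease:
  fixes A :: "real^'n^'n"
  assumes sa: "self_adjoint A"
    and upper: "\<And>x. x \<bullet> (A *v x) \<le> \<beta> * (x \<bullet> x)" and lower: "\<And>x. - \<beta> * (x \<bullet> x) \<le> x \<bullet> (A *v x)"
    and pos: "0 < \<rho>" "0 < r" "3 * \<rho> * r \<le> \<beta>" and \<delta>': "0 < \<delta>'" "\<delta>' \<le> 1/2"
    and s: "cubic_minimizer \<rho> A b s" "r \<le> norm s"
  obtains w where "norm w = 1"
    "\<And>u. norm u \<le> 1 \<Longrightarrow> \<delta>' / (2 * sqrt (real CARD('n))) \<le> \<bar>u \<bullet> w\<bar> \<Longrightarrow>
      \<exists>x\<in>krylov A {b, u} (T_inner CARD('n) \<rho> \<beta> r \<delta>'). cmodel \<rho> A b x < - \<rho> * r ^ 3 / 12"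
proof -
  obtain B where "eigenbasis A B" using spectral_theorem[OF sa] .
  then interpret eigenbasis A B .
  obtain w where w: "w \<in> B" "\<And>v. v \<in> B \<Longrightarrow> eig w \<le> eig v"
  proof -
    have "Min ((\<lambda>v. eig v) ` B) \<in> (\<lambda>v. eig v) ` B" using finite_B B_nonempty by (intro Min_in) auto
    then obtain w where w: "w \<in> B" "Min ((\<lambda>v. eig v) ` B) = eig w" by blast
    have "eig w \<le> eig v" if "v \<in> B" for v
      unfolding w(2)[symmetric] using finite_B that by (intro Min_le) auto
    with w(1) show ?thesis by (rule that)
  qed
  have nw: "norm w = 1" "w \<bullet> w = 1" using norm_1[OF w(1)] by (auto simp: norm_eq_1)
  have ev_upper: "eig v \<le> \<beta>" if "v \<in> B" for v
    using upper[of v] norm_1[OF that] by (simp add: norm_eq_1)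
  have ew: "- \<beta> \<le> eig w" using lower[of w] nw by simp
  have "0 < 3 * \<rho> * r" using pos by simp
  then have b: "0 < \<beta>" using pos(3) by linarith
  define R where "R = norm s"
  define \<gamma> where "\<gamma> = max 0 (- eig w)"
  have \<gamma>: "0 \<le> \<gamma>" "- eig w \<le> \<gamma>" "\<gamma> \<le> \<beta>" using ew b by (auto simp: \<gamma>_def)
  have "- eig w \<le> \<rho> * R" using cubic_minimizer_psd[OF sa pos(1) s(1), of w] nw by (simp add: R_def)
  then have \<gamma>R: "\<gamma> \<le> \<rho> * R" using pos by (simp add: \<gamma>_def R_def)
  define M where "M = (\<lambda>x. A *v x + \<gamma> *\<^sub>R x)"
  interpret M: sym_operator M
    using sa
    by unfold_locales (auto simp: M_def linear_iff matrix_vector_right_distrib matrix_vector_mult_scaleR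
      self_adjoint_def inner_add_left inner_add_right algebra_simps)
  have xMx: "x \<bullet> M x = x \<bullet> (A *v x) + \<gamma> * (x \<bullet> x)" for x by (simp add: M_def inner_add_right)
  have psd: "0 \<le> x \<bullet> M x" for x
  proof -
    have "x \<bullet> M x = (\<Sum>v\<in>B. (eig v + \<gamma>) * (x \<bullet> v)\<^sup>2)"
      unfolding xMx quad_eq_sum[of x] inner_eq_sum[of x x] sum_distrib_left sum.distrib[symmetric]
      by (intro sum.cong) (simp_all add: power2_eq_square distrib_right mult.assoc)
    also have "\<dots> \<ge> 0"
    proof (intro sum_nonneg mult_nonneg_nonneg)
      show "0 \<le> eig v + \<gamma>" if "v \<in> B" for v using w(2)[OF that] \<gamma>(2) by linarith
    qed simp
    finally show ?thesis .
  qed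
  have M_upper: "x \<bullet> M x \<le> (2 * \<beta>) * (x \<bullet> x)" for x
  proof -
    have "\<gamma> * (x \<bullet> x) \<le> \<beta> * (x \<bullet> x)" using \<gamma> by (intro mult_right_mono) auto
    then show ?thesis using upper[of x] by (simp add: xMx)
  qed
  have q_eq: "qmodel M b x = 1/2 * (x \<bullet> (A *v x)) + b \<bullet> x + \<gamma> / 2 * (norm x)\<^sup>2" for x
    by (simp add: qmodel_def xMx power2_norm_eq_inner)
  have f_eq: "cmodel \<rho> A b x = qmodel M b x - \<gamma> / 2 * (norm x)\<^sup>2 + \<rho> / 3 * norm x ^ 3" for x
    by (simp add: q_eq cmodel_def)
  \<comment> \<open>The gradient of the shifted quadratic at \<open>s\<close> is -(\<rho>R -
    \<gamma>)s with a nonnegative factor; this is the optimality condition of a convex function on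
    the ball.\<close>
  have smin: "qmodel M b s \<le> qmodel M b x" if "norm x \<le> R" for x
  proof -
    have "A *v s + b = - ((\<rho> * R) *\<^sub>R s)"
      using cubic_minimizer_stationary[OF sa pos(1) s(1)] by (simp add: R_def eq_neg_iff_add_eq_0)
    moreover have "M s + b = (A *v s + b) + \<gamma> *\<^sub>R s" by (simp add: M_def)
    ultimately have "M s + b = (\<gamma> - \<rho> * R) *\<^sub>R s" by (simp add: scaleR_diff_left)
    then have "(M s + b) \<bullet> (x - s) = (\<gamma> - \<rho> * R) * (s \<bullet> (x - s))" by simp
    then have "(M s + b) \<bullet> (x - s) = (\<rho> * R - \<gamma>) * (s \<bullet> s - s \<bullet> x)"
      by (simp only: inner_diff_right) (simp add: algebra_simps)
    moreover have "s \<bullet> x \<le> norm s * norm x" by (rule norm_cauchy_schwarz)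
    then have "s \<bullet> x \<le> s \<bullet> s"
      using that mult_left_mono[OF that, of "norm s"]
      by (simp add: R_def power2_norm_eq_inner[symmetric] power2_eq_square)
    then have "0 \<le> (\<rho> * R - \<gamma>) * (s \<bullet> s - s \<bullet> x)" using \<gamma>R by (intro mult_nonneg_nonneg) auto
    ultimately show ?thesis using M.qmodel_expand[of b x s] psd[of "x - s"] by simp
  qed
  define T where "T = T_inner CARD('n) \<rho> \<beta> r \<delta>'"
  have "\<exists>x\<in>krylov A {b, u} T. cmodel \<rho> A b x < - \<rho> * r ^ 3 / 12"
    if u: "norm u \<le> 1" "\<delta>' / (2 * sqrt (real CARD('n))) \<le> \<bar>u \<bullet> w\<bar>" for u
  proof -
    let ?K = "krylov A {b, u}"
    define a where "a = \<bar>u \<bullet> w\<bar>"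
    have "a \<le> norm u * norm w" unfolding a_def by (rule Cauchy_Schwarz_ineq2)
    then have a1: "a \<le> 1" using u nw by simp
    have card: "1 \<le> CARD('n)" by (simp add: Suc_le_eq)
    note err = Solve_CR_error[OF pos card \<delta>' T_def u(2)[folded a_def] a1]
    \<comment> \<open>T powers of A allow k + 1 gradient steps and polynomials of degree k, whence T
      + 1 = k + 2 and 2T - 1 = 2k + 1 in the error bounds.\<close>
    obtain k where k: "T = Suc k" using err(1) by (cases T) auto
    have up: "x \<in> ?K (Suc t)" if "x \<in> ?K t" for x t
      using krylov_mono[of "{b, u}" "{b, u}" t "Suc t" A] that by auto
    have "\<exists>x\<in>?K (Suc k). norm x \<le> R \<and>
      qmodel M b x - qmodel M b s \<le> 2 * (2 * \<beta>) * (norm s)\<^sup>2 / (real k + 2)\<^sup>2"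
    proof (rule M.accelerated_gradient_ball[OF psd M_upper])
      fix t x assume "x \<in> ?K t"
      then show "M x \<in> ?K (Suc t)"
        unfolding M_def using krylov_mult up
        by (intro subspace_add[OF subspace_krylov] subspace_scale[OF subspace_krylov]) blast+
    qed (use b smin up krylov_generator[of b "{b, u}"] in \<open>auto simp: R_def subspace_krylov\<close>)
    then obtain x where x: "x \<in> ?K T" "norm x \<le> R"
      and "qmodel M b x - qmodel M b s \<le> 2 * (2 * \<beta>) * (norm s)\<^sup>2 / (real k + 2)\<^sup>2"
      unfolding k by blast
    moreover have "real k + 2 = real T + 1" by (simp add: k)
    ultimately have qx: "qmodel M b x - qmodel M b s \<le> 2 * (2 * \<beta>) * R\<^sup>2 / (real T + 1)\<^sup>2"
      by (simp only: R_def)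
    define \<eta> where "\<eta> = 2 * \<beta> * (ln (2 / a) / (2 * real T - 1))\<^sup>2"
    have \<eta>: "0 \<le> \<eta>" using b by (simp add: \<eta>_def)
    have \<eta>_err: "2 * (2 * \<beta>) * R\<^sup>2 / (real T + 1)\<^sup>2 + 2 * R\<^sup>2 * \<eta> \<le> \<rho> * r * R\<^sup>2 / 16"
      unfolding \<eta>_def by (rule err(2))
    \<comment> \<open>For \<gamma> = 0 the cubic term is smaller inside the ball, so x itself
      serves. Otherwise x is moved to the sphere, where the model and the shifted quadratic differ
      by the same constant as at \<open>s\<close>.\<close>
    obtain x' where x': "x' \<in> ?K T" and fx': "cmodel \<rho> A b x' \<le> cmodel \<rho> A b s + \<rho> * r * R\<^sup>2 / 16"
    proof (cases "\<gamma> = 0")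
      case True
      have "norm x ^ 3 \<le> R ^ 3" using x(2) by (intro power_mono) auto
      then have "\<rho> / 3 * norm x ^ 3 \<le> \<rho> / 3 * norm s ^ 3" using pos unfolding R_def by (intro mult_left_mono) auto
      moreover have "cmodel \<rho> A b x = qmodel M b x + \<rho> / 3 * norm x ^ 3"
        "cmodel \<rho> A b s = qmodel M b s + \<rho> / 3 * norm s ^ 3" by (simp_all add: f_eq True)
      moreover have "0 \<le> 2 * R\<^sup>2 * \<eta>" using \<eta> by simp
      ultimately have "cmodel \<rho> A b x \<le> cmodel \<rho> A b s + \<rho> * r * R\<^sup>2 / 16"
        using qx \<eta>_err by linarith
      then show ?thesis using that x by blast
    next
      case False
      then have \<gamma>w: "\<gamma> = - eig w" by (simp add: \<gamma>_def max_def split: if_splits)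
      have "u \<bullet> w \<noteq> 0"
      proof -
        have "0 < \<delta>' / (2 * sqrt (real CARD('n)))" using \<delta>' card by simp
        then show ?thesis using u(2) by auto
      qed
      moreover have "eig v \<le> eig w + 2 * \<beta>" if "v \<in> B" for v using ev_upper[OF that] ew by simp
      ultimately obtain z where z: "z \<in> krylov A {u} (Suc k)" "norm z = 1"
        "z \<bullet> (A *v z) \<le> eig w + 2 * \<beta> * (ln (2 / \<bar>u \<bullet> w\<bar>) / (2 * real k + 1))\<^sup>2"
        using krylov_contains_approximate_eigenvector[OF w, of "2 * \<beta>" u k] u(1) b by auto
      have zK: "z \<in> ?K T" using z(1) krylov_mono[of "{u}" "{b, u}" "Suc k" T A] by (auto simp: k)
      have "z \<bullet> z = 1" using z(2) by (simp add: norm_eq_1)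
      moreover have eq: "2 * real k + 1 = 2 * real T - 1" by (simp add: k)
      ultimately have "z \<bullet> M z \<le> \<eta>" using z(3) unfolding xMx \<gamma>w \<eta>_def a_def eq by simp
      then obtain \<alpha> where \<alpha>: "norm (x + \<alpha> *\<^sub>R z) = R"
        "qmodel M b (x + \<alpha> *\<^sub>R z) \<le> qmodel M b x + 2 * R\<^sup>2 * \<eta>"
        using M.extend_to_sphere[OF x(2) z(2) _ \<eta>] by blast
      have "cmodel \<rho> A b (x + \<alpha> *\<^sub>R z) = qmodel M b (x + \<alpha> *\<^sub>R z) - \<gamma> / 2 * R\<^sup>2 + \<rho> / 3 * R ^ 3"
        unfolding f_eq \<alpha>(1) ..
      moreover have "cmodel \<rho> A b s = qmodel M b s - \<gamma> / 2 * R\<^sup>2 + \<rho> / 3 * R ^ 3"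
        unfolding f_eq R_def ..
      ultimately have "cmodel \<rho> A b (x + \<alpha> *\<^sub>R z) \<le> cmodel \<rho> A b s + \<rho> * r * R\<^sup>2 / 16"
        using \<alpha>(2) qx \<eta>_err by linarith
      moreover have "x + \<alpha> *\<^sub>R z \<in> ?K T"
        using x zK by (intro subspace_add[OF subspace_krylov] subspace_scale[OF subspace_krylov])
      ultimately show ?thesis using that by blast
    qed
    have R: "r \<le> R" "0 < R" using s(2) pos by (auto simp: R_def)
    have "\<rho> * r * R\<^sup>2 \<le> \<rho> * R * R\<^sup>2" using R pos by (intro mult_right_mono mult_left_mono) auto
    also have "\<dots> = \<rho> * R ^ 3" by (simp add: power2_eq_square power3_eq_cube)
    finally have 1: "\<rho> * r * R\<^sup>2 \<le> \<rho> * R ^ 3" .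
    have "r ^ 3 \<le> R ^ 3" using R pos by (intro power_mono) auto
    then have 2: "\<rho> * r ^ 3 \<le> \<rho> * R ^ 3" using pos by (intro mult_left_mono) auto
    have 3: "0 < \<rho> * R ^ 3" using R pos by simp
    have "cmodel \<rho> A b s \<le> - \<rho> / 6 * R ^ 3" unfolding R_def by (rule cubic_minimizer_value[OF sa pos(1) s(1)])
    then have "cmodel \<rho> A b x' < - \<rho> * r ^ 3 / 12" using fx' 1 2 3 by simp
    then show ?thesis using x' by blast
  qed
  then show ?thesis using that[OF nw(1)] by (simp add: T_def)
qed

section \<open>The regularized quadratic\<close>

context eigenbasis
begin

text \<open>The solution is (A + c')^(-1) (A + c) s, which shrinks every eigencoordinate. At a cubic
  minimizer with c = \<rho>|s| the right-hand side is -b.\<close>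

lemma regularized_solution_norm:
  assumes c: "\<And>v. v \<in> B \<Longrightarrow> 0 \<le> eig v + c" "c < c'"
  obtains x where "A *v x + c' *\<^sub>R x = A *v s + c *\<^sub>R s" "norm x \<le> norm s"
proof -
  define k where "k v = (eig v + c) / (eig v + c')" for v
  have k: "0 \<le> k v" "k v \<le> 1" "(eig v + c') * k v = eig v + c" if "v \<in> B" for v
    using c(1)[OF that] c(2) by (auto simp: k_def)
  define x where "x = (\<Sum>v\<in>B. (k v * (s \<bullet> v)) *\<^sub>R v)"
  have xv: "x \<bullet> w = k w * (s \<bullet> w)" if w: "w \<in> B" for w
  proof -
    have "x \<bullet> w = (\<Sum>v\<in>B. k v * (s \<bullet> v) * (v \<bullet> w))" by (simp add: x_def inner_sum_left)
    also have "\<dots> = (\<Sum>v\<in>B. if v = w then k w * (s \<bullet> w) else 0)"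
    proof (rule sum.cong[OF refl])
      fix v assume "v \<in> B"
      then show "k v * (s \<bullet> v) * (v \<bullet> w) = (if v = w then k w * (s \<bullet> w) else 0)"
        using orth w norm_1[OF w] by (auto simp: pairwise_def orthogonal_def norm_eq_1)
    qed
    also have "\<dots> = k w * (s \<bullet> w)" using finite_B w by simp
    finally show ?thesis .
  qed
  have "A *v x + c' *\<^sub>R x = A *v s + c *\<^sub>R s"
  proof (rule eqI)
    fix v assume v: "v \<in> B"
    have "(A *v x + c' *\<^sub>R x) \<bullet> v = ((eig v + c') * k v) * (s \<bullet> v)"
      using mult_inner[OF v, of x] xv[OF v] by (simp add: inner_add_left algebra_simps)
    also have "\<dots> = (A *v s + c *\<^sub>R s) \<bullet> v"
      using mult_inner[OF v, of s] k(3)[OF v] by (simp add: inner_add_left algebra_simps)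
    finally show "(A *v x + c' *\<^sub>R x) \<bullet> v = (A *v s + c *\<^sub>R s) \<bullet> v" .
  qed
  moreover have "x \<bullet> x \<le> s \<bullet> s"
    unfolding inner_eq_sum[of x x] inner_eq_sum[of s s]
  proof (rule sum_mono)
    fix v assume v: "v \<in> B"
    have "(k v)\<^sup>2 \<le> 1\<^sup>2" using k[OF v] by (intro power_mono) auto
    then have "(k v)\<^sup>2 * (s \<bullet> v)\<^sup>2 \<le> 1 * (s \<bullet> v)\<^sup>2" by (intro mult_right_mono) auto
    then show "x \<bullet> v * (x \<bullet> v) \<le> s \<bullet> v * (s \<bullet> v)"
      by (simp add: xv[OF v] power2_eq_square mult_ac)
  qed
  ultimately show ?thesis using that by (simp add: norm_le)
qed

end

text \<open>The spectrum of A + 2\<rho>r I lies between \<rho>r and L = \<beta> + 2\<rho>r. The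
  tolerance 6\<rho>r^2, which is 2\<epsilon>/3 in terms of r, makes the argument of the logarithm in
  \<open>T_final\<close> the square of L/(\<rho>r), so that \<open>T_final\<close> is the Chebyshev
  iteration count for this condition number.\<close>

lemma Solve_Quadratic_accurate:
  fixes A :: "real^'n^'n"
  assumes sa: "self_adjoint A" and upper: "\<And>x. x \<bullet> (A *v x) \<le> \<beta> * (x \<bullet> x)"
    and pos: "0 < \<beta>" "0 < \<rho>" "0 < r" and s: "cubic_minimizer \<rho> A b s" "norm s \<le> r"
  shows "solve_quadratic A b \<rho> \<beta> r (6 * \<rho> * r\<^sup>2) \<noteq> {}"
    and "\<Delta> \<in> solve_quadratic A b \<rho> \<beta> r (6 * \<rho> * r\<^sup>2) \<Longrightarrow>
      norm \<Delta> \<le> norm s \<and> norm (A *v \<Delta> + (2 * \<rho> * r) *\<^sub>R \<Delta> + b) \<le> 2 * (\<rho> * r) * r"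
proof -
  obtain B where "eigenbasis A B" using spectral_theorem[OF sa] .
  then interpret eigenbasis A B .
  define c L T where "c = 2 * \<rho> * r" and "L = \<beta> + 2 * \<rho> * r" and "T = T_final \<rho> \<beta> r (6 * \<rho> * r\<^sup>2)"
  note psd = cubic_minimizer_psd[OF sa pos(2) s(1)]
  have rs: "\<rho> * norm s \<le> \<rho> * r" using s(2) pos by simp
  have rr: "0 < \<rho> * r" using pos by simp
  have evs: "0 \<le> eig v + \<rho> * norm s" "\<rho> * r \<le> eig v + c" "eig v + c \<le> L" if "v \<in> B" for v
    using psd[of v] upper[of v] norm_1[OF that] rs by (auto simp: norm_eq_1 c_def L_def)
  have "\<rho> * norm s < c" using rs rr by (simp add: c_def)
  from regularized_solution_norm[OF evs(1) this]
  obtain x0 where x0: "A *v x0 + c *\<^sub>R x0 = A *v s + (\<rho> * norm s) *\<^sub>R s" "norm x0 \<le> norm s" by blast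
  have "A *v s + (\<rho> * norm s) *\<^sub>R s = - b"
    using cubic_minimizer_stationary[OF sa pos(2) s(1)] by (metis add.commute add.left_commute eq_neg_iff_add_eq_0)
  then have x0b: "A *v x0 + c *\<^sub>R x0 = - b" using x0(1) by simp
  have spd: "0 < x \<bullet> (A *v x + c *\<^sub>R x)" if "x \<noteq> 0" for x
  proof -
    have "0 < (c - \<rho> * norm s) * (x \<bullet> x)" using that \<open>\<rho> * norm s < c\<close> by (intro mult_pos_pos) auto
    then show ?thesis using psd[of x] by (simp add: inner_add_right algebra_simps)
  qed
  define q where "q = qmodel (\<lambda>x. A *v x + c *\<^sub>R x) b"
  obtain z where z: "z \<in> krylov A {b} T" "norm z \<le> norm x0"
    "\<And>x. x \<in> krylov A {b} T \<Longrightarrow> x \<noteq> z \<Longrightarrow> q z < q x"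
    unfolding q_def using krylov_regularized_minimizer[OF sa spd x0b, where t = T] by blast
  have q: "1/2 * (x \<bullet> (A *v x)) + b \<bullet> x + \<rho> * r * (norm x)\<^sup>2 = q x" for x
    by (simp add: q_def qmodel_def c_def inner_add_right power2_norm_eq_inner algebra_simps)
  have sol: "solve_quadratic A b \<rho> \<beta> r (6 * \<rho> * r\<^sup>2) = {z}"
    unfolding solve_quadratic_def q T_def[symmetric] is_arg_min_def
    using z by (auto intro: less_asym)
  then show "solve_quadratic A b \<rho> \<beta> r (6 * \<rho> * r\<^sup>2) \<noteq> {}" by simp
  have "(6 * \<rho> * r\<^sup>2)\<^sup>2 = 36 * r\<^sup>2 * (\<rho> * r)\<^sup>2" by (simp add: power2_eq_square)
  then have eq: "36 * L\<^sup>2 * r\<^sup>2 / (6 * \<rho> * r\<^sup>2)\<^sup>2 = (L / (\<rho> * r))\<^sup>2"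
    using pos by (simp add: power_divide)
  have "1/4 * sqrt (L / (\<rho> * r)) * ln ((L / (\<rho> * r))\<^sup>2) \<le> real T"
    unfolding T_def T_final_def L_def[symmetric] eq by (rule real_nat_ceiling_ge)
  moreover have Lr: "\<rho> * r < L" unfolding L_def using rr pos by linarith
  then have "ln ((L / (\<rho> * r))\<^sup>2) = 2 * ln (L / (\<rho> * r))" using rr by (subst ln_realpow) (auto intro!: divide_pos_pos)
  ultimately have T: "1/2 * sqrt (L / (\<rho> * r)) * ln (L / (\<rho> * r)) \<le> real T" by simp
  have qz: "q z \<le> q x" if "x \<in> krylov A {b} T" for x using z(3)[OF that] by (cases "x = z") auto
  have "norm (A *v z + c *\<^sub>R z + b) \<le> 2 * (\<rho> * r) * norm x0"
    by (rule regularized_krylov_residual[OF x0b _ _ rr Lr T qz[unfolded q_def]]) (auto intro: evs)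
  also have "\<dots> \<le> 2 * (\<rho> * r) * r" using x0(2) s(2) rr by (intro mult_left_mono) auto
  finally show "norm \<Delta> \<le> norm s \<and> norm (A *v \<Delta> + (2 * \<rho> * r) *\<^sub>R \<Delta> + b) \<le> 2 * (\<rho> * r) * r"
    if "\<Delta> \<in> solve_quadratic A b \<rho> \<beta> r (6 * \<rho> * r\<^sup>2)"
    using that z(2) x0(2) by (simp add: sol c_def)
qed

text \<open>The gradient collects \<rho>r^2 from Taylor's formula, 2\<rho>r^2 from the residual and
  2\<rho>r^2 from the regularizer. The Hessian is at least -\<rho>r at y and moves by at most
  2\<rho>r.\<close>

lemma (in smooth_objective) Solve_Quadratic_second_order_point:
  assumes pos: "0 < \<beta>" "0 < r" and s: "cubic_minimizer \<rho> (H y) (dg y) s" "norm s \<le> r"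
    and \<Delta>: "\<Delta> \<in> solve_quadratic (H y) (dg y) \<rho> \<beta> r (6 * \<rho> * r\<^sup>2)"
  shows "norm (dg (y + \<Delta>)) \<le> 9 * \<rho> * r\<^sup>2"
    and "loewner_ge (H (y + \<Delta>)) (- (3 * \<rho> * r) *\<^sub>R mat 1)"
proof -
  note sa = hessian_self_adjoint[of y]
  note acc = Solve_Quadratic_accurate[OF sa hessian_upper pos(1) rho pos(2) s]
  have n: "norm \<Delta> \<le> norm s" "norm (H y *v \<Delta> + (2 * \<rho> * r) *\<^sub>R \<Delta> + dg y) \<le> 2 * (\<rho> * r) * r"
    using acc(2)[OF \<Delta>] by auto
  then have nr: "norm \<Delta> \<le> r" using s by simp
  have rr: "0 < \<rho> * r" using rho pos by simp
  have "dg (y + \<Delta>) = (dg (y + \<Delta>) - dg y - H y *v \<Delta>)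
      + ((H y *v \<Delta> + (2 * \<rho> * r) *\<^sub>R \<Delta> + dg y) - (2 * \<rho> * r) *\<^sub>R \<Delta>)"
    by simp
  then have "norm (dg (y + \<Delta>)) \<le> norm (dg (y + \<Delta>) - dg y - H y *v \<Delta>)
      + norm ((H y *v \<Delta> + (2 * \<rho> * r) *\<^sub>R \<Delta> + dg y) - (2 * \<rho> * r) *\<^sub>R \<Delta>)"
    by (metis norm_triangle_ineq)
  also have "norm ((H y *v \<Delta> + (2 * \<rho> * r) *\<^sub>R \<Delta> + dg y) - (2 * \<rho> * r) *\<^sub>R \<Delta>)
      \<le> norm (H y *v \<Delta> + (2 * \<rho> * r) *\<^sub>R \<Delta> + dg y) + norm ((2 * \<rho> * r) *\<^sub>R \<Delta>)"
    by (rule norm_triangle_ineq4)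
  also have "norm ((2 * \<rho> * r) *\<^sub>R \<Delta>) \<le> 2 * \<rho> * r * r" using nr rr rho pos by (simp add: abs_mult)
  also have "norm (dg (y + \<Delta>) - dg y - H y *v \<Delta>) \<le> \<rho> * r\<^sup>2"
  proof -
    have "\<rho> * (norm \<Delta>)\<^sup>2 \<le> \<rho> * r\<^sup>2" using nr rho by (intro mult_left_mono power_mono) auto
    then show ?thesis using gradient_taylor[of y \<Delta>] by simp
  qed
  finally have "norm (dg (y + \<Delta>)) \<le> \<rho> * r\<^sup>2 + (2 * (\<rho> * r) * r + 2 * \<rho> * r * r)" using n(2) by simp
  also have "\<dots> = 5 * (\<rho> * r\<^sup>2)" by (simp add: power2_eq_square)
  also have "\<dots> \<le> 9 * (\<rho> * r\<^sup>2)" using rho by (intro mult_right_mono) auto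
  finally show "norm (dg (y + \<Delta>)) \<le> 9 * \<rho> * r\<^sup>2" by simp
  show "loewner_ge (H (y + \<Delta>)) (- (3 * \<rho> * r) *\<^sub>R mat 1)"
    unfolding loewner_ge_def
  proof
    fix x :: "real^'n"
    have "\<bar>x \<bullet> ((H (y + \<Delta>) - H y) *v x)\<bar> \<le> norm x * norm ((H (y + \<Delta>) - H y) *v x)"
      by (rule Cauchy_Schwarz_ineq2)
    also have "\<dots> \<le> norm x * (2 * \<rho> * norm \<Delta> * norm x)"
      using hessian_lipschitz[of "y + \<Delta>" y x] by (intro mult_left_mono) auto
    also have "\<dots> = (2 * \<rho> * norm \<Delta>) * (x \<bullet> x)"
      by (simp add: power2_norm_eq_inner[symmetric] power2_eq_square)
    also have "\<dots> \<le> (2 * \<rho> * r) * (x \<bullet> x)" using nr rho by (intro mult_right_mono) auto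
    finally have 1: "- (2 * (\<rho> * r * (x \<bullet> x))) \<le> x \<bullet> (H (y + \<Delta>) *v x) - x \<bullet> (H y *v x)"
      by (simp add: matrix_vector_mult_diff_rdistrib inner_diff_right abs_le_iff)
    have "\<rho> * norm s * (x \<bullet> x) \<le> \<rho> * r * (x \<bullet> x)" using s(2) rho by (intro mult_right_mono) auto
    then have 2: "- (\<rho> * r * (x \<bullet> x)) \<le> x \<bullet> (H y *v x)"
      using cubic_minimizer_psd[OF sa rho s(1), of x] by simp
    have "x \<bullet> ((H (y + \<Delta>) - - (3 * \<rho> * r) *\<^sub>R mat 1) *v x) = x \<bullet> (H (y + \<Delta>) *v x) + 3 * (\<rho> * r * (x \<bullet> x))"
    proof -
      have "(- (3 * \<rho> * r) *\<^sub>R mat 1) *v x = - (3 * \<rho> * r) *\<^sub>R x"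
        using scaleR_matrix_vector_assoc[of "- (3 * \<rho> * r)" "mat 1" x] by simp
      then show ?thesis by (simp only: matrix_vector_mult_diff_rdistrib inner_diff_right) simp
    qed
    then show "0 \<le> x \<bullet> ((H (y + \<Delta>) - - (3 * \<rho> * r) *\<^sub>R mat 1) *v x)" using 1 2 by linarith
  qed
qed

section \<open>Measurability and independence\<close>

text \<open>Parametrization by coefficients turns a condition on all points of a Krylov subspace
  into an intersection of closed conditions on the pair (y, u), although the dimension of the
  subspace may jump.\<close>

lemma krylov_two_generators:
  "krylov A {b, u} t = {(\<Sum>i<t. c i *\<^sub>R ((\<lambda>x. A *v x) ^^ i) b) + (\<Sum>i<t. e i *\<^sub>R ((\<lambda>x. A *v x) ^^ i) u) | c e. True}"
  (is "_ = ?R")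
proof
  define s where "s c v = (\<Sum>i<t. c i *\<^sub>R ((\<lambda>x. A *v x) ^^ i) v)" for c :: "nat \<Rightarrow> real" and v
  have add: "k *\<^sub>R ((\<lambda>x. A *v x) ^^ i) v + s c v = s (\<lambda>j. (if j = i then k else 0) + c j) v" if "i < t" for k i v c
    using that by (simp add: s_def scaleR_left_distrib sum.distrib if_distrib[of "\<lambda>k. k *\<^sub>R _"] cong: if_cong)
  have R: "?R = {s c b + s e u | c e. True}" by (simp add: s_def)
  have memI: "x = s c b + s e u \<Longrightarrow> x \<in> {s c b + s e u | c e. True}" for x c e by blast
  show "krylov A {b, u} t \<subseteq> ?R"
    unfolding R
  proof
    fix x assume "x \<in> krylov A {b, u} t"
    then show "x \<in> {s c b + s e u | c e. True}"
      unfolding krylov_def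
    proof (induction rule: span_induct_alt)
      case base
      have "0 = s (\<lambda>_. 0) b + s (\<lambda>_. 0) u" by (simp add: s_def)
      then show ?case by (rule memI)
    next
      case (step k x y)
      then obtain i c e where i: "i < t" "x = ((\<lambda>x. A *v x) ^^ i) b \<or> x = ((\<lambda>x. A *v x) ^^ i) u"
        and y: "y = s c b + s e u" by blast
      from i(2) show ?case
      proof
        assume "x = ((\<lambda>x. A *v x) ^^ i) b"
        then have "k *\<^sub>R x + y = s (\<lambda>j. (if j = i then k else 0) + c j) b + s e u"
          using add[OF i(1), of k b c] by (simp add: y add.assoc[symmetric])
        then show ?thesis by (rule memI)
      next
        assume "x = ((\<lambda>x. A *v x) ^^ i) u"
        then have "k *\<^sub>R x + y = s c b + s (\<lambda>j. (if j = i then k else 0) + e j) u"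
          using add[OF i(1), of k u e] by (simp add: y add.left_commute)
        then show ?thesis by (rule memI)
      qed
    qed
  qed
  show "?R \<subseteq> krylov A {b, u} t"
    by (auto intro!: subspace_add[OF subspace_krylov] subspace_sum[OF subspace_krylov]
        subspace_scale[OF subspace_krylov] krylov_funpow)
qed

text \<open>The model has no minimizer of norm at most r, yet no point of the subspace achieves the
  required decrease. Only the current point and the drawn direction occur, so the event is
  unaffected by tie-breaking.\<close>

definition krylov_failure :: "(real^'n \<Rightarrow> real^'n) \<Rightarrow> (real^'n \<Rightarrow> real^'n^'n) \<Rightarrow> real \<Rightarrow> real \<Rightarrow> nat
    \<Rightarrow> ((real^'n) \<times> (real^'n)) set" where
  "krylov_failure dg H \<rho> r t = {(y, u). \<not> (\<exists>s\<in>cball 0 r. cubic_minimizer \<rho> (H y) (dg y) s) \<and>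
     (\<forall>x\<in>krylov (H y) {dg y, u} t. - \<rho> * r ^ 3 / 12 \<le> cmodel \<rho> (H y) (dg y) x)}"

context smooth_objective
begin

lemma continuous_on_cmodel:
  assumes f: "continuous_on UNIV f" and h: "continuous_on UNIV h"
  shows "continuous_on UNIV (\<lambda>p. cmodel \<rho> (H (f p)) (dg (f p)) (h p))"
proof -
  have "continuous_on UNIV (\<lambda>p. H (f p))" "continuous_on UNIV (\<lambda>p. dg (f p))"
    using continuous_on_compose2[OF continuous_hessian f] continuous_on_compose2[OF continuous_gradient f] by auto
  then show ?thesis
    unfolding cmodel_def using h by (intro continuous_intros continuous_on_matrix_vector_mult)
qed

lemma continuous_on_hessian_power:
  assumes f: "continuous_on UNIV f" and h: "continuous_on UNIV h"
  shows "continuous_on UNIV (\<lambda>p. ((\<lambda>x. H (f p) *v x) ^^ i) (h p))"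
proof (induction i)
  case (Suc i)
  have "continuous_on UNIV (\<lambda>p. H (f p))" using continuous_on_compose2[OF continuous_hessian f] by auto
  then show ?case using Suc by (auto intro: continuous_on_matrix_vector_mult)
qed (simp add: h)

text \<open>Points whose model has a minimizer in the compact ball form a closed set, as a
  projection along a compact factor. Failure is thus the intersection of an open and a closed
  set.\<close>

lemma krylov_failure_measurable: "krylov_failure dg H \<rho> r t \<in> sets (borel \<Otimes>\<^sub>M borel)"
proof -
  define G where "G = {y. \<exists>s. s \<in> cball 0 r \<and> (s, y) \<in> {p. cubic_minimizer \<rho> (H (snd p)) (dg (snd p)) (fst p)}}"
  have "closed G"
    unfolding G_def
  proof (rule closed_compact_projection)
    show "closed {p. cubic_minimizer \<rho> (H (snd p)) (dg (snd p)) (fst p)}"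
      unfolding cubic_minimizer_def
      by (intro closed_Collect_all closed_Collect_le continuous_on_cmodel continuous_intros)
  qed simp
  then have "closed (fst -` G :: ((real^'n) \<times> (real^'n)) set)" by (intro closed_vimage continuous_intros)
  moreover define S where "S = {p. \<forall>c e. - \<rho> * r ^ 3 / 12 \<le> cmodel \<rho> (H (fst p)) (dg (fst p))
      ((\<Sum>i<t. c i *\<^sub>R ((\<lambda>x. H (fst p) *v x) ^^ i) (dg (fst p))) + (\<Sum>i<t. e i *\<^sub>R ((\<lambda>x. H (fst p) *v x) ^^ i) (snd p)))}"
  have "continuous_on UNIV (\<lambda>p::(real^'n) \<times> (real^'n). dg (fst p))"
    using continuous_on_compose2[OF continuous_gradient continuous_on_fst[OF continuous_on_id]] by auto
  then have "closed S"
    unfolding S_def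
    by (intro closed_Collect_all closed_Collect_le continuous_on_cmodel continuous_on_add continuous_on_sum
        continuous_on_scaleR continuous_on_hessian_power continuous_intros) 
  ultimately have "- (fst -` G) \<inter> S \<in> sets borel" by (intro sets.Int) auto
  moreover have "krylov_failure dg H \<rho> r t = - (fst -` G) \<inter> S"
  proof -
    have "(\<forall>x\<in>krylov (H y) {dg y, u} t. - \<rho> * r ^ 3 / 12 \<le> cmodel \<rho> (H y) (dg y) x) \<longleftrightarrow> (y, u) \<in> S" for y u
      unfolding krylov_two_generators S_def by auto
    moreover have "(\<exists>s\<in>cball 0 r. cubic_minimizer \<rho> (H y) (dg y) s) \<longleftrightarrow> y \<in> G" for y
      unfolding G_def by auto
    ultimately show ?thesis by (auto simp only: krylov_failure_def split_conv mem_Collect_eq fst_conv vimage_eq)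
  qed
  ultimately have "krylov_failure dg H \<rho> r t \<in> sets borel" by simp
  then show ?thesis unfolding borel_prod .
qed

text \<open>For a fixed point, failure puts u into a slab orthogonal to one bottom eigenvector. The
  half-width a = \<delta>'/(2 sqrt d) is chosen such that the slab bound 2a sqrt d equals
  \<delta>'.\<close>

lemma krylov_failure_section:
  assumes beta: "3 * \<rho> * r \<le> \<beta>" and r: "0 < r" and \<delta>': "0 < \<delta>'" "\<delta>' \<le> 1/2"
  shows "measure uniform_sphere {u. (y, u) \<in> krylov_failure dg H \<rho> r (T_inner CARD('n) \<rho> \<beta> r \<delta>')} \<le> \<delta>'"
proof (cases "\<exists>s\<in>cball 0 r. cubic_minimizer \<rho> (H y) (dg y) s")
  case True
  then have "{u. (y, u) \<in> krylov_failure dg H \<rho> r (T_inner CARD('n) \<rho> \<beta> r \<delta>')} = {}"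
    by (simp only: krylov_failure_def split_conv mem_Collect_eq) simp
  then show ?thesis using \<delta>' by simp
next
  case False
  obtain s where s: "cubic_minimizer \<rho> (H y) (dg y) s"
    using cubic_minimizer_exists[OF rho hessian_lower] by blast
  then have "\<not> norm s \<le> r" using False by auto
  then have "r \<le> norm s" by simp
  from Solve_CR_decrease[OF hessian_self_adjoint hessian_upper hessian_lower rho r beta \<delta>' s this]
  obtain w where w: "norm w = 1" and dec: "\<And>u. norm u \<le> 1 \<Longrightarrow> \<delta>' / (2 * sqrt (real CARD('n))) \<le> \<bar>u \<bullet> w\<bar> \<Longrightarrow>
      \<exists>x\<in>krylov (H y) {dg y, u} (T_inner CARD('n) \<rho> \<beta> r \<delta>'). cmodel \<rho> (H y) (dg y) x < - \<rho> * r ^ 3 / 12"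
    by blast
  define a where "a = \<delta>' / (2 * sqrt (real CARD('n)))"
  have a: "0 < a" using \<delta>' by (simp add: a_def)
  have "{u. (y, u) \<in> krylov_failure dg H \<rho> r (T_inner CARD('n) \<rho> \<beta> r \<delta>')} \<subseteq> {u. 1 < norm u \<or> \<bar>u \<bullet> w\<bar> < a}"
  proof
    fix u assume "u \<in> {u. (y, u) \<in> krylov_failure dg H \<rho> r (T_inner CARD('n) \<rho> \<beta> r \<delta>')}"
    then have "\<not> (norm u \<le> 1 \<and> a \<le> \<bar>u \<bullet> w\<bar>)"
      using dec[of u] by (auto simp: krylov_failure_def a_def not_le[symmetric])
    then show "u \<in> {u. 1 < norm u \<or> \<bar>u \<bullet> w\<bar> < a}" by auto
  qed
  moreover have "{u. 1 < norm u \<or> \<bar>u \<bullet> w\<bar> < a} \<in> sets borel"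
    by (intro borel_open open_Collect_disj open_Collect_less continuous_intros)
  moreover have "finite_measure (uniform_sphere :: (real^'n) measure)"
    using prob_space_uniform_sphere by (rule prob_space.finite_measure)
  ultimately have "measure uniform_sphere {u. (y, u) \<in> krylov_failure dg H \<rho> r (T_inner CARD('n) \<rho> \<beta> r \<delta>')}
      \<le> measure uniform_sphere {u. 1 < norm u \<or> \<bar>u \<bullet> w\<bar> < a}"
    by (intro finite_measure.finite_measure_mono) (auto simp: uniform_sphere_def)
  also have "\<dots> \<le> 2 * a * sqrt (real CARD('n))" by (rule uniform_sphere_slab[OF w a])
  also have "\<dots> = \<delta>'" by (simp add: a_def)
  finally show ?thesis .
qed

end

text \<open>Independence makes the joint law of X and U a product, and the bound on the sections is
  integrated over the law of X.\<close>

lemma (in prob_space) fresh_sample_prob_le: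
  fixes X :: "'a \<Rightarrow> real^'n" and U :: "'a \<Rightarrow> real^'n"
  assumes sub: "subalgebra M F" and X: "X \<in> borel_measurable F" and U: "random_variable borel U"
    and fresh: "indep_set {U -` S \<inter> space M | S. S \<in> sets borel} (sets F)"
    and E: "E \<in> sets (borel \<Otimes>\<^sub>M borel)" and section_le: "\<And>x. measure (distr M borel U) {u. (x, u) \<in> E} \<le> c"
  shows "prob {\<omega> \<in> space M. (X \<omega>, U \<omega>) \<in> E} \<le> c"
proof -
  have XM: "random_variable borel X" by (rule measurable_from_subalg[OF sub X])
  have "indep_set {X -` S \<inter> space M | S. S \<in> sets borel} {U -` S \<inter> space M | S. S \<in> sets borel}"
  proof (rule indep_setI)
    fix a b assume "a \<in> {X -` S \<inter> space M | S. S \<in> sets borel}" and b: "b \<in> {U -` S \<inter> space M | S. S \<in> sets borel}"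
    then have "a \<in> sets F" using X sub by (auto simp: subalgebra_def dest: measurable_sets)
    from indep_setD[OF fresh b this] show "prob (a \<inter> b) = prob a * prob b"
      by (simp add: Int_commute mult.commute)
  qed (use XM U in \<open>auto intro: measurable_sets\<close>)
  moreover have "Int_stable {f -` S \<inter> space M | S. S \<in> sets borel}" for f :: "'a \<Rightarrow> real^'n"
  proof (rule Int_stableI)
    fix a b assume "a \<in> {f -` S \<inter> space M | S. S \<in> sets borel}" "b \<in> {f -` S \<inter> space M | S. S \<in> sets borel}"
    then obtain S T where "S \<in> sets borel" "T \<in> sets borel" "a \<inter> b = f -` (S \<inter> T) \<inter> space M" by blast
    then show "a \<inter> b \<in> {f -` S \<inter> space M | S. S \<in> sets borel}" using sets.Int by blast
  qed
  ultimately have "indep_var borel X borel U"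
    unfolding indep_var_eq using XM U by (blast intro: indep_set_sigma_sets)
  then have joint: "distr M borel X \<Otimes>\<^sub>M distr M borel U = distr M (borel \<Otimes>\<^sub>M borel) (\<lambda>\<omega>. (X \<omega>, U \<omega>))"
    unfolding indep_var_distribution_eq by blast
  interpret DX: prob_space "distr M borel X" by (rule prob_space_distr[OF XM])
  interpret DU: prob_space "distr M borel U" by (rule prob_space_distr[OF U])
  have c: "0 \<le> c" using section_le[of undefined] measure_nonneg order_trans by blast
  have XU: "(\<lambda>\<omega>. (X \<omega>, U \<omega>)) \<in> measurable M (borel \<Otimes>\<^sub>M borel)" using XM U by simp
  have "emeasure M {\<omega> \<in> space M. (X \<omega>, U \<omega>) \<in> E} = emeasure (distr M (borel \<Otimes>\<^sub>M borel) (\<lambda>\<omega>. (X \<omega>, U \<omega>))) E"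
    using XU E by (subst emeasure_distr) (auto intro!: arg_cong[of _ _ "emeasure M"])
  also have "\<dots> = (\<integral>\<^sup>+ x. emeasure (distr M borel U) (Pair x -` E) \<partial>distr M borel X)"
    unfolding joint[symmetric] by (rule DU.emeasure_pair_measure_alt) (use E in simp)
  also have "\<dots> \<le> (\<integral>\<^sup>+ x. ennreal c \<partial>distr M borel X)"
    using section_le by (intro nn_integral_mono) (simp add: DU.emeasure_eq_measure vimage_def ennreal_leI)
  also have "\<dots> = ennreal c" using DX.emeasure_space_1 by simp
  finally show ?thesis using c by (simp add: emeasure_eq_measure)
qed

section \<open>Iteration counts\<close>

text \<open>The last identity holds because \<rho>r^3 = \<epsilon>^(3/2) / (27 sqrt \<rho>), and 12
  * 27 = 324.\<close>

lemma step_radius_facts: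
  fixes \<rho> \<epsilon> :: real
  assumes "0 < \<rho>" "0 < \<epsilon>"
  defines "r \<equiv> step_radius \<rho> \<epsilon>"
  shows "0 < r" "9 * \<rho> * r\<^sup>2 = \<epsilon>" "3 * \<rho> * r = sqrt (\<rho> * \<epsilon>)" "6 * \<rho> * r\<^sup>2 = 2 * \<epsilon> / 3"
    "12 * D / (\<rho> * r ^ 3) = 324 * (sqrt \<rho> * D / \<epsilon> powr (3/2))"
proof -
  show r: "0 < r" using assms by (simp add: r_def step_radius_def)
  have "r\<^sup>2 = \<epsilon> / (9 * \<rho>)" using assms by (simp add: r_def step_radius_def)
  then show r2: "9 * \<rho> * r\<^sup>2 = \<epsilon>" using assms by simp
  then show "6 * \<rho> * r\<^sup>2 = 2 * \<epsilon> / 3" by simp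
  have "(3 * \<rho> * r)\<^sup>2 = \<rho> * (9 * \<rho> * r\<^sup>2)" by (simp add: power2_eq_square)
  also have "\<dots> = \<rho> * \<epsilon>" unfolding r2 ..
  finally have "(3 * \<rho> * r)\<^sup>2 = \<rho> * \<epsilon>" .
  then show r3: "3 * \<rho> * r = sqrt (\<rho> * \<epsilon>)"
    using r assms by (metis less_eq_real_def mult_nonneg_nonneg real_sqrt_unique zero_le_numeral)
  have "27 * (\<rho> * r ^ 3) * sqrt \<rho> * sqrt \<rho> = (9 * \<rho> * r\<^sup>2) * (3 * \<rho> * r)"
    using assms by (simp add: power2_eq_square power3_eq_cube mult.assoc)
  also have "\<dots> = \<epsilon> * sqrt \<epsilon> * sqrt \<rho>" unfolding r2 r3 by (simp add: real_sqrt_mult)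
  finally have "27 * (\<rho> * r ^ 3) * sqrt \<rho> = \<epsilon> * sqrt \<epsilon>" using assms by simp
  moreover have "\<epsilon> powr (3/2) = \<epsilon> * sqrt \<epsilon>"
    using powr_add[of \<epsilon> 1 "1/2"] assms by (simp add: powr_half_sqrt)
  ultimately have "\<epsilon> powr (3/2) = 27 * (\<rho> * r ^ 3) * sqrt \<rho>" by simp
  then show "12 * D / (\<rho> * r ^ 3) = 324 * (sqrt \<rho> * D / \<epsilon> powr (3/2))" using r assms by simp
qed

text \<open>A statement about a single path. Each iteration before the halting one lowers g by at
  least \<rho>r^3/12, which bounds their number. At the halting iteration the upper model exceeds
  -\<rho>r^3/12 at the returned minimizer, hence is at least that on the whole subspace; without
  failure this leaves only a short minimizer.\<close>

lemma (in smooth_objective) halting_iteration: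
  fixes Y U :: "nat \<Rightarrow> real^'n" and \<epsilon> :: real
  defines "r \<equiv> step_radius \<rho> \<epsilon>"
  assumes eps: "0 < \<epsilon>" and low: "\<And>x. g\<^sub>s \<le> g x"
    and step: "\<And>k. reaches_iteration g \<rho> \<epsilon> Y k \<Longrightarrow>
      \<exists>\<Delta> \<in> solve_cr (H (Y (k - 1))) (dg (Y (k - 1))) \<rho> \<beta> r (conf \<delta> k) (U k). Y k = Y (k - 1) + \<Delta>"
    and N: "12 * (g (Y 0) - g\<^sub>s) / (\<rho> * r ^ 3) < real N"
  obtains K where "halts_at g \<rho> \<epsilon> Y K" "1 \<le> K" "K \<le> N" "real K \<le> 1 + 12 * (g (Y 0) - g\<^sub>s) / (\<rho> * r ^ 3)"
    "(Y (K - 1), U K) \<notin> krylov_failure dg H \<rho> r (T_inner CARD('n) \<rho> \<beta> r (conf \<delta> K)) \<Longrightarrow>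
      \<exists>s\<in>cball 0 r. cubic_minimizer \<rho> (H (Y (K - 1))) (dg (Y (K - 1))) s"
proof -
  have r: "0 < r" unfolding r_def by (rule step_radius_facts(1)[OF rho eps])
  define c where "c = 1/12 * \<rho> * r ^ 3"
  have c: "0 < c" using r rho by (simp add: c_def)
  have bound: "real m \<le> 12 * (g (Y 0) - g\<^sub>s) / (\<rho> * r ^ 3)"
    if "\<And>j. 1 \<le> j \<Longrightarrow> j \<le> m \<Longrightarrow> \<not> insufficient_decrease g \<rho> \<epsilon> Y j" for m
  proof -
    have "g (Y m) \<le> g (Y 0) - real m * c"
      using that
    proof (induction m)
      case (Suc m)
      have "g (Y (Suc m)) \<le> g (Y m) - c"
        using Suc.prems[of "Suc m"] by (simp add: insufficient_decrease_def c_def r_def)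
      moreover have "g (Y m) \<le> g (Y 0) - real m * c" using Suc by simp
      ultimately show ?case by (simp add: algebra_simps)
    qed simp
    then have "real m * c \<le> g (Y 0) - g\<^sub>s" using low[of "Y m"] by simp
    then have "real m \<le> (g (Y 0) - g\<^sub>s) / c" using c by (simp add: pos_le_divide_eq)
    then show ?thesis by (simp add: c_def right_diff_distrib mult.commute)
  qed
  define P where "P j \<longleftrightarrow> 1 \<le> j \<and> insufficient_decrease g \<rho> \<epsilon> Y j" for j
  have "\<exists>j\<le>N. P j"
  proof (rule ccontr)
    assume "\<not> (\<exists>j\<le>N. P j)"
    then have "real N \<le> 12 * (g (Y 0) - g\<^sub>s) / (\<rho> * r ^ 3)" by (intro bound) (auto simp: P_def)
    then show False using N by simp
  qed
  then obtain j where j: "P j" "j \<le> N" by blast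
  define K where "K = (LEAST j. P j)"
  have K: "P K" unfolding K_def by (rule LeastI[of P, OF j(1)])
  have KN: "K \<le> N" using Least_le[of P j] j by (simp add: K_def)
  have least: "\<not> insufficient_decrease g \<rho> \<epsilon> Y j" if "1 \<le> j" "j < K" for j
    using not_less_Least[of j P] that by (auto simp: K_def P_def)
  have reach: "reaches_iteration g \<rho> \<epsilon> Y K" using K least by (simp add: reaches_iteration_def P_def)
  have K1: "1 \<le> K" using K by (simp add: P_def)
  have "real (K - 1) \<le> 12 * (g (Y 0) - g\<^sub>s) / (\<rho> * r ^ 3)"
    using K1 by (intro bound least) auto
  then have count: "real K \<le> 1 + 12 * (g (Y 0) - g\<^sub>s) / (\<rho> * r ^ 3)" using K1 by simp
  have good: "\<exists>s\<in>cball 0 r. cubic_minimizer \<rho> (H (Y (K - 1))) (dg (Y (K - 1))) s"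
    if nb: "(Y (K - 1), U K) \<notin> krylov_failure dg H \<rho> r (T_inner CARD('n) \<rho> \<beta> r (conf \<delta> K))"
  proof -
    let ?m = "cmodel \<rho> (H (Y (K - 1))) (dg (Y (K - 1)))"
    let ?K = "krylov (H (Y (K - 1))) {dg (Y (K - 1)), U K} (T_inner CARD('n) \<rho> \<beta> r (conf \<delta> K))"
    obtain \<Delta> where \<Delta>: "\<Delta> \<in> solve_cr (H (Y (K - 1))) (dg (Y (K - 1))) \<rho> \<beta> r (conf \<delta> K) (U K)"
      and YK: "Y K = Y (K - 1) + \<Delta>" using step[OF reach] by blast
    have "g (Y K) > g (Y (K - 1)) - 1/12 * \<rho> * r ^ 3"
      using K by (simp add: P_def insufficient_decrease_def r_def)
    then have "- \<rho> * r ^ 3 / 12 < ?m \<Delta>" using cubic_upper_model[of "Y (K - 1)" \<Delta>] by (simp add: YK)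
    moreover have "?m \<Delta> \<le> ?m x" if "x \<in> ?K" for x
      using \<Delta> that by (auto simp: solve_cr_def is_arg_min_def cmodel_def not_less)
    ultimately have "\<forall>x\<in>?K. - \<rho> * r ^ 3 / 12 \<le> ?m x" by fastforce
    then show ?thesis using nb by (auto simp: krylov_failure_def)
  qed
  have "halts_at g \<rho> \<epsilon> Y K" using reach K by (simp add: halts_at_def P_def)
  then show ?thesis using K1 KN count good by (rule that)
qed

section \<open>Numerical bounds on the costs of the subroutines\<close>

lemma ln_16_le: "ln (16::real) \<le> 4"
proof -
  have "ln (16::real) = 4 * ln 2" using ln_realpow[of 2 4] by simp
  then show ?thesis using ln_le_minus_one[of "2::real"] by simp
qed

lemma ln_325_le: "ln (325::real) \<le> 9"
proof -
  have "ln (325::real) \<le> ln (2 ^ 9)" by (subst ln_le_cancel_iff) auto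
  also have "\<dots> = 9 * ln 2" by (subst ln_realpow) auto
  also have "\<dots> \<le> 9" using ln_le_minus_one[of "2::real"] by simp
  finally show ?thesis .
qed

lemma ln_2_ge: "1/2 \<le> ln (2::real)"
proof -
  have "exp (1/2::real) ^ 2 = exp 1" by (simp add: exp_of_nat_mult[symmetric])
  also have "\<dots> \<le> 2 ^ 2" using exp_le by simp
  finally have "exp (1/2::real) \<le> 2" by (rule power2_le_imp_le) simp
  then show ?thesis by (subst ln_ge_iff) auto
qed

text \<open>72(4 + l^2/2) = 288 + 36 l^2 is at most (17 + 6l)^2, and rounding up costs at most 1 <=
  w.\<close>

lemma T_inner_le:
  fixes w :: real
  assumes w: "1 \<le> w" "24 * \<beta> / (\<rho> * r) = 72 * w\<^sup>2" and l: "ln (4 * real d / \<delta>'\<^sup>2) = l" "0 \<le> l"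
  shows "real (T_inner d \<rho> \<beta> r \<delta>') \<le> w * (18 + 6 * l)"
proof -
  define y where "y = sqrt (72 * w\<^sup>2 * (4 + 1/2 * l\<^sup>2))"
  have "72 * w\<^sup>2 * (4 + 1/2 * l\<^sup>2) \<le> w\<^sup>2 * (17 + 6 * l)\<^sup>2"
    using l w by (simp add: power2_sum power_mult_distrib algebra_simps)
  then have "y \<le> sqrt ((w * (17 + 6 * l))\<^sup>2)"
    unfolding y_def power_mult_distrib by (rule real_sqrt_le_mono)
  also have "\<dots> = w * (17 + 6 * l)" using w l by simp
  finally have y: "y \<le> w * (17 + 6 * l)" .
  have "0 \<le> y" by (simp add: y_def)
  then have "real (nat \<lceil>y\<rceil>) \<le> y + 1" by linarith
  moreover have "T_inner d \<rho> \<beta> r \<delta>' = nat \<lceil>y\<rceil>" by (simp add: T_inner_def y_def w l)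
  ultimately show ?thesis using y w by (simp add: algebra_simps)
qed

lemma T_final_le:
  fixes w :: real
  assumes pos: "0 < \<rho>" "0 < r" and w: "1 \<le> w" "\<beta> / (\<rho> * r) = 3 * w\<^sup>2"
  shows "real (T_final \<rho> \<beta> r (6 * \<rho> * r\<^sup>2)) \<le> w * (7 + 3 * ln w)"
proof -
  define k where "k = 3 * w\<^sup>2 + 2"
  have rr: "0 < \<rho> * r" using pos by simp
  have k: "(\<beta> + 2 * \<rho> * r) / (\<rho> * r) = k"
    using pos w by (simp add: add_divide_distrib k_def)
  have w2: "1 \<le> w\<^sup>2" using w by simp
  have lw: "0 \<le> ln w" using w by simp
  have "(6 * \<rho> * r\<^sup>2)\<^sup>2 = 36 * r\<^sup>2 * (\<rho> * r)\<^sup>2" by (simp add: power2_eq_square)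
  then have "36 * (\<beta> + 2 * \<rho> * r)\<^sup>2 * r\<^sup>2 / (6 * \<rho> * r\<^sup>2)\<^sup>2 = ((\<beta> + 2 * \<rho> * r) / (\<rho> * r))\<^sup>2"
    using pos by (simp add: power_divide)
  then have arg: "36 * (\<beta> + 2 * \<rho> * r)\<^sup>2 * r\<^sup>2 / (6 * \<rho> * r\<^sup>2)\<^sup>2 = k\<^sup>2" unfolding k .
  have "sqrt k \<le> sqrt ((3 * w)\<^sup>2)"
    using w2 by (intro real_sqrt_le_mono) (simp add: k_def power_mult_distrib)
  also have "\<dots> = 3 * w" using w by (subst real_sqrt_abs) simp
  finally have sk: "sqrt k \<le> 3 * w" .
  have "k \<le> 16 * w\<^sup>2" using w2 by (simp add: k_def)
  then have "ln k \<le> ln (16 * w\<^sup>2)" using w2 by (subst ln_le_cancel_iff) (auto simp: k_def intro!: add_pos_pos)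
  also have "\<dots> = ln 16 + 2 * ln w" using w by (simp add: ln_mult ln_realpow)
  finally have lk: "ln k \<le> 4 + 2 * ln w" using ln_16_le by simp
  have lk0: "0 \<le> ln k" using w2 by (simp add: k_def)
  define y where "y = 1/4 * sqrt k * ln (k\<^sup>2)"
  have "k > 0" using w2 by (simp add: k_def)
  then have "y = 1/2 * (sqrt k * ln k)" by (simp add: y_def ln_realpow)
  also have "\<dots> \<le> 1/2 * ((3 * w) * (4 + 2 * ln w))"
    using sk lk lk0 w by (intro mult_left_mono mult_mono) auto
  finally have y: "y \<le> w * (6 + 3 * ln w)" by (simp add: algebra_simps)
  have "0 \<le> sqrt k * ln k" using lk0 \<open>k > 0\<close> by simp
  then have "0 \<le> y" using \<open>y = 1/2 * (sqrt k * ln k)\<close> by linarith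
  then have "real (nat \<lceil>y\<rceil>) \<le> y + 1" by linarith
  moreover have "T_final \<rho> \<beta> r (6 * \<rho> * r\<^sup>2) = nat \<lceil>y\<rceil>" unfolding T_final_def k arg y_def ..
  ultimately show ?thesis using y w by (simp add: algebra_simps)
qed

text \<open>Here c scales the number of iterations and w the work in each. With X for the two
  logarithms, 258 + 24X = 18 + 6(40 + 4X), and the factor 2 * 325 yields 167700 and 15600.\<close>

lemma hvp_evals_le:
  fixes w c \<rho> \<epsilon> :: real
  defines "r \<equiv> step_radius \<rho> \<epsilon>"
  assumes pos: "0 < \<rho>" "0 < \<epsilon>" and delta: "0 < \<delta>" "\<delta> \<le> 1" and d: "1 \<le> d"
    and w: "1 \<le> w" "\<beta> / (\<rho> * r) = 3 * w\<^sup>2" and c: "1 \<le> c"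
    and K: "1 \<le> K" "real K \<le> 325 * c"
  shows "real (hvp_evals d \<beta> \<rho> \<epsilon> \<delta> K) \<le> O1 * (c * w) * log_factor d \<delta> (c * w)"
proof -
  define s where "s = c * w"
  define X where "X = ln (real d / \<delta>\<^sup>2) + ln s"
  have r: "0 < r" unfolding r_def by (rule step_radius_facts(1)[OF pos])
  have s: "1 \<le> s" "w \<le> s" "c \<le> s"
    using mult_mono[of 1 c 1 w] mult_mono[of 1 c w w] mult_mono[of c c 1 w] c w by (auto simp: s_def)
  have "\<delta>\<^sup>2 \<le> 1\<^sup>2" using delta by (intro power_mono) auto
  then have d\<delta>: "real d \<le> real d / \<delta>\<^sup>2" using delta d by (simp add: le_divide_eq)
  then have lnd: "ln (real d) \<le> ln (real d / \<delta>\<^sup>2)" using d delta by (subst ln_le_cancel_iff) auto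
  have lnd0: "0 \<le> ln (real d)" using d by simp
  have lns: "0 \<le> ln s" using s by simp
  have X: "0 \<le> X" "ln (real d) \<le> X" using lnd lnd0 lns by (auto simp: X_def)
  \<comment> \<open>The decreasing confidence levels cost a term in ln k; it is absorbed because the
    number of iterations is itself at most 325 s.\<close>
  have lnK: "ln (real k) \<le> 9 + ln s" if "1 \<le> k" "k \<le> K" for k
  proof -
    have "real k \<le> 325 * s" using that K s by linarith
    then have "ln (real k) \<le> ln (325 * s)" using that s by (subst ln_le_cancel_iff) auto
    also have "\<dots> = ln 325 + ln s" using s by (subst ln_mult) auto
    finally show ?thesis using ln_325_le by simp
  qed
  have "real (T_inner d \<rho> \<beta> r (conf \<delta> k)) \<le> w * (258 + 24 * X)" if k: "k \<in> {1..K}" for k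
  proof -
    have k1: "1 \<le> real k" using k by simp
    define l where "l = ln (4 * real d / (conf \<delta> k)\<^sup>2)"
    define q where "q = real d / \<delta>\<^sup>2"
    have q: "0 < q" using d delta by (simp add: q_def)
    have "4 * real d / (conf \<delta> k)\<^sup>2 = 16 * q * real k ^ 4"
      unfolding q_def using delta k1 by (simp add: conf_def power_divide power_mult_distrib field_simps power2_eq_square power4_eq_xxxx)
    moreover have "ln (16 * q * real k ^ 4) = ln 16 + ln q + 4 * ln (real k)"
      using q k1 by (simp add: ln_mult ln_realpow)
    ultimately have "l = ln 16 + ln (real d / \<delta>\<^sup>2) + 4 * ln (real k)" by (simp add: l_def q_def)
    moreover have "0 \<le> ln (16::real)" "0 \<le> ln (real k)" using k1 by auto
    moreover have "ln (real k) \<le> 9 + ln s" using lnK k by simp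
    ultimately have l: "0 \<le> l" "l \<le> 40 + 4 * X"
      using lnd lnd0 ln_16_le by (auto simp: X_def)
    have "24 * \<beta> / (\<rho> * r) = 72 * w\<^sup>2" using w(2) by simp
    then have "real (T_inner d \<rho> \<beta> r (conf \<delta> k)) \<le> w * (18 + 6 * l)"
      using T_inner_le[OF w(1) _ l_def[symmetric] l(1)] by blast
    also have "\<dots> \<le> w * (258 + 24 * X)" using l w by (intro mult_left_mono) auto
    finally show ?thesis .
  qed
  then have "(\<Sum>k = 1..K. 2 * real (T_inner d \<rho> \<beta> r (conf \<delta> k))) \<le> (\<Sum>k = 1..K. 2 * (w * (258 + 24 * X)))"
    by (intro sum_mono mult_left_mono) auto
  also have "\<dots> = real K * (2 * (w * (258 + 24 * X)))" by simp
  also have "\<dots> \<le> 325 * c * (2 * (w * (258 + 24 * X)))" using K w X by (intro mult_right_mono) auto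
  also have "\<dots> = s * (167700 + 15600 * X)" by (simp add: s_def algebra_simps)
  finally have inner: "(\<Sum>k = 1..K. 2 * real (T_inner d \<rho> \<beta> r (conf \<delta> k))) \<le> s * (167700 + 15600 * X)" .
  have "ln w \<le> X"
  proof -
    have "ln w \<le> ln s" using w s by (subst ln_le_cancel_iff) auto
    then show ?thesis using lnd lnd0 by (simp add: X_def)
  qed
  moreover have "real (T_final \<rho> \<beta> r (6 * \<rho> * r\<^sup>2)) \<le> w * (7 + 3 * ln w)"
    by (rule T_final_le[OF pos(1) r w])
  moreover have "w * (7 + 3 * ln w) \<le> s * (7 + 3 * X)"
    using \<open>ln w \<le> X\<close> w s by (intro mult_mono) auto
  moreover have "6 * \<rho> * r\<^sup>2 = 2 * \<epsilon> / 3" unfolding r_def by (rule step_radius_facts(4)[OF pos])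
  ultimately have "real (hvp_evals d \<beta> \<rho> \<epsilon> \<delta> K) \<le> s * (167700 + 15600 * X) + s * (7 + 3 * X)"
    using inner by (simp add: hvp_evals_def r_def[symmetric])
  also have "\<dots> = s * (167707 + 15603 * X)" by (simp add: algebra_simps)
  also have "\<dots> \<le> s * (10 ^ 6 * log_factor d \<delta> s)"
  proof (rule mult_left_mono)
    have lf: "log_factor d \<delta> s = X + of_bool (d = 1)" by (simp add: log_factor_def X_def)
    \<comment> \<open>The additive constant must be dominated by the bracket: for d >= 2 because X
      >= ln 2 >= 1/2, for d = 1 by the extra summand.\<close>
    show "167707 + 15603 * X \<le> 10 ^ 6 * log_factor d \<delta> s"
    proof (cases "d = 1")
      case True
      then show ?thesis unfolding lf using X by simp
    next
      case False
      then have "ln 2 \<le> ln (real d)" using d by (subst ln_le_cancel_iff) auto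
      then have "1/2 \<le> X" using ln_2_ge X by linarith
      then show ?thesis unfolding lf using False by simp
    qed
  qed (use s in simp)
  finally show ?thesis by (simp add: O1_def s_def mult_ac)
qed

text \<open>The bound factors into the scale of the iteration count and w, where w^2 =
  \<beta>/(3\<rho>r) plays the role of a condition number.\<close>

lemma complexity_scale:
  assumes pos: "0 < \<beta>" "0 < \<rho>" "0 < \<epsilon>"
  shows "\<beta> powr (1/2) * \<rho> powr (1/4) * D / \<epsilon> powr (7/4)
    = (sqrt \<rho> * D / \<epsilon> powr (3/2)) * sqrt (\<beta> / sqrt (\<rho> * \<epsilon>))"
proof -
  have "sqrt (\<beta> / sqrt (\<rho> * \<epsilon>)) = \<beta> powr (1/2) / (\<rho> powr (1/4) * \<epsilon> powr (1/4))"
    using pos by (simp add: powr_half_sqrt[symmetric] powr_divide powr_mult powr_powr)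
  moreover have "sqrt \<rho> = \<rho> powr (1/4) * \<rho> powr (1/4)"
    using pos by (simp add: powr_half_sqrt[symmetric] powr_add[symmetric])
  moreover have "\<epsilon> powr (7/4) = \<epsilon> powr (3/2) * \<epsilon> powr (1/4)" by (simp add: powr_add[symmetric])
  ultimately show ?thesis using pos by simp
qed

lemma iteration_scale_ge_1:
  assumes pos: "0 < \<rho>" "0 < \<epsilon>" and D: "0 \<le> D" and eps: "\<epsilon> \<le> \<rho> powr (1/3) * D powr (2/3)"
  shows "1 \<le> sqrt \<rho> * D / \<epsilon> powr (3/2)"
proof -
  have "\<epsilon> powr (3/2) \<le> (\<rho> powr (1/3) * D powr (2/3)) powr (3/2)"
    using pos eps by (intro powr_mono2) auto
  also have "\<dots> = sqrt \<rho> * D"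
    using pos D by (simp add: powr_mult powr_powr powr_half_sqrt[symmetric])
  finally show ?thesis using pos by simp
qed

section \<open>The complexity theorem\<close>

text \<open>Telescoping with 1/(n + 1)^2 <= 1/n - 1/(n + 1); the induction needs the sharper bound
  \<delta>(1 - 1/(2N)).\<close>

lemma sum_conf_le:
  assumes "0 \<le> \<delta>"
  shows "(\<Sum>k = 1..N. conf \<delta> k) \<le> \<delta>"
proof -
  have "(\<Sum>k = 1..N. conf \<delta> k) \<le> \<delta> * (1 - 1 / (2 * real N))" if "1 \<le> N"
    using that
  proof (induction N rule: dec_induct)
    case (step n)
    have n: "1 \<le> real n" using step by simp
    have "1 / (2 * (real (Suc n))\<^sup>2) \<le> 1 / (2 * (real n * real (Suc n)))"
      using n by (intro divide_left_mono) (auto simp: power2_eq_square)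
    also have "\<dots> = 1 / (2 * real n) - 1 / (2 * real (Suc n))"
      using n by (simp add: field_simps)
    finally have "\<delta> * (1 / (2 * (real (Suc n))\<^sup>2)) \<le> \<delta> * (1 / (2 * real n) - 1 / (2 * real (Suc n)))"
      using assms by (rule mult_left_mono)
    then have "conf \<delta> (Suc n) \<le> \<delta> * (1 / (2 * real n) - 1 / (2 * real (Suc n)))"
      by (simp add: conf_def)
    moreover have "(\<Sum>k = 1..Suc n. conf \<delta> k) = (\<Sum>k = 1..n. conf \<delta> k) + conf \<delta> (Suc n)" by simp
    ultimately show ?case using step.IH unfolding right_diff_distrib by linarith
  qed (simp add: conf_def)
  moreover have "\<delta> * (1 - 1 / (2 * real N)) \<le> \<delta> * 1" using assms by (intro mult_left_mono) auto
  ultimately show ?thesis using assms by (cases "1 \<le> N") auto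
qed

theorem proposition6p1:
  fixes g :: "real^'n \<Rightarrow> real"
    and dg :: "real^'n \<Rightarrow> real^'n"
    and H :: "real^'n \<Rightarrow> real^'n^'n"
    and g\<^sub>s \<beta> \<rho> \<epsilon> \<delta> :: real
    and y0 :: "real^'n"
    and M :: "'w measure" and F :: "nat \<Rightarrow> 'w measure"
    and u y :: "nat \<Rightarrow> 'w \<Rightarrow> real^'n" and final :: "'w \<Rightarrow> real^'n"
  assumes gradient: "\<And>x. GDERIV g x :> dg x"
    and hessian: "\<And>x. (dg has_derivative (\<lambda>h. H x *v h)) (at x)"
    and bounded_below: "bdd_below (range g)"
    and g_star: "g\<^sub>s = (INF x. g x)"
    and pos: "\<beta> > 0" "\<rho> > 0"
    and lipschitz_gradient: "\<beta>-lipschitz_on UNIV dg"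
    and lipschitz_hessian:
      "\<And>x x'. onorm (\<lambda>v. (H x - H x') *v v) \<le> 2 * \<rho> * norm (x - x')"
    and delta: "0 < \<delta>" "\<delta> \<le> 1"
    and eps: "0 < \<epsilon>" "\<epsilon> \<le> min (\<beta>\<^sup>2 / \<rho>) (\<rho> powr (1/3) * (g y0 - g\<^sub>s) powr (2/3))"
    and run: "find_sosp_run M F y0 g dg H \<beta> \<rho> \<epsilon> \<delta> u y final"
  shows "Sigma_Algebra.measure M {\<omega> \<in> space M. \<exists>K.
           halts_at g \<rho> \<epsilon> (\<lambda>k. y k \<omega>) K \<and>
           (let y\<^sub>\<epsilon> = y (K - 1) \<omega> + final \<omega>;
                s = \<beta> powr (1/2) * \<rho> powr (1/4) * (g y0 - g\<^sub>s) / \<epsilon> powr (7/4);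
                c = sqrt \<rho> * (g y0 - g\<^sub>s) / \<epsilon> powr (3/2)
            in norm (dg y\<^sub>\<epsilon>) \<le> \<epsilon> \<and>
               loewner_ge (H y\<^sub>\<epsilon>) (- sqrt (\<rho> * \<epsilon>) *\<^sub>R mat 1) \<and>
               real (hvp_evals CARD('n) \<beta> \<rho> \<epsilon> \<delta> K) \<le> O1 * s * log_factor CARD('n) \<delta> s \<and>
               real (cr_calls K) \<le> O1 * c \<and>
               real (gradient_evals K) \<le> O1 * c)} \<ge> 1 - \<delta>"
proof -
  interpret run: find_sosp_run M F y0 g dg H \<beta> \<rho> \<epsilon> \<delta> u y final by (rule run)
  interpret smooth_objective g dg H \<beta> \<rho>
    by unfold_locales (fact gradient hessian pos lipschitz_gradient lipschitz_hessian)+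
  define r D where "r = step_radius \<rho> \<epsilon>" and "D = g y0 - g\<^sub>s"
  note r = step_radius_facts[OF pos(2) eps(1), folded r_def]
  have low: "g\<^sub>s \<le> g x" for x unfolding g_star by (rule cINF_lower[OF bounded_below]) simp
  have D: "0 \<le> D" using low[of y0] by (simp add: D_def)
  have "\<rho> * \<epsilon> \<le> \<beta>\<^sup>2" using eps(2) pos by (simp add: le_divide_eq mult.commute)
  then have "sqrt (\<rho> * \<epsilon>) \<le> sqrt (\<beta>\<^sup>2)" by (rule real_sqrt_le_mono)
  then have r\<beta>: "3 * \<rho> * r \<le> \<beta>" using pos by (simp add: r(3))
  define c where "c = sqrt \<rho> * D / \<epsilon> powr (3/2)"
  define w where "w = sqrt (\<beta> / sqrt (\<rho> * \<epsilon>))"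
  have c: "1 \<le> c" unfolding c_def using iteration_scale_ge_1[OF pos(2) eps(1) D] eps(2) by (simp add: D_def)
  have "1 \<le> \<beta> / sqrt (\<rho> * \<epsilon>)" using r\<beta> pos eps(1) by (simp add: r(3) le_divide_eq)
  then have w: "1 \<le> w" by (simp add: w_def)
  have "w\<^sup>2 = \<beta> / (3 * \<rho> * r)" using pos eps(1) by (simp add: w_def r(3))
  then have w2: "\<beta> / (\<rho> * r) = 3 * w\<^sup>2" by simp
  have s: "\<beta> powr (1/2) * \<rho> powr (1/4) * (g y0 - g\<^sub>s) / \<epsilon> powr (7/4) = c * w"
    unfolding c_def w_def D_def by (rule complexity_scale[OF pos eps(1)])
  have c': "sqrt \<rho> * (g y0 - g\<^sub>s) / \<epsilon> powr (3/2) = c" by (simp add: c_def D_def)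
  \<comment> \<open>A deterministic bound on the halting iteration, so that the union bound runs
    over a fixed finite set.\<close>
  obtain N where N: "12 * D / (\<rho> * r ^ 3) < real N" using reals_Archimedean2 by blast
  have conf: "0 < conf \<delta> k" "conf \<delta> k \<le> 1/2" if "1 \<le> k" for k
  proof -
    have "\<delta> \<le> 1 * (real k)\<^sup>2" using delta that by (simp add: order_trans[of \<delta> 1])
    then show "0 < conf \<delta> k" "conf \<delta> k \<le> 1/2" using delta that by (simp_all add: conf_def divide_le_eq)
  qed
  define bad where "bad k = krylov_failure dg H \<rho> r (T_inner CARD('n) \<rho> \<beta> r (conf \<delta> k))" for k
  \<comment> \<open>Freshness and adaptedness hold for every k, also after halting, so no
    conditioning on the run still being active occurs.\<close>
  define E where "E k = {\<omega> \<in> space M. (y (k - 1) \<omega>, u k \<omega>) \<in> bad k}" for k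
  have yM[measurable]: "y k \<in> borel_measurable M" for k
    by (rule measurable_from_subalg[OF run.F_subalgebra run.y_adapted])
  have uM: "u k \<in> borel_measurable M" if "1 \<le> k" for k
    by (rule measurable_from_subalg[OF run.F_subalgebra run.u_adapted[OF that]])
  have E: "E k \<in> sets M" "run.prob (E k) \<le> conf \<delta> k" if k: "1 \<le> k" for k
  proof -
    have "(\<lambda>\<omega>. (y (k - 1) \<omega>, u k \<omega>)) \<in> measurable M (borel \<Otimes>\<^sub>M borel)" using uM[OF k] by simp
    from measurable_sets[OF this krylov_failure_measurable, of r "T_inner CARD('n) \<rho> \<beta> r (conf \<delta> k)"]
    show "E k \<in> sets M" by (simp add: E_def bad_def vimage_def Int_def conj_commute)
    show "run.prob (E k) \<le> conf \<delta> k"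
      unfolding E_def
    proof (rule run.fresh_sample_prob_le[OF run.F_subalgebra run.y_adapted uM[OF k] run.u_fresh[OF k]])
      show "bad k \<in> sets (borel \<Otimes>\<^sub>M borel)" unfolding bad_def by (rule krylov_failure_measurable)
      show "measure (distr M borel (u k)) {u. (x, u) \<in> bad k} \<le> conf \<delta> k" for x
        unfolding run.u_uniform[OF k] bad_def by (rule krylov_failure_section[OF r\<beta> r(1) conf[OF k]])
    qed
  qed
  have "run.prob (\<Union>k\<in>{1..N}. E k) \<le> (\<Sum>k\<in>{1..N}. run.prob (E k))"
    using E(1) by (intro run.finite_measure_subadditive_finite) auto
  also have "\<dots> \<le> (\<Sum>k\<in>{1..N}. conf \<delta> k)" using E(2) by (intro sum_mono) auto
  also have "\<dots> \<le> \<delta>" using delta by (intro sum_conf_le) simp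
  finally have bad_le: "run.prob (\<Union>k\<in>{1..N}. E k) \<le> \<delta>" .
  define S where "S = {x. norm (dg x) \<le> \<epsilon> \<and> loewner_ge (H x) (- sqrt (\<rho> * \<epsilon>) *\<^sub>R mat 1)}"
  define Q where "Q K \<longleftrightarrow> real (hvp_evals CARD('n) \<beta> \<rho> \<epsilon> \<delta> K) \<le> O1 * (c * w) * log_factor CARD('n) \<delta> (c * w) \<and>
    real (cr_calls K) \<le> O1 * c \<and> real (gradient_evals K) \<le> O1 * c" for K
  define W where "W = {\<omega> \<in> space M. \<exists>K. halts_at g \<rho> \<epsilon> (\<lambda>k. y k \<omega>) K \<and> y (K - 1) \<omega> + final \<omega> \<in> S \<and> Q K}"
  have "closed S"
    unfolding S_def loewner_ge_def
    by (intro closed_Collect_conj closed_Collect_all closed_Collect_le continuous_intros continuous_gradient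
        continuous_on_matrix_vector_mult continuous_hessian)
  then have [measurable]: "S \<in> sets borel" by simp
  have "continuous_on UNIV g"
  proof (intro continuous_at_imp_continuous_on ballI)
    show "isCont g x" for x using gradient[of x] unfolding gderiv_def by (rule has_derivative_continuous)
  qed
  then have [measurable]: "g \<in> borel_measurable borel" by (rule borel_measurable_continuous_onI)
  note [measurable] = run.final_measurable
  have W_sets: "W \<in> sets M"
    unfolding W_def halts_at_def reaches_iteration_def insufficient_decrease_def by measurable
  have sub: "space M - (\<Union>k\<in>{1..N}. E k) \<subseteq> W"
  proof
    fix \<omega> assume \<omega>: "\<omega> \<in> space M - (\<Union>k\<in>{1..N}. E k)"
    then have \<omega>M: "\<omega> \<in> space M" by simp
    have g0: "g (y 0 \<omega>) - g\<^sub>s = D" using run.y_init[OF \<omega>M] by (simp add: D_def)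
    obtain K where K: "halts_at g \<rho> \<epsilon> (\<lambda>k. y k \<omega>) K" "1 \<le> K" "K \<le> N" "real K \<le> 1 + 12 * D / (\<rho> * r ^ 3)"
      and good: "(y (K - 1) \<omega>, u K \<omega>) \<notin> bad K \<Longrightarrow> \<exists>s\<in>cball 0 r. cubic_minimizer \<rho> (H (y (K - 1) \<omega>)) (dg (y (K - 1) \<omega>)) s"
      using halting_iteration[of \<epsilon> g\<^sub>s "\<lambda>k. y k \<omega>" \<delta> "\<lambda>k. u k \<omega>" N, OF eps(1) low run.y_step[OF \<omega>M]]
        N unfolding r_def[symmetric] g0 bad_def by blast
    have "\<omega> \<notin> E K" using \<omega> K by auto
    then obtain s where s: "norm s \<le> r" "cubic_minimizer \<rho> (H (y (K - 1) \<omega>)) (dg (y (K - 1) \<omega>)) s"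
      using good \<omega>M by (auto simp: E_def)
    let ?sol = "solve_quadratic (H (y (K - 1) \<omega>)) (dg (y (K - 1) \<omega>)) \<rho> \<beta> r (6 * \<rho> * r\<^sup>2)"
    \<comment> \<open>Solvability has to be shown before \<open>final\<close> is known to be a
      solution; outside the failure events the quadratic is strictly convex.\<close>
    have "?sol \<noteq> {}"
      by (rule Solve_Quadratic_accurate(1)[OF hessian_self_adjoint hessian_upper pos r(1) s(2,1)])
    then have "final \<omega> \<in> ?sol" using run.final_step[OF \<omega>M K(1)] unfolding r_def[symmetric] r(4) by blast
    from Solve_Quadratic_second_order_point[OF pos(1) r(1) s(2,1) this]
    have "y (K - 1) \<omega> + final \<omega> \<in> S" unfolding r(2,3) by (simp add: S_def)
    moreover have "Q K"
    proof -
      have "real K \<le> 1 + 324 * c" using K(4) unfolding r(5) c_def .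
      then have Kc: "real K \<le> 325 * c" using c by simp
      have "real (hvp_evals CARD('n) \<beta> \<rho> \<epsilon> \<delta> K) \<le> O1 * (c * w) * log_factor CARD('n) \<delta> (c * w)"
        by (rule hvp_evals_le[OF pos(2) eps(1) delta _ w w2[unfolded r_def] c K(2) Kc]) (simp add: Suc_le_eq)
      then show ?thesis using Kc c by (simp add: Q_def O1_def cr_calls_def gradient_evals_def)
    qed
    ultimately show "\<omega> \<in> W" using K(1) \<omega>M by (auto simp: W_def)
  qed
  have "1 - \<delta> \<le> 1 - run.prob (\<Union>k\<in>{1..N}. E k)" using bad_le by simp
  also have "\<dots> = run.prob (space M - (\<Union>k\<in>{1..N}. E k))"
    using E(1) by (subst run.prob_compl) auto
  also have "\<dots> \<le> run.prob W" using sub W_sets by (rule run.finite_measure_mono)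
  finally show ?thesis
    unfolding Let_def s c' W_def S_def Q_def mem_Collect_eq conj_assoc .
qed

end
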